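(* Let $F$ be a field of characteristic different from $2$ and $3$, let $\mathbb{M}$ be a $7$-dimensional exceptional Malcev algebra over $F$, and let $\mathcal{M}$ be a Malcev algebra over $F$ in the variety $\mathcal{H}$ such that $\mathcal{M}$ contains $\mathbb{M}$ as a subalgebra and $m\mathbb{M}\neq 0$ for every nonzero $m\in\mathcal{M}$. Then $\mathcal{M}\cong \mathbb{M}\otimes_F \mathcal{U}$ (as $F$-algebras) for a certain commutative associative $F$-algebra $\mathcal{U}$.
   Context: A Malcev algebra over $F$ is an $F$-vector space with a bilinear product $(x,y)\mapsto xy$ satisfying $x^2=0$ and $J(x,y,xz)=J(x,y,z)x$, where $J(x,y,z)=(xy)z+(yz)x+(zx)y$. No finite-dimensionality is assumed. Put $\{x,y,z\}=(xy)z-(xz)y+2x(yz)$ and $$h(y,z,t,x,u)=\{yz,t,u\}x+\{yz,t,x\}u+\{yx,z,u\}t+\{yu,z,x\}t.$$ The variety $\mathcal{H}$ is the class of Malcev algebras over $F$ satisfying the identity $h(y,z,t,x,u)=0$. The exceptional algebra $\mathbb{M}$: it denotes either of the following $7$-dimensional simple non-Lie Malcev algebras. (1) $\mathcal{M}_7(F)=C(F)^{(-)}/F\cdot e_0$, where $C(F)$ is the split Cayley-Dickson matrix algebra of matrices $\begin{bmatrix} a&\alpha\\ \beta&b\end{bmatrix}$ with $a,b\in F$, $\alpha,\beta\in F^3$, entrywise addition, and product $$\begin{bmatrix} a&\alpha\\ \beta&b\end{bmatrix}\begin{bmatrix} c&\gamma\\ \delta&d\end{bmatrix}=\begin{bmatrix}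 ac+\alpha\bullet\delta & a\gamma+d\alpha-\beta\times\delta\\ c\beta+b\delta+\alpha\times\gamma & \beta\bullet\gamma+bd\end{bmatrix}$$ ($\bullet$ the scalar product, $\times$ the vector product on $F^3$), $e_0$ is the identity matrix, and $A^{(-)}$ denotes the vector space $A$ with product $[x,y]=xy-yx$. (2) $\mathbb{M}_7=\mathbb{O}^{(-)}/F\cdot 1$, where $\mathbb{O}=\mathbb{H}\oplus v\mathbb{H}$ is a division Cayley-Dickson algebra over $F$ obtained from a division quaternion algebra $\mathbb{H}$ with basis $1,i,j,k$, $i^2=j^2=k^2=-1$, and canonical involution $a\mapsto\bar a$, with $v^2=\gamma\in F$, $\gamma\ne 0$, and $aw=w\bar a$ for $a\in\mathbb{H}$, $w\in v\mathbb{H}$, and $(ab)v=b(av)$, $v(ab)=(vb)a$, $(va)(vb)=\gamma b\bar a$ for $a,b\in\mathbb{H}$. The product on $\mathbb{M}\otimes_F\mathcal{U}$ is $(a\otimes u)(b\otimes w)=ab\otimes uw$. *)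

theory Defs
  imports "HOL-Analysis.Analysis" "HOL-Library.Poly_Mapping"
begin

section \<open>Algebras over a field\<close>

text \<open>
  A (not necessarily associative or unital) algebra over the field \<^typ>\<open>'f\<close> is a record with an
  explicit carrier set; the operations are only meaningful on the carrier.
\<close>

record ('f, 'a) alg =
  carrier :: "'a set"
  zero :: "'a"  (\<open>\<zero>\<index>\<close>)
  add :: "'a \<Rightarrow> 'a \<Rightarrow> 'a"  (infixl \<open>\<oplus>\<index>\<close> 65)
  smult :: "'f \<Rightarrow> 'a \<Rightarrow> 'a"  (infixr \<open>\<odot>\<index>\<close> 75)
  mult :: "'a \<Rightarrow> 'a \<Rightarrow> 'a"  (infixl \<open>\<otimes>\<index>\<close> 70)

locale algebra_over =
  fixes A :: "('f::field, 'a) alg" (structure)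
  assumes zero_closed: "\<zero> \<in> carrier A"
    and add_closed: "\<lbrakk>x \<in> carrier A; y \<in> carrier A\<rbrakk> \<Longrightarrow> x \<oplus> y \<in> carrier A"
    and smult_closed: "x \<in> carrier A \<Longrightarrow> c \<odot> x \<in> carrier A"
    and mult_closed: "\<lbrakk>x \<in> carrier A; y \<in> carrier A\<rbrakk> \<Longrightarrow> x \<otimes> y \<in> carrier A"
    and add_assoc: "\<lbrakk>x \<in> carrier A; y \<in> carrier A; z \<in> carrier A\<rbrakk>
      \<Longrightarrow> (x \<oplus> y) \<oplus> z = x \<oplus> (y \<oplus> z)"
    and add_comm: "\<lbrakk>x \<in> carrier A; y \<in> carrier A\<rbrakk> \<Longrightarrow> x \<oplus> y = y \<oplus> x"
    and zero_add: "x \<in> carrier A \<Longrightarrow> \<zero> \<oplus> x = x"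
    and add_inverse: "x \<in> carrier A \<Longrightarrow> \<exists>y\<in>carrier A. x \<oplus> y = \<zero>"
    and smult_add: "\<lbrakk>x \<in> carrier A; y \<in> carrier A\<rbrakk> \<Longrightarrow> c \<odot> (x \<oplus> y) = c \<odot> x \<oplus> c \<odot> y"
    and add_smult: "x \<in> carrier A \<Longrightarrow> (c + d) \<odot> x = c \<odot> x \<oplus> d \<odot> x"
    and smult_smult: "x \<in> carrier A \<Longrightarrow> c \<odot> (d \<odot> x) = (c * d) \<odot> x"
    and one_smult: "x \<in> carrier A \<Longrightarrow> 1 \<odot> x = x"
    and mult_add_left: "\<lbrakk>x \<in> carrier A; y \<in> carrier A; z \<in> carrier A\<rbrakk>
      \<Longrightarrow> (x \<oplus> y) \<otimes> z = x \<otimes> z \<oplus> y \<otimes> z"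
    and mult_add_right: "\<lbrakk>x \<in> carrier A; y \<in> carrier A; z \<in> carrier A\<rbrakk>
      \<Longrightarrow> z \<otimes> (x \<oplus> y) = z \<otimes> x \<oplus> z \<otimes> y"
    and mult_smult_left: "\<lbrakk>x \<in> carrier A; y \<in> carrier A\<rbrakk> \<Longrightarrow> (c \<odot> x) \<otimes> y = c \<odot> (x \<otimes> y)"
    and mult_smult_right: "\<lbrakk>x \<in> carrier A; y \<in> carrier A\<rbrakk> \<Longrightarrow> x \<otimes> (c \<odot> y) = c \<odot> (x \<otimes> y)"

locale comm_assoc_algebra = algebra_over +
  assumes mult_comm: "\<lbrakk>x \<in> carrier A; y \<in> carrier A\<rbrakk> \<Longrightarrow> x \<otimes> y = y \<otimes> x"
    and mult_assoc: "\<lbrakk>x \<in> carrier A; y \<in> carrier A; z \<in> carrier A\<rbrakk>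
      \<Longrightarrow> (x \<otimes> y) \<otimes> z = x \<otimes> (y \<otimes> z)"

definition type_alg :: "('f \<Rightarrow> 'a \<Rightarrow> 'a) \<Rightarrow> ('a \<Rightarrow> 'a \<Rightarrow> 'a) \<Rightarrow> ('f::field, 'a::ab_group_add) alg"
  where "type_alg s m =
    \<lparr>carrier = UNIV, zero = 0, add = (+), smult = s, mult = m\<rparr>"

definition subalgebra :: "'a set \<Rightarrow> ('f::field, 'a) alg \<Rightarrow> bool" where
  "subalgebra S A \<longleftrightarrow> S \<subseteq> carrier A \<and> \<zero>\<^bsub>A\<^esub> \<in> S
     \<and> (\<forall>x\<in>S. \<forall>y\<in>S. x \<oplus>\<^bsub>A\<^esub> y \<in> S \<and> x \<otimes>\<^bsub>A\<^esub> y \<in> S)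
     \<and> (\<forall>c. \<forall>x\<in>S. c \<odot>\<^bsub>A\<^esub> x \<in> S)"

definition alg_iso :: "('f::field, 'a) alg \<Rightarrow> ('f, 'b) alg \<Rightarrow> bool"  (infix \<open>\<cong>\<close> 50) where
  "A \<cong> B \<longleftrightarrow> (\<exists>\<phi>. bij_betw \<phi> (carrier A) (carrier B)
     \<and> (\<forall>x\<in>carrier A. \<forall>y\<in>carrier A. \<phi> (x \<oplus>\<^bsub>A\<^esub> y) = \<phi> x \<oplus>\<^bsub>B\<^esub> \<phi> y)
     \<and> (\<forall>c. \<forall>x\<in>carrier A. \<phi> (c \<odot>\<^bsub>A\<^esub> x) = c \<odot>\<^bsub>B\<^esub> \<phi> x)
     \<and> (\<forall>x\<in>carrier A. \<forall>y\<in>carrier A. \<phi> (x \<otimes>\<^bsub>A\<^esub> y) = \<phi> x \<otimes>\<^bsub>B\<^esub> \<phi> y))"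

definition alg_minus :: "('f::field, 'a) alg \<Rightarrow> 'a \<Rightarrow> 'a \<Rightarrow> 'a"  (infixl \<open>\<ominus>\<index>\<close> 65) where
  "x \<ominus>\<^bsub>A\<^esub> y = x \<oplus>\<^bsub>A\<^esub> (-1) \<odot>\<^bsub>A\<^esub> y"

definition commutator_alg :: "('f::field, 'a) alg \<Rightarrow> ('f, 'a) alg" where
  "commutator_alg A = A\<lparr>mult := \<lambda>x y. x \<otimes>\<^bsub>A\<^esub> y \<ominus>\<^bsub>A\<^esub> y \<otimes>\<^bsub>A\<^esub> x\<rparr>"

definition alg_coset :: "('f::field, 'a) alg \<Rightarrow> 'a set \<Rightarrow> 'a \<Rightarrow> 'a set" where
  "alg_coset A I x = {x \<oplus>\<^bsub>A\<^esub> y | y. y \<in> I}"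

text \<open>
  The quotient by an ideal \<open>I\<close>. The unions below are taken over families of equal cosets, so they
  are the usual operations on representatives.
\<close>

definition quotient_alg :: "('f::field, 'a) alg \<Rightarrow> 'a set \<Rightarrow> ('f, 'a set) alg" where
  "quotient_alg A I =
    \<lparr>carrier = alg_coset A I ` carrier A,
     zero = alg_coset A I \<zero>\<^bsub>A\<^esub>,
     add = (\<lambda>X Y. \<Union>x\<in>X. \<Union>y\<in>Y. alg_coset A I (x \<oplus>\<^bsub>A\<^esub> y)),
     smult = (\<lambda>c X. \<Union>x\<in>X. alg_coset A I (c \<odot>\<^bsub>A\<^esub> x)),
     mult = (\<lambda>X Y. \<Union>x\<in>X. \<Union>y\<in>Y. alg_coset A I (x \<otimes>\<^bsub>A\<^esub> y))\<rparr>"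

definition division_alg :: "('f::field, 'a) alg \<Rightarrow> bool" where
  "division_alg A \<longleftrightarrow> (\<forall>a\<in>carrier A - {\<zero>\<^bsub>A\<^esub>}. \<forall>b\<in>carrier A.
     (\<exists>!x. x \<in> carrier A \<and> a \<otimes>\<^bsub>A\<^esub> x = b) \<and> (\<exists>!y. y \<in> carrier A \<and> y \<otimes>\<^bsub>A\<^esub> a = b))"


section \<open>The tensor product of two algebras\<close>

text \<open>
  The underlying space is the quotient of the free vector space on \<open>A \<times> B\<close> (finitely supported
  functions) by the subspace spanned by the bilinearity relations; the basis vector at \<open>(a, u)\<close>
  becomes the pure tensor of \<open>a\<close> and \<open>u\<close>. The product of the free vector space is the bilinear
  extension of \<open>(a, u) (b, w) = (a b, u w)\<close>.
\<close>

definition free_smult :: "'f::field \<Rightarrow> ('x \<Rightarrow>\<^sub>0 'f) \<Rightarrow> ('x \<Rightarrow>\<^sub>0 'f)" where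
  "free_smult c = Poly_Mapping.map ((*) c)"

definition free_prod_alg ::
  "('f::field, 'a) alg \<Rightarrow> ('f, 'b) alg \<Rightarrow> ('f, ('a \<times> 'b) \<Rightarrow>\<^sub>0 'f) alg" where
  "free_prod_alg A B =
    \<lparr>carrier = {f. Poly_Mapping.keys f \<subseteq> carrier A \<times> carrier B},
     zero = 0,
     add = (+),
     smult = free_smult,
     mult = (\<lambda>f g. \<Sum>p\<in>Poly_Mapping.keys f. \<Sum>q\<in>Poly_Mapping.keys g.
        Poly_Mapping.single (fst p \<otimes>\<^bsub>A\<^esub> fst q, snd p \<otimes>\<^bsub>B\<^esub> snd q)
          (Poly_Mapping.lookup f p * Poly_Mapping.lookup g q))\<rparr>"

abbreviation basis_pair :: "'a \<Rightarrow> 'b \<Rightarrow> ('a \<times> 'b) \<Rightarrow>\<^sub>0 'f::field" where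
  "basis_pair a u \<equiv> Poly_Mapping.single (a, u) 1"

definition bilinear_relations ::
  "('f::field, 'a) alg \<Rightarrow> ('f, 'b) alg \<Rightarrow> (('a \<times> 'b) \<Rightarrow>\<^sub>0 'f) set" where
  "bilinear_relations A B =
     {basis_pair (a \<oplus>\<^bsub>A\<^esub> a') u - basis_pair a u - basis_pair a' u | a a' u.
        a \<in> carrier A \<and> a' \<in> carrier A \<and> u \<in> carrier B}
   \<union> {basis_pair a (u \<oplus>\<^bsub>B\<^esub> u') - basis_pair a u - basis_pair a u' | a u u'.
        a \<in> carrier A \<and> u \<in> carrier B \<and> u' \<in> carrier B}
   \<union> {basis_pair (c \<odot>\<^bsub>A\<^esub> a) u - free_smult c (basis_pair a u) | c a u. a \<in> carrier A \<and> u \<in> carrier B}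
   \<union> {basis_pair a (c \<odot>\<^bsub>B\<^esub> u) - free_smult c (basis_pair a u) | c a u. a \<in> carrier A \<and> u \<in> carrier B}"

definition tensor_alg ::
  "('f::field, 'a) alg \<Rightarrow> ('f, 'b) alg \<Rightarrow> ('f, (('a \<times> 'b) \<Rightarrow>\<^sub>0 'f) set) alg" where
  "tensor_alg A B =
     quotient_alg (free_prod_alg A B) (module.span free_smult (bilinear_relations A B))"

text \<open>The library's \<^const>\<open>module.span\<close> applies to \<^const>\<open>free_smult\<close>.\<close>

lemma lookup_free_smult: "Poly_Mapping.lookup (free_smult c f) x = c * Poly_Mapping.lookup f x"
  by (simp add: free_smult_def map.rep_eq when_def)

lemma vector_space_free_smult: "vector_space (free_smult :: 'f::field \<Rightarrow> ('x \<Rightarrow>\<^sub>0 'f) \<Rightarrow> _)"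
  by standard
    (simp_all add: poly_mapping_eq_iff fun_eq_iff lookup_free_smult lookup_add algebra_simps)


section \<open>Malcev algebras and the variety\<close>

definition jacobian :: "('f::field, 'a) alg \<Rightarrow> 'a \<Rightarrow> 'a \<Rightarrow> 'a \<Rightarrow> 'a" where
  "jacobian A x y z =
     (x \<otimes>\<^bsub>A\<^esub> y) \<otimes>\<^bsub>A\<^esub> z \<oplus>\<^bsub>A\<^esub> (y \<otimes>\<^bsub>A\<^esub> z) \<otimes>\<^bsub>A\<^esub> x \<oplus>\<^bsub>A\<^esub> (z \<otimes>\<^bsub>A\<^esub> x) \<otimes>\<^bsub>A\<^esub> y"

locale malcev_algebra = algebra_over +
  assumes square_zero: "x \<in> carrier A \<Longrightarrow> x \<otimes> x = \<zero>"
    and malcev: "\<lbrakk>x \<in> carrier A; y \<in> carrier A; z \<in> carrier A\<rbrakk>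
      \<Longrightarrow> jacobian A x y (x \<otimes> z) = jacobian A x y z \<otimes> x"

definition triple_expr :: "('f::field, 'a) alg \<Rightarrow> 'a \<Rightarrow> 'a \<Rightarrow> 'a \<Rightarrow> 'a" where
  "triple_expr A x y z =
     (x \<otimes>\<^bsub>A\<^esub> y) \<otimes>\<^bsub>A\<^esub> z \<ominus>\<^bsub>A\<^esub> (x \<otimes>\<^bsub>A\<^esub> z) \<otimes>\<^bsub>A\<^esub> y \<oplus>\<^bsub>A\<^esub> 2 \<odot>\<^bsub>A\<^esub> (x \<otimes>\<^bsub>A\<^esub> (y \<otimes>\<^bsub>A\<^esub> z))"

definition h_expr :: "('f::field, 'a) alg \<Rightarrow> 'a \<Rightarrow> 'a \<Rightarrow> 'a \<Rightarrow> 'a \<Rightarrow> 'a \<Rightarrow> 'a" where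
  "h_expr A y z t x u =
     triple_expr A (y \<otimes>\<^bsub>A\<^esub> z) t u \<otimes>\<^bsub>A\<^esub> x \<oplus>\<^bsub>A\<^esub> triple_expr A (y \<otimes>\<^bsub>A\<^esub> z) t x \<otimes>\<^bsub>A\<^esub> u
     \<oplus>\<^bsub>A\<^esub> triple_expr A (y \<otimes>\<^bsub>A\<^esub> x) z u \<otimes>\<^bsub>A\<^esub> t \<oplus>\<^bsub>A\<^esub> triple_expr A (y \<otimes>\<^bsub>A\<^esub> u) z x \<otimes>\<^bsub>A\<^esub> t"

locale variety_H = malcev_algebra +
  assumes h_zero: "\<lbrakk>y \<in> carrier A; z \<in> carrier A; t \<in> carrier A; x \<in> carrier A; u \<in> carrier A\<rbrakk>
    \<Longrightarrow> h_expr A y z t x u = \<zero>"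


section \<open>The exceptional algebras\<close>

subsection \<open>The split case\<close>

definition dot3 :: "'f::field ^ 3 \<Rightarrow> 'f ^ 3 \<Rightarrow> 'f"  (infixl \<open>\<bullet>\<^sub>3\<close> 70) where
  "x \<bullet>\<^sub>3 y = (\<Sum>i\<in>UNIV. x $ i * y $ i)"

definition vprod3 :: "'f::field ^ 3 \<Rightarrow> 'f ^ 3 \<Rightarrow> 'f ^ 3"  (infixl \<open>\<times>\<^sub>3\<close> 70) where
  "x \<times>\<^sub>3 y = vector [x$2 * y$3 - x$3 * y$2, x$3 * y$1 - x$1 * y$3, x$1 * y$2 - x$2 * y$1]"

text \<open>\<open>CD a \<alpha> \<beta> b\<close> is the matrix with rows \<open>a \<alpha>\<close> and \<open>\<beta> b\<close>.\<close>

datatype 'f cd_matrix = CD 'f "'f ^ 3" "'f ^ 3" 'f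

fun cd_add :: "'f::field cd_matrix \<Rightarrow> 'f cd_matrix \<Rightarrow> 'f cd_matrix" where
  "cd_add (CD a \<alpha> \<beta> b) (CD c \<gamma> \<delta> d) = CD (a + c) (\<alpha> + \<gamma>) (\<beta> + \<delta>) (b + d)"

fun cd_smult :: "'f::field \<Rightarrow> 'f cd_matrix \<Rightarrow> 'f cd_matrix" where
  "cd_smult k (CD a \<alpha> \<beta> b) = CD (k * a) (k *s \<alpha>) (k *s \<beta>) (k * b)"

fun cd_mult :: "'f::field cd_matrix \<Rightarrow> 'f cd_matrix \<Rightarrow> 'f cd_matrix" where
  "cd_mult (CD a \<alpha> \<beta> b) (CD c \<gamma> \<delta> d) =
     CD (a * c + \<alpha> \<bullet>\<^sub>3 \<delta>) (a *s \<gamma> + d *s \<alpha> - \<beta> \<times>\<^sub>3 \<delta>)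
        (c *s \<beta> + b *s \<delta> + \<alpha> \<times>\<^sub>3 \<gamma>) (\<beta> \<bullet>\<^sub>3 \<gamma> + b * d)"

definition split_cd_alg :: "('f::field, 'f cd_matrix) alg" where
  "split_cd_alg =
    \<lparr>carrier = UNIV, zero = CD 0 0 0 0, add = cd_add, smult = cd_smult, mult = cd_mult\<rparr>"

definition split_M7 :: "('f::field, 'f cd_matrix set) alg" where
  "split_M7 = quotient_alg (commutator_alg split_cd_alg) {cd_smult c (CD 1 0 0 1) | c. True}"

subsection \<open>The division case\<close>

text \<open>\<open>Quat a b c d\<close> is \<open>a + b i + c j + d k\<close>, with \<open>i\<^sup>2 = j\<^sup>2 = k\<^sup>2 = -1\<close> and \<open>i j = k = - j i\<close>.\<close>

datatype 'f quat = Quat 'f 'f 'f 'f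

fun quat_add :: "'f::field quat \<Rightarrow> 'f quat \<Rightarrow> 'f quat" where
  "quat_add (Quat a b c d) (Quat a' b' c' d') = Quat (a + a') (b + b') (c + c') (d + d')"

fun quat_smult :: "'f::field \<Rightarrow> 'f quat \<Rightarrow> 'f quat" where
  "quat_smult r (Quat a b c d) = Quat (r * a) (r * b) (r * c) (r * d)"

fun quat_mult :: "'f::field quat \<Rightarrow> 'f quat \<Rightarrow> 'f quat" where
  "quat_mult (Quat a b c d) (Quat a' b' c' d') =
     Quat (a * a' - b * b' - c * c' - d * d')
          (a * b' + b * a' + c * d' - d * c')
          (a * c' - b * d' + c * a' + d * b')
          (a * d' + b * c' - c * b' + d * a')"

fun quat_conj :: "'f::field quat \<Rightarrow> 'f quat" where
  "quat_conj (Quat a b c d) = Quat a (- b) (- c) (- d)"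

definition quat_alg :: "('f::field, 'f quat) alg" where
  "quat_alg = \<lparr>carrier = UNIV, zero = Quat 0 0 0 0, add = quat_add, smult = quat_smult,
     mult = quat_mult\<rparr>"

text \<open>
  The pair \<open>(a, b)\<close> stands for \<open>a + v b\<close>. The product formula
  \<open>(a + v b)(c + v d) = (a c + \<gamma> d b\<^sup>*) + v (a\<^sup>* d + c b)\<close>, with \<open>\<^sup>*\<close> the canonical involution, is
  forced by the defining relations of the Cayley-Dickson process: \<open>a (v d) = (v d) a\<^sup>* = v (a\<^sup>* d)\<close>,
  \<open>(v b) c = v (c b)\<close> and \<open>(v b)(v d) = \<gamma> d b\<^sup>*\<close>.
\<close>

fun oct_add :: "'f::field quat \<times> 'f quat \<Rightarrow> 'f quat \<times> 'f quat \<Rightarrow> 'f quat \<times> 'f quat" where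
  "oct_add (a, b) (c, d) = (quat_add a c, quat_add b d)"

fun oct_smult :: "'f::field \<Rightarrow> 'f quat \<times> 'f quat \<Rightarrow> 'f quat \<times> 'f quat" where
  "oct_smult r (a, b) = (quat_smult r a, quat_smult r b)"

fun oct_mult :: "'f::field \<Rightarrow> 'f quat \<times> 'f quat \<Rightarrow> 'f quat \<times> 'f quat \<Rightarrow> 'f quat \<times> 'f quat" where
  "oct_mult \<gamma> (a, b) (c, d) =
     (quat_add (quat_mult a c) (quat_smult \<gamma> (quat_mult d (quat_conj b))),
      quat_add (quat_mult (quat_conj a) d) (quat_mult c b))"

definition oct_alg :: "'f::field \<Rightarrow> ('f, 'f quat \<times> 'f quat) alg" where
  "oct_alg \<gamma> = \<lparr>carrier = UNIV, zero = (Quat 0 0 0 0, Quat 0 0 0 0), add = oct_add,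
     smult = oct_smult, mult = oct_mult \<gamma>\<rparr>"

definition division_M7 :: "'f::field \<Rightarrow> ('f, ('f quat \<times> 'f quat) set) alg" where
  "division_M7 \<gamma> = quotient_alg (commutator_alg (oct_alg \<gamma>))
     {oct_smult c (Quat 1 0 0 0, Quat 0 0 0 0) | c. True}"

definition exceptional :: "('f::field, 'a) alg \<Rightarrow> bool" where
  "exceptional A \<longleftrightarrow> A \<cong> split_M7 \<or>
     (\<exists>\<gamma>. \<gamma> \<noteq> 0 \<and> division_alg (quat_alg :: ('f, _) alg) \<and> division_alg (oct_alg \<gamma>)
        \<and> A \<cong> division_M7 \<gamma>)"

end

theory Submission
  imports Defs
begin

text \<open>
  Write \<open>m a b\<close> for \<open>(m a) b\<close> and regard \<open>M\<close> as a module over its exceptional subalgebra. Both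
  exceptional algebras have a basis \<open>e\<^sub>1, \<dots>, e\<^sub>7\<close> of imaginary octonion units: indices are nonzero
  bit vectors of length three, \<open>e\<^sub>i e\<^sub>j\<close> is a nonzero multiple of \<open>e\<^bsub>i XOR j\<^esub>\<close> for \<open>i \<noteq> j\<close>, and
  the coefficients are those of the octonions with \<open>i\<^sup>2 = j\<^sup>2 = k\<^sup>2 = -1\<close> and \<open>v\<^sup>2 = \<gamma>\<close>; the split
  algebra is the case \<open>\<gamma> = 1\<close>. The locale \<open>octonion_frame\<close> records such a basis, acting without
  common kernel.

  The first half of the proof shows that \<open>M\<close> is a direct sum of regular modules. Sagle's form of
  the Malcev identity, with one argument in \<open>M\<close> and three in the subalgebra, gives cubic relations
  between the right multiplications. The identity \<open>h(m, a, t, a, a) = 0\<close> adds one relation, and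
  together they rewrite \<open>m a a t\<close>, \<open>m a t a\<close> and \<open>m t a a\<close>, for orthogonal units \<open>a\<close>, \<open>t\<close>, into
  shorter words (\<open>left_square\<close>, \<open>sandwich\<close>, \<open>right_square\<close>). Comparing the three lines of the Fano
  plane through a point yields \<open>m e\<^sub>w e\<^sub>w e\<^sub>w = -4 n\<^sub>w (m e\<^sub>w)\<close> (\<open>cube\<close>), so that
  \<open>1 + e\<^sub>w\<^sup>2 / (4 n\<^sub>w)\<close> projects onto the kernel of \<open>e\<^sub>w\<close>, here called the component of \<open>w\<close>. On a
  component all products with two basis elements are those of the regular module
  (\<open>component_square\<close>, \<open>component_mul_indep\<close>), and the seven projections add up to the identity
  (\<open>decomposition\<close>). In both places a vector that all basis elements annihilate has to vanish;
  this is where the assumption \<open>m S \<noteq> 0\<close> enters. With \<open>U\<close> the component of \<open>1\<close>, it follows that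
  \<open>M\<close> consists of seven copies of \<open>U\<close>, embedded by \<open>embed 1, \<dots>, embed 7\<close>.

  The second half determines the product. Sagle's identity with two arguments in \<open>M\<close> shows that a
  component squares to zero and that the product of the components of \<open>i \<noteq> j\<close> lies in that of
  \<open>i XOR j\<close> (\<open>component_square_zero\<close>, \<open>component_product\<close>), and that the resulting bilinear map
  \<open>U \<times> U \<rightarrow> U\<close> is the same for all pairs \<open>i \<noteq> j\<close> (\<open>coeff_eq_uprod\<close>). Skew-symmetry makes this map
  commutative, and Sagle's identity with three arguments in \<open>M\<close> makes it associative
  (\<open>uprod_assoc\<close>). Finally the evaluation \<open>a \<otimes> u \<mapsto> pure_tensor a u\<close> on the free vector space is
  multiplicative, and its kernel is exactly the span of the bilinearity relations
  (\<open>span_relations\<close>), which identifies \<open>M\<close> with the tensor product.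
\<close>

section \<open>Linear forms\<close>

text \<open>
  Identities between vectors are proved below by applying an arbitrary linear form: the claim then
  becomes a polynomial identity in the scalars, with the values of the form on the monomials of
  the algebra as indeterminates, which is decided by ring normalisation.
\<close>

definition linear_form :: "('f::field \<Rightarrow> 'm::ab_group_add \<Rightarrow> 'm) \<Rightarrow> ('m \<Rightarrow> 'f) \<Rightarrow> bool" where
  "linear_form s g \<longleftrightarrow> (\<forall>x y. g (x + y) = g x + g y) \<and> (\<forall>c x. g (s c x) = c * g x)"

text \<open>
  Coordinate functionals with respect to a basis separate points.
\<close>

lemma (in vector_space) vector_eqI:
  assumes "\<And>g. linear_form scale g \<Longrightarrow> g x = g y"
  shows "x = y"
proof -
  define B where "B = extend_basis {}"
  have B: "independent B" "span B = UNIV"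
    unfolding B_def using independent_extend_basis span_extend_basis independent_empty by blast+
  have "linear_form scale (\<lambda>v. representation B v b)" for b
    by (simp add: linear_form_def representation_add[OF B(1)] representation_scale[OF B(1)] B(2))
  then have "representation B x = representation B y"
    using assms by (intro ext) blast
  then show ?thesis
    by (metis B UNIV_I sum_nonzero_representation_eq)
qed

section \<open>Anticommutative algebras and the Sagle identity\<close>

locale anticommutative_algebra = vector_space scale
  for scale :: "'f::field \<Rightarrow> 'm::ab_group_add \<Rightarrow> 'm" (infixr "\<cdot>" 75) +
  fixes mul :: "'m \<Rightarrow> 'm \<Rightarrow> 'm" (infixl "\<star>" 70)
  assumes two: "(2::'f) \<noteq> 0" and three: "(3::'f) \<noteq> 0"
    and mul_add_left: "(x + y) \<star> z = x \<star> z + y \<star> z"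
    and mul_add_right: "z \<star> (x + y) = z \<star> x + z \<star> y"
    and mul_scale_left: "(c \<cdot> x) \<star> y = c \<cdot> (x \<star> y)"
    and mul_scale_right: "x \<star> (c \<cdot> y) = c \<cdot> (x \<star> y)"
    and mul_self: "x \<star> x = 0"
begin

lemma four: "(4::'f) \<noteq> 0"
  and six: "(6::'f) \<noteq> 0"
  and eight: "(8::'f) \<noteq> 0"
  and nine: "(9::'f) \<noteq> 0"
  and eighteen: "(18::'f) \<noteq> 0"
proof -
  have "(4::'f) = 2 * 2" "(6::'f) = 2 * 3" "(8::'f) = 2 * (2 * 2)" "(9::'f) = 3 * 3"
      "(18::'f) = 2 * (3 * 3)"
    by simp_all
  then show "(4::'f) \<noteq> 0" "(6::'f) \<noteq> 0" "(8::'f) \<noteq> 0" "(9::'f) \<noteq> 0" "(18::'f) \<noteq> 0"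
    using two three by (metis mult_eq_0_iff)+
qed

lemma mul_zero_left: "0 \<star> x = 0" by (metis mul_scale_left scale_zero_left)
lemma mul_zero_right: "x \<star> 0 = 0" by (metis mul_scale_right scale_zero_left)
lemma mul_minus_left: "(- x) \<star> y = - (x \<star> y)"
  by (metis add.right_inverse mul_add_left mul_zero_left eq_neg_iff_add_eq_0 add.commute)
lemma mul_minus_right: "x \<star> (- y) = - (x \<star> y)"
  by (metis add.right_inverse mul_add_right mul_zero_right eq_neg_iff_add_eq_0 add.commute)
lemma mul_diff_left: "(x - y) \<star> z = x \<star> z - y \<star> z"
  using mul_add_left[of x "- y" z] by (simp add: mul_minus_left)
lemma mul_diff_right: "z \<star> (x - y) = z \<star> x - z \<star> y"
  using mul_add_right[of z x "- y"] by (simp add: mul_minus_right)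

lemmas bilinear = mul_add_left mul_add_right mul_scale_left mul_scale_right mul_zero_left mul_zero_right
  mul_minus_left mul_minus_right mul_diff_left mul_diff_right

lemma anticomm: "x \<star> y = - (y \<star> x)"
proof -
  have "(x + y) \<star> (x + y) = 0" by (rule mul_self)
  then have "x \<star> y + y \<star> x = 0"
    unfolding mul_add_left mul_add_right by (simp add: mul_self add.commute)
  then show ?thesis by (simp add: eq_neg_iff_add_eq_0)
qed

lemma linear_form_simps:
  assumes "linear_form scale g"
  shows "g (x + y) = g x + g y" "g (c \<cdot> x) = c * g x" "g (x - y) = g x - g y" "g (- x) = - g x"
      "g 0 = 0"
proof -
  show a: "g (x + y) = g x + g y" for x y using assms by (simp add: linear_form_def)
  show b: "g (c \<cdot> x) = c * g x" for c x using assms by (simp add: linear_form_def)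
  show "g 0 = 0" using b[of 0 0] by simp
  show m: "g (- x) = - g x" for x using b[of "-1" x] by simp
  show "g (x - y) = g x - g y" using a[of x "- y"] m by simp
qed

text \<open>
  The Malcev identity, linearised in its repeated variable, is an identity in four variables.
  Sagle's identity is half of a signed sum of three of its instances.
\<close>

lemma sagle_identity:
  assumes malcev: "\<And>x y z. x \<star> y \<star> (x \<star> z) + y \<star> (x \<star> z) \<star> x + x \<star> z \<star> x \<star> y
    = (x \<star> y \<star> z + y \<star> z \<star> x + z \<star> x \<star> y) \<star> x"
  shows "(x \<star> z) \<star> (y \<star> t) =
      x \<star> y \<star> z \<star> t + y \<star> z \<star> t \<star> x + z \<star> t \<star> x \<star> y + t \<star> x \<star> y \<star> z"
proof -
  have N: "(x \<star> y) \<star> (x \<star> z) = x \<star> y \<star> z \<star> x + y \<star> z \<star> x \<star> x + z \<star> x \<star> x \<star> y" for x y z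
  proof -
    have 1: "y \<star> (x \<star> z) = z \<star> x \<star> y" by (metis anticomm mul_minus_left)
    have 2: "x \<star> z \<star> x \<star> y = - (z \<star> x \<star> x \<star> y)" by (metis anticomm mul_minus_left)
    show ?thesis using malcev[of x y z] unfolding 1 2 mul_add_left by (simp add: algebra_simps)
  qed
  \<comment> \<open>the polarisation of \<open>N\<close> in \<open>x\<close>\<close>
  have M: "(x \<star> y) \<star> (w \<star> z) + (w \<star> y) \<star> (x \<star> z) = x \<star> y \<star> z \<star> w + w \<star> y \<star> z \<star> x
    + y \<star> z \<star> x \<star> w + y \<star> z \<star> w \<star> x + z \<star> x \<star> w \<star> y + z \<star> w \<star> x \<star> y" for x y z w
  proof (rule vector_eqI)
    fix g assume g: "linear_form scale g"
    show "g ((x \<star> y) \<star> (w \<star> z) + (w \<star> y) \<star> (x \<star> z)) = g (x \<star> y \<star> z \<star> w + w \<star> y \<star> z \<star> x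
        + y \<star> z \<star> x \<star> w + y \<star> z \<star> w \<star> x + z \<star> x \<star> w \<star> y + z \<star> w \<star> x \<star> y)"
      using arg_cong[OF N[of "x + w" y z], of g] arg_cong[OF N[of x y z], of g]
          arg_cong[OF N[of w y z], of g]
      unfolding mul_add_left mul_add_right linear_form_simps[OF g] by algebra
  qed
  have P: "x \<star> t \<star> (z \<star> y) = y \<star> z \<star> (x \<star> t)" "t \<star> y \<star> (x \<star> z) = x \<star> z \<star> (y \<star> t)"
      "x \<star> y \<star> (t \<star> z) = z \<star> t \<star> (x \<star> y)"
    by (metis anticomm mul_minus_right)+
  have Q: "x \<star> z \<star> t \<star> y = - (z \<star> x \<star> t \<star> y)" "x \<star> t \<star> y \<star> z = - (t \<star> x \<star> y \<star> z)"
      "y \<star> x \<star> z \<star> t = - (x \<star> y \<star> z \<star> t)"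
    by (metis anticomm mul_minus_left)+
  have "2 \<cdot> ((x \<star> z) \<star> (y \<star> t)) =
      2 \<cdot> (x \<star> y \<star> z \<star> t + y \<star> z \<star> t \<star> x + z \<star> t \<star> x \<star> y + t \<star> x \<star> y \<star> z)" (is "2 \<cdot> ?l = 2 \<cdot> ?r")
  proof (rule vector_eqI)
    fix g assume g: "linear_form scale g"
    show "g (2 \<cdot> ?l) = g (2 \<cdot> ?r)"
      using arg_cong[OF M[where x = x and w = y and y = z and z = t], of g]
        arg_cong[OF M[where x = x and w = z and y = t and z = y], of g]
        arg_cong[OF M[where x = t and w = x and y = y and z = z], of g]
      unfolding P Q linear_form_simps[OF g] by algebra
  qed
  then show ?thesis using two by (metis scale_left_imp_eq)
qed

end

text \<open>
  The assumption \<open>h_diag\<close> is the identity \<open>h(m, a, t, a, a) = 0\<close> after cancelling a factor \<open>2\<close>: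
  the two terms that contain \<open>{m a, a, a}\<close> vanish.
\<close>

locale sagle_space = anticommutative_algebra scale mul
  for scale :: "'f::field \<Rightarrow> 'm::ab_group_add \<Rightarrow> 'm" (infixr "\<cdot>" 75)
  and mul :: "'m \<Rightarrow> 'm \<Rightarrow> 'm" (infixl "\<star>" 70) +
  assumes sagle: "(x \<star> z) \<star> (y \<star> t) =
      x \<star> y \<star> z \<star> t + y \<star> z \<star> t \<star> x + z \<star> t \<star> x \<star> y + t \<star> x \<star> y \<star> z"
    and h_diag: "(m \<star> a \<star> t \<star> a - m \<star> a \<star> a \<star> t + 2 \<cdot> (m \<star> a \<star> (t \<star> a))) \<star> a = 0"
begin

text \<open>
  With \<open>m\<close> moved to the front, Sagle's identity becomes a relation between operators on \<open>m\<close>. The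
  module structure of \<open>M\<close> uses the identity only in this form.
\<close>

lemma op_sagle: "m \<star> y \<star> z \<star> t - m \<star> t \<star> y \<star> z = m \<star> z \<star> (y \<star> t) + m \<star> (z \<star> t) \<star> y + m \<star> (y \<star> z \<star> t)"
proof -
  have 1: "y \<star> z \<star> t \<star> m = - (m \<star> (y \<star> z \<star> t))" by (rule anticomm)
  have 2: "z \<star> t \<star> m \<star> y = - (m \<star> (z \<star> t) \<star> y)" by (metis anticomm mul_minus_left)
  have 3: "t \<star> m \<star> y \<star> z = - (m \<star> t \<star> y \<star> z)" by (metis anticomm mul_minus_left)
  show ?thesis
    using sagle[of m z y t] unfolding 1 2 3 by (simp add: algebra_simps)
qed

section \<open>Right multiplications by an orthogonal pair\<close>

text \<open>
  Orthogonal imaginary units \<open>a\<close>, \<open>t\<close> with octonion product \<open>c\<close> and norms \<open>\<alpha>\<close>, \<open>\<beta>\<close> span, together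
  with \<open>c\<close>, the imaginary part of a quaternion algebra. The factor \<open>2\<close> comes from the commutator.
\<close>

definition orth_pair :: "'m \<Rightarrow> 'm \<Rightarrow> 'm \<Rightarrow> 'f \<Rightarrow> 'f \<Rightarrow> bool" where
  "orth_pair a t c \<alpha> \<beta> \<longleftrightarrow> a \<star> t = 2 \<cdot> c \<and> c \<star> a = (2 * \<alpha>) \<cdot> t \<and> t \<star> c = (2 * \<beta>) \<cdot> a \<and> \<alpha> \<noteq> 0 \<and> \<beta> \<noteq> 0"

lemma orth_pairD:
  assumes "orth_pair a t c \<alpha> \<beta>"
  shows "a \<star> t = 2 \<cdot> c" "t \<star> a = - (2 \<cdot> c)" "c \<star> a = (2 * \<alpha>) \<cdot> t" "a \<star> c = - ((2 * \<alpha>) \<cdot> t)"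
    "t \<star> c = (2 * \<beta>) \<cdot> a" "c \<star> t = - ((2 * \<beta>) \<cdot> a)" "\<alpha> \<noteq> 0" "\<beta> \<noteq> 0"
  using assms anticomm[of t a] anticomm[of a c] anticomm[of c t] unfolding orth_pair_def by auto

lemma orth_pair_next: assumes "orth_pair a t c \<alpha> \<beta>" shows "orth_pair a c ((- \<alpha>) \<cdot> t) \<alpha> (\<alpha> * \<beta>)"
  using orth_pairD[OF assms] by (simp add: orth_pair_def bilinear mult.assoc)

lemma orth_pair_swap: assumes "orth_pair a t c \<alpha> \<beta>" shows "orth_pair t a (- c) \<beta> \<alpha>"
  using orth_pairD[OF assms] by (simp add: orth_pair_def bilinear)

lemma orth_pair_rot: assumes "orth_pair a t c \<alpha> \<beta>" shows "orth_pair c a (\<alpha> \<cdot> t) (\<alpha> * \<beta>) \<alpha>"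
  using orth_pairD[OF assms] by (simp add: orth_pair_def bilinear mult.assoc)

text \<open>
  The cubic relations on two letters that Sagle's identity gives by itself are this one and the
  next. They hold for every Lie module over the three-dimensional algebra spanned by \<open>a\<close>, \<open>t\<close>,
  \<open>c\<close>, hence do not determine the words of length three; \<open>h_diag\<close> supplies the missing relation.
\<close>

lemma sagle_pair_left:
  assumes "orth_pair a t c \<alpha> \<beta>"
  shows "m \<star> a \<star> a \<star> t - m \<star> a \<star> t \<star> a = 2 \<cdot> (m \<star> c \<star> a) - (4 * \<alpha>) \<cdot> (m \<star> t)"
proof (rule vector_eqI)
  fix g assume g: "linear_form scale g"
  show "g (m \<star> a \<star> a \<star> t - m \<star> a \<star> t \<star> a) = g (2 \<cdot> (m \<star> c \<star> a) - (4 * \<alpha>) \<cdot> (m \<star> t))"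
    using arg_cong[OF op_sagle[of m a t a], of g]
    apply (simp add: linear_form_simps[OF g] orth_pairD[OF assms] bilinear mul_self)
    by algebra
qed

lemma sagle_pair_right:
  assumes "orth_pair a t c \<alpha> \<beta>"
  shows "m \<star> a \<star> t \<star> a - m \<star> t \<star> a \<star> a = 2 \<cdot> (m \<star> a \<star> c) + (4 * \<alpha>) \<cdot> (m \<star> t)"
proof (rule vector_eqI)
  fix g assume g: "linear_form scale g"
  show "g (m \<star> a \<star> t \<star> a - m \<star> t \<star> a \<star> a) = g (2 \<cdot> (m \<star> a \<star> c) + (4 * \<alpha>) \<cdot> (m \<star> t))"
    using arg_cong[OF op_sagle[of m t a a], of g]
    apply (simp add: linear_form_simps[OF g] orth_pairD[OF assms] bilinear mul_self)
    by algebra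
qed

text \<open>
  Multiplied by \<open>a\<close>, \<open>sagle_pair_left\<close> turns \<open>h_diag\<close> into a relation between \<open>m c a a\<close>, \<open>m a c a\<close>
  and \<open>m t a\<close>; \<open>sagle_pair_right\<close> for the pair \<open>a\<close>, \<open>c\<close> removes \<open>m a c a\<close>.
\<close>

lemma right_square_aux:
  assumes "orth_pair a t c \<alpha> \<beta>"
  shows "3 \<cdot> (m \<star> c \<star> a \<star> a) = (2 * \<alpha>) \<cdot> (m \<star> t \<star> a) + (4 * \<alpha>) \<cdot> (m \<star> a \<star> t) - (8 * \<alpha>) \<cdot> (m \<star> c)"
proof -
  have "2 \<cdot> (3 \<cdot> (m \<star> c \<star> a \<star> a)) = 2 \<cdot> ((2 * \<alpha>) \<cdot> (m \<star> t \<star> a) + (4 * \<alpha>) \<cdot> (m \<star> a \<star> t)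
      - (8 * \<alpha>) \<cdot> (m \<star> c))"
  proof (rule vector_eqI)
    fix g assume g: "linear_form scale g"
    show "g (2 \<cdot> (3 \<cdot> (m \<star> c \<star> a \<star> a))) = g (2 \<cdot> ((2 * \<alpha>) \<cdot> (m \<star> t \<star> a) + (4 * \<alpha>) \<cdot> (m \<star> a \<star> t)
        - (8 * \<alpha>) \<cdot> (m \<star> c)))"
      using arg_cong[OF h_diag[of m a t], of g]
          arg_cong[OF sagle_pair_left[OF assms, of m], of "\<lambda>x. g (x \<star> a)"]
        arg_cong[OF sagle_pair_right[OF orth_pair_next[OF assms], of m], of g]
      apply (simp add: linear_form_simps[OF g] orth_pairD[OF assms] bilinear)
      by algebra
  qed
  then show ?thesis using two by (simp only: scale_left_imp_eq)
qed

lemma right_square: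
  assumes "orth_pair a t c \<alpha> \<beta>"
  shows "3 \<cdot> (m \<star> t \<star> a \<star> a) = - (2 \<cdot> (m \<star> c \<star> a)) - 4 \<cdot> (m \<star> a \<star> c) - (8 * \<alpha>) \<cdot> (m \<star> t)"
proof -
  have "\<alpha> \<cdot> (3 \<cdot> (m \<star> t \<star> a \<star> a)) = \<alpha> \<cdot> (- (2 \<cdot> (m \<star> c \<star> a)) - 4 \<cdot> (m \<star> a \<star> c) - (8 * \<alpha>) \<cdot> (m \<star> t))"
  proof (rule vector_eqI)
    fix g assume g: "linear_form scale g"
    show "g (\<alpha> \<cdot> (3 \<cdot> (m \<star> t \<star> a \<star> a))) = g (\<alpha> \<cdot> (- (2 \<cdot> (m \<star> c \<star> a)) - 4 \<cdot> (m \<star> a \<star> c)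
        - (8 * \<alpha>) \<cdot> (m \<star> t)))"
      using arg_cong[OF right_square_aux[OF orth_pair_next[OF assms], of m], of g]
      apply (simp add: linear_form_simps[OF g] bilinear)
      by algebra
  qed
  then show ?thesis using orth_pairD(7)[OF assms] by (simp only: scale_left_imp_eq)
qed

lemma sandwich:
  assumes "orth_pair a t c \<alpha> \<beta>"
  shows "3 \<cdot> (m \<star> a \<star> t \<star> a) = 2 \<cdot> (m \<star> a \<star> c) - 2 \<cdot> (m \<star> c \<star> a) + (4 * \<alpha>) \<cdot> (m \<star> t)"
proof (rule vector_eqI)
  fix g assume g: "linear_form scale g"
  show "g (3 \<cdot> (m \<star> a \<star> t \<star> a)) = g (2 \<cdot> (m \<star> a \<star> c) - 2 \<cdot> (m \<star> c \<star> a) + (4 * \<alpha>) \<cdot> (m \<star> t))"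
    using arg_cong[OF right_square[OF assms, of m], of g]
        arg_cong[OF sagle_pair_right[OF assms, of m], of g]
    apply (simp add: linear_form_simps[OF g])
    by algebra
qed

lemma left_square:
  assumes "orth_pair a t c \<alpha> \<beta>"
  shows "3 \<cdot> (m \<star> a \<star> a \<star> t) = 2 \<cdot> (m \<star> a \<star> c) + 4 \<cdot> (m \<star> c \<star> a) - (8 * \<alpha>) \<cdot> (m \<star> t)"
proof (rule vector_eqI)
  fix g assume g: "linear_form scale g"
  show "g (3 \<cdot> (m \<star> a \<star> a \<star> t)) = g (2 \<cdot> (m \<star> a \<star> c) + 4 \<cdot> (m \<star> c \<star> a) - (8 * \<alpha>) \<cdot> (m \<star> t))"
    using arg_cong[OF sandwich[OF assms, of m], of g] arg_cong[OF sagle_pair_left[OF assms, of m], of g]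
    apply (simp add: linear_form_simps[OF g])
    by algebra
qed

text \<open>
  Moving \<open>c c\<close> past \<open>a\<close> produces the words \<open>c t t\<close> and \<open>t c t\<close>, and rewriting these makes all
  terms without \<open>m a t\<close> cancel. The two rounds of rewriting account for the factor \<open>9\<close>.
\<close>

lemma square_mul:
  assumes p: "orth_pair a t c \<alpha> \<beta>"
  shows "m \<star> c \<star> c \<star> a \<star> t = (- 4 * \<alpha> * \<beta>) \<cdot> (m \<star> a \<star> t)"
proof -
  have ca: "orth_pair c a (\<alpha> \<cdot> t) (\<alpha> * \<beta>) \<alpha>" by (rule orth_pair_rot[OF p])
  have tc: "orth_pair t c (\<beta> \<cdot> a) \<beta> (\<alpha> * \<beta>)"
    using orth_pair_next[OF orth_pair_swap[OF p]] by (simp add: orth_pair_def bilinear mult.commute)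
  have "9 \<cdot> (m \<star> c \<star> c \<star> a \<star> t) = 9 \<cdot> ((- 4 * \<alpha> * \<beta>) \<cdot> (m \<star> a \<star> t))"
  proof (rule vector_eqI)
    fix g assume g: "linear_form scale g"
    show "g (9 \<cdot> (m \<star> c \<star> c \<star> a \<star> t)) = g (9 \<cdot> ((- 4 * \<alpha> * \<beta>) \<cdot> (m \<star> a \<star> t)))"
      using arg_cong[OF left_square[OF ca, of m], of "\<lambda>x. g (x \<star> t)"]
        arg_cong[OF right_square[OF tc, of m], of g] arg_cong[OF sandwich[OF tc, of m], of g]
      apply (simp add: linear_form_simps[OF g] bilinear)
      by algebra
  qed
  then show ?thesis using nine by (simp only: scale_left_imp_eq)
qed

text \<open>
  The next lemmas describe how a vector \<open>u\<close> with \<open>u a = 0\<close> behaves under two further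
  multiplications within the quaternion algebra of \<open>a\<close> and \<open>t\<close>.
\<close>

lemma ker_mul:
  assumes p: "orth_pair a t c \<alpha> \<beta>" and u: "u \<star> a = 0"
  shows "u \<star> t \<star> a = - (2 \<cdot> (u \<star> c))"
proof -
  have "(2 * \<alpha>) \<cdot> (u \<star> t \<star> a) = (2 * \<alpha>) \<cdot> (- (2 \<cdot> (u \<star> c)))"
  proof (rule vector_eqI)
    fix g assume g: "linear_form scale g"
    show "g ((2 * \<alpha>) \<cdot> (u \<star> t \<star> a)) = g ((2 * \<alpha>) \<cdot> (- (2 \<cdot> (u \<star> c))))"
      using arg_cong[OF sagle_pair_left[OF orth_pair_next[OF p], of u], of g]
      unfolding u bilinear linear_form_simps[OF g] by algebra
  qed
  moreover have "2 * \<alpha> \<noteq> 0" using two orth_pairD(7)[OF p] by simp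
  ultimately show ?thesis by (metis scale_left_imp_eq)
qed

text \<open>
  Once \<open>ker_mul\<close> has eliminated \<open>u t a\<close>, the relations for \<open>a t t\<close> and \<open>t a t\<close> are two linear
  equations for \<open>u t c\<close> and \<open>u c t\<close> with determinant \<open>18\<close> up to sign and a power of \<open>2\<close>.
\<close>

lemma ker_mul_mul:
  assumes p: "orth_pair a t c \<alpha> \<beta>" and u: "u \<star> a = 0"
  shows "u \<star> t \<star> c = 0" "u \<star> c \<star> t = 0"
proof -
  note q = orth_pair_swap[OF p]
  have "18 \<cdot> (u \<star> t \<star> c) = 18 \<cdot> 0" "18 \<cdot> (u \<star> c \<star> t) = 18 \<cdot> 0"
  proof (rule_tac [!] vector_eqI)
    fix g assume g: "linear_form scale g"
    note eqs = arg_cong[OF right_square[OF q, of u], of g] arg_cong[OF sandwich[OF q, of u], of g]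
    show "g (18 \<cdot> (u \<star> t \<star> c)) = g (18 \<cdot> 0)"
      using eqs unfolding u ker_mul[OF p u] bilinear linear_form_simps[OF g] by algebra
    show "g (18 \<cdot> (u \<star> c \<star> t)) = g (18 \<cdot> 0)"
      using eqs unfolding u ker_mul[OF p u] bilinear linear_form_simps[OF g] by algebra
  qed
  then show "u \<star> t \<star> c = 0" "u \<star> c \<star> t = 0" by (metis eighteen scale_left_imp_eq)+
qed

lemma ker_square:
  assumes p: "orth_pair a t c \<alpha> \<beta>" and u: "u \<star> a = 0"
  shows "u \<star> t \<star> t \<star> a = 0"
proof -
  have "3 \<cdot> (u \<star> t \<star> t \<star> a) = 3 \<cdot> 0"
    using left_square[OF orth_pair_swap[OF p], of u] ker_mul_mul[OF p u] by (simp add: bilinear u)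
  then show ?thesis by (metis three scale_left_imp_eq)
qed

section \<open>Sagle's identity with a repeated argument\<close>

text \<open>
  The two ways of repeating an argument are used for products of two general elements \<open>x\<close>, \<open>y\<close>
  with \<open>z\<close> in the exceptional subalgebra.
\<close>

lemma sagle_repeat:
  "(x \<star> z) \<star> (y \<star> z) = x \<star> y \<star> z \<star> z - x \<star> (y \<star> z \<star> z) - x \<star> z \<star> y \<star> z"
proof -
  have 1: "y \<star> z \<star> z \<star> x = - (x \<star> (y \<star> z \<star> z))" by (rule anticomm)
  have 2: "z \<star> x \<star> y \<star> z = - (x \<star> z \<star> y \<star> z)" by (metis anticomm mul_minus_left)
  show ?thesis using sagle[of x z y z] unfolding 1 2 by (simp add: mul_self mul_zero_left)
qed

lemma sagle_repeat':
  "x \<star> z \<star> y \<star> z + x \<star> (y \<star> z \<star> z) = x \<star> (y \<star> z) \<star> z + x \<star> z \<star> z \<star> y"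
proof -
  have 1: "z \<star> y \<star> z \<star> x = x \<star> (y \<star> z \<star> z)" by (metis anticomm mul_minus_left mul_minus_right)
  have 2: "y \<star> z \<star> x \<star> z = - (x \<star> (y \<star> z) \<star> z)" by (metis anticomm mul_minus_left)
  have 3: "z \<star> x \<star> z \<star> y = - (x \<star> z \<star> z \<star> y)" by (metis anticomm mul_minus_left)
  have "0 = x \<star> z \<star> y \<star> z + z \<star> y \<star> z \<star> x + y \<star> z \<star> x \<star> z + z \<star> x \<star> z \<star> y"
    using sagle[of x y z z] by (simp add: mul_self mul_zero_right)
  then show ?thesis unfolding 1 2 3 by (simp add: algebra_simps)
qed

end

section \<open>The index group of the octonion basis\<close>

unbundle bit_operations_syntax

lemma xor_left_self: "i XOR (i XOR j) = (j::nat)"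
  by (simp flip: xor.assoc)
lemma xor_right_self: "(j XOR i) XOR i = (j::nat)"
  by (simp add: xor.assoc)
lemmas xor_simps = xor.assoc xor.commute xor.left_commute xor_left_self

lemma xor_cancel: "(i XOR j = i XOR k) = (j = (k::nat))" "(j XOR i = k XOR i) = (j = (k::nat))"
  by (metis xor_left_self, metis xor_right_self)
lemma xor_fix: "(i XOR j = i) = (j = (0::nat))" "(i = i XOR j) = (j = (0::nat))"
  "(j XOR i = i) = (j = (0::nat))" "(i = j XOR i) = (j = (0::nat))"
   by (metis xor.right_neutral xor_left_self xor.commute)+
lemma xor_zero: "(i XOR j = 0) = (i = (j::nat))" "(0 = i XOR j) = (i = (j::nat))"
  by (metis xor_self_eq xor_left_self xor.right_neutral)+
lemma xor_less_8: "i < 8 \<Longrightarrow> j < 8 \<Longrightarrow> i XOR j < (8::nat)"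
proof -
  have "\<forall>i\<in>set [0..<8]. \<forall>j\<in>set [0..<8]. i XOR j < (8::nat)" by code_simp
  then show "i < 8 \<Longrightarrow> j < 8 \<Longrightarrow> i XOR j < (8::nat)" by auto
qed

abbreviation imag :: "nat set" where "imag \<equiv> {0<..<8}"

text \<open>
  Linear independence over the field with two elements: \<open>e\<^sub>i\<close>, \<open>e\<^sub>j\<close>, \<open>e\<^sub>k\<close> lie in no common
  quaternion subalgebra.
\<close>

definition indep :: "nat \<Rightarrow> nat \<Rightarrow> nat \<Rightarrow> bool" where
  "indep i j k \<longleftrightarrow> {i, j, k} \<subseteq> imag
    \<and> i XOR j \<noteq> 0 \<and> i XOR k \<noteq> 0 \<and> j XOR k \<noteq> 0 \<and> i XOR j XOR k \<noteq> 0"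

lemma imag_iff: "i \<in> imag \<longleftrightarrow> i \<noteq> 0 \<and> i < 8"
  by auto

lemma xor_imag: "\<lbrakk>i \<in> imag; j \<in> imag; i \<noteq> j\<rbrakk> \<Longrightarrow> i XOR j \<in> imag"
  unfolding imag_iff by (simp add: xor_less_8 xor_zero)

lemma indepI:
  assumes "i \<in> imag" "j \<in> imag" "k \<in> imag" "i \<noteq> j" "k \<noteq> i" "k \<noteq> j" "k \<noteq> i XOR j"
  shows "indep i j k"
proof -
  have "i XOR j XOR k \<noteq> 0" using assms(7) by (metis xor_zero(1) xor.assoc)
  then show ?thesis unfolding indep_def using assms by (simp add: xor_zero)
qed

lemma indepD:
  assumes "indep i j k"
  shows "i \<in> imag" "j \<in> imag" "k \<in> imag" "i XOR j \<in> imag" "i XOR k \<in> imag" "j XOR k \<in> imag"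
    "i XOR j XOR k \<in> imag" "i \<noteq> j" "j \<noteq> i" "i \<noteq> k" "k \<noteq> i" "j \<noteq> k" "k \<noteq> j" "i XOR j \<noteq> k" "k \<noteq> i XOR j"
    "i XOR k \<noteq> j" "j \<noteq> i XOR k" "j XOR k \<noteq> i" "i \<noteq> j XOR k"
proof -
  show *: "i \<in> imag" "j \<in> imag" "k \<in> imag" "i XOR j \<in> imag" "i XOR k \<in> imag" "j XOR k \<in> imag"
    "i XOR j XOR k \<in> imag"
    using assms unfolding indep_def imag_iff by (simp_all add: xor_less_8)
  show "i \<noteq> j" "j \<noteq> i" "i \<noteq> k" "k \<noteq> i" "j \<noteq> k" "k \<noteq> j"
    using assms unfolding indep_def by auto
  show "i \<noteq> j XOR k" "j XOR k \<noteq> i"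
    using assms unfolding indep_def by (metis xor_self_eq)+
  show "i XOR j \<noteq> k" "k \<noteq> i XOR j"
    using assms unfolding indep_def by (metis xor_self_eq xor.assoc)+
  show "i XOR k \<noteq> j" "j \<noteq> i XOR k"
    using assms unfolding indep_def by (metis xor_self_eq xor.left_commute)+
qed

lemma indep_perm:
  assumes "indep i j k"
  shows "indep j k i" "indep j i k" "indep i k j" "indep k i j" "indep k j i"
  using assms unfolding indep_def by (simp_all add: xor.commute xor.left_commute)

lemma indep_xor:
  assumes "indep i j k"
  shows "indep (i XOR j) j k" "indep i (i XOR j) k" "indep i j (i XOR k)" "indep i j (j XOR k)"
  using assms unfolding indep_def
  by (simp_all add: imag_iff xor_less_8 xor.assoc xor_left_self xor.left_commute[of j i] xor.commute[of
      j i])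

lemma indep_decomp:
  assumes "w \<in> imag"
  obtains i j k where "indep i j k" "i XOR j XOR k = w"
proof -
  from assms have "w = 1 \<or> w = 2 \<or> w = 3 \<or> w = 4 \<or> w = 5 \<or> w = 6 \<or> w = 7"
    unfolding imag_iff by linarith
  moreover have "indep 2 4 7 \<and> indep 1 4 7 \<and> indep 1 4 6 \<and> indep 1 2 7 \<and> indep 1 2 6 \<and> indep 1 2 5
      \<and> indep 1 2 4"
    unfolding indep_def imag_iff insert_subset by code_simp
  moreover have "2 XOR 4 XOR 7 = (1::nat) \<and> 1 XOR 4 XOR 7 = (2::nat) \<and> 1 XOR 4 XOR 6 = (3::nat)
      \<and> 1 XOR 2 XOR 7 = (4::nat) \<and> 1 XOR 2 XOR 6 = (5::nat) \<and> 1 XOR 2 XOR 5 = (6::nat) \<and> 1 XOR 2 XOR 4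
          = (7::nat)"
    by code_simp
  ultimately show thesis
    using that[of 2 4 7] that[of 1 4 7] that[of 1 4 6] that[of 1 2 7] that[of 1 2 6] that[of 1 2 5]
        that[of 1 2 4]
    by metis
qed

section \<open>Octonion frames\<close>

text \<open>
  The conditions on \<open>s\<close> express skew-symmetry of the imaginary units, the norm of a unit, and the
  sign in \<open>(x y) z = - x (y z)\<close> for independent units.
\<close>

locale octonion_frame = sagle_space scale mul
  for scale :: "'f::field \<Rightarrow> 'm::ab_group_add \<Rightarrow> 'm" (infixr "\<cdot>" 75)
  and mul :: "'m \<Rightarrow> 'm \<Rightarrow> 'm" (infixl "\<star>" 70) +
  fixes e :: "nat \<Rightarrow> 'm" and s :: "nat \<Rightarrow> nat \<Rightarrow> 'f" and n :: "nat \<Rightarrow> 'f"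
  assumes e_mul: "\<lbrakk>i \<in> imag; j \<in> imag; i \<noteq> j\<rbrakk> \<Longrightarrow> e i \<star> e j = (2 * s i j) \<cdot> e (i XOR j)"
    and s_nonzero: "\<lbrakk>i \<in> imag; j \<in> imag\<rbrakk> \<Longrightarrow> s i j \<noteq> 0"
    and n_nonzero: "i \<in> imag \<Longrightarrow> n i \<noteq> 0"
    and s_skew: "\<lbrakk>i \<in> imag; j \<in> imag; i \<noteq> j\<rbrakk> \<Longrightarrow> s j i = - s i j"
    and s_norm: "\<lbrakk>i \<in> imag; j \<in> imag; i \<noteq> j\<rbrakk> \<Longrightarrow> s i j * s (i XOR j) i = n i"
    and s_assoc: "indep i j k \<Longrightarrow> s i j * s (i XOR j) k = - s j k * s i (j XOR k)"
    and faithful: "(\<And>i. i \<in> imag \<Longrightarrow> m \<star> e i = 0) \<Longrightarrow> m = 0"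
begin

lemma orth_pair_basis:
  assumes "i \<in> imag" "j \<in> imag" "i \<noteq> j"
  shows "orth_pair (e i) (e j) (s i j \<cdot> e (i XOR j)) (n i) (n j)"
proof -
  have k: "i XOR j \<in> imag" "i XOR j \<noteq> i" "i XOR j \<noteq> j"
    using assms xor_imag by (auto simp: xor_fix)
  have 1: "(i XOR j) XOR i = j" by (metis xor.commute xor_left_self)
  have 2: "s i j * s j (i XOR j) = n j"
    using s_norm[of j i] s_skew[of i j] s_skew[of "i XOR j" j] assms k by (simp add: xor.commute)
  show ?thesis
    unfolding orth_pair_def using e_mul[OF assms] e_mul[OF k(1) assms(1)] e_mul[OF assms(2) k(1)] k
      s_norm[OF assms] n_nonzero assms 1 2
    by (simp add: bilinear xor_left_self xor.commute[of i j] algebra_simps)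
qed

lemma s_cyclic:
  assumes "indep i j k" shows "s j k * s (j XOR k) i = s i j * s (i XOR j) k"
  using s_assoc[OF assms] s_skew[of i "j XOR k"] indepD[OF assms] by simp

lemma s_assoc':
  assumes "indep i j k" shows "s i k * s (i XOR k) j = - s i j * s (i XOR j) k"
  using s_assoc[OF assms] s_assoc[OF indep_perm(3)[OF assms]] s_skew[of j k] indepD[OF assms]
  by (simp add: xor.commute)

lemma s_square_norm:
  assumes "i \<in> imag" "j \<in> imag" "i \<noteq> j" shows "s i j * s i j * n (i XOR j) = n i * n j"
proof -
  have k: "i XOR j \<in> imag" "i XOR j \<noteq> i" "i XOR j \<noteq> j"
    using assms xor_imag by (auto simp: xor_fix)
  have 1: "(i XOR j) XOR i = j" by (metis xor.commute xor_left_self)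
  have ni: "n i = s i j * s (i XOR j) i" using s_norm[OF assms] by simp
  have nj: "n j = - (s i j * s (i XOR j) j)"
    using s_norm[of j i] s_skew[of i j] assms by (simp add: xor.commute[of j i])
  have nij: "n (i XOR j) = - (s (i XOR j) i * s (i XOR j) j)"
    using s_norm[of "i XOR j" i] s_skew[of "i XOR j" j] assms k 1 by simp
  show ?thesis by (simp add: ni nj nij)
qed

lemma frame_sagle:
  assumes "indep i j k"
  shows "m \<star> e i \<star> e j \<star> e k - m \<star> e k \<star> e i \<star> e j =
    (2 * s i k) \<cdot> (m \<star> e j \<star> e (i XOR k)) + (2 * s j k) \<cdot> (m \<star> e (j XOR k) \<star> e i)
    + (4 * (s i j * s (i XOR j) k)) \<cdot> (m \<star> e (i XOR j XOR k))"
  using op_sagle[of m "e i" "e j" "e k"] indepD[OF assms]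
  by (simp add: e_mul bilinear xor.assoc mult.assoc)

text \<open>
  In the sum of Sagle's identity over the cyclic permutations of \<open>i\<close>, \<open>j\<close>, \<open>k\<close> all words of length
  three cancel. What remains expresses \<open>e\<^sub>w\<close> through the commutators along the three lines of the
  Fano plane that pass through \<open>w = i XOR j XOR k\<close>.
\<close>

lemma bracket_sum:
  assumes i: "indep i j k"
  shows "s i j \<cdot> (m \<star> e (i XOR j) \<star> e k - m \<star> e k \<star> e (i XOR j))
    + s j k \<cdot> (m \<star> e (j XOR k) \<star> e i - m \<star> e i \<star> e (j XOR k))
    + s k i \<cdot> (m \<star> e (k XOR i) \<star> e j - m \<star> e j \<star> e (k XOR i))
    = - ((6 * (s i j * s (i XOR j) k)) \<cdot> (m \<star> e (i XOR j XOR k)))" (is "?l = ?r")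
proof -
  note p = indep_perm[OF i]
  have x: "j XOR k XOR i = i XOR j XOR k" "k XOR i XOR j = i XOR j XOR k"
    "j XOR i = i XOR j" "k XOR j = j XOR k" "i XOR k = k XOR i"
    by (simp_all add: xor.commute xor.left_commute)
  have sk: "s j i = - s i j" "s k j = - s j k" "s i k = - s k i"
    using s_skew indepD[OF i] by metis+
  have "2 \<cdot> ?l = 2 \<cdot> ?r"
  proof (rule vector_eqI)
    fix g assume g: "linear_form scale g"
    show "g (2 \<cdot> ?l) = g (2 \<cdot> ?r)"
      using arg_cong[OF frame_sagle[OF i, of m], of g] arg_cong[OF frame_sagle[OF p(1), of m], of g]
        arg_cong[OF frame_sagle[OF p(4), of m], of g] sk s_cyclic[OF i] s_cyclic[OF p(1)]
      unfolding linear_form_simps[OF g] x by algebra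
  qed
  then show ?thesis using two by (simp only: scale_left_imp_eq)
qed

text \<open>
  By \<open>square_mul\<close>, prepending \<open>e\<^sub>w e\<^sub>w\<close> multiplies each commutator along a line through \<open>w\<close> by
  \<open>-4 n\<^sub>w\<close>; by \<open>bracket_sum\<close> it does the same to \<open>e\<^sub>w\<close>.
\<close>

lemma cube:
  assumes "w \<in> imag"
  shows "m \<star> e w \<star> e w \<star> e w = (- 4 * n w) \<cdot> (m \<star> e w)"
proof -
  obtain i j k where i: "indep i j k" and w: "i XOR j XOR k = w"
    using indep_decomp[OF assms] by blast
  have sq: "m \<star> e w \<star> e w \<star> e a \<star> e b = (- 4 * n w) \<cdot> (m \<star> e a \<star> e b)"
    if ab: "a \<in> imag" "b \<in> imag" "a \<noteq> b" "a XOR b = w" for a b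
  proof -
    have "(s a b * s a b) \<cdot> (m \<star> e w \<star> e w \<star> e a \<star> e b)
        = (s a b * s a b) \<cdot> ((- 4 * n w) \<cdot> (m \<star> e a \<star> e b))"
      using square_mul[OF orth_pair_basis[OF ab(1-3)], of m] s_square_norm[OF ab(1-3)] ab(4)
      by (simp add: bilinear mult.assoc mult.left_commute[of _ 4])
    moreover have "s a b * s a b \<noteq> 0" using s_nonzero ab by simp
    ultimately show ?thesis by (metis scale_left_imp_eq)
  qed
  note d = indepD[OF i]
  have x: "(i XOR j) XOR k = w" "k XOR (i XOR j) = w" "(j XOR k) XOR i = w" "i XOR (j XOR k) = w"
      "(k XOR i) XOR j = w" "j XOR (k XOR i) = w"
    unfolding w[symmetric] by (simp_all add: xor.commute xor.left_commute xor.assoc)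
  have m: "k XOR i \<in> imag" "k XOR i \<noteq> j" "j \<noteq> k XOR i" using d by (simp_all add: xor.commute)
  note sqs = sq[OF d(4,3,14) x(1)] sq[OF d(3,4,15) x(2)] sq[OF d(6,1,18) x(3)] sq[OF d(1,6,19) x(4)]
    sq[OF m(1) d(2) m(2) x(5)] sq[OF d(2) m(1) m(3) x(6)]
  have nz: "6 * (s i j * s (i XOR j) k) \<noteq> 0" using six s_nonzero d by simp
  have "(6 * (s i j * s (i XOR j) k)) \<cdot> (m \<star> e w \<star> e w \<star> e w)
      = (6 * (s i j * s (i XOR j) k)) \<cdot> ((- 4 * n w) \<cdot> (m \<star> e w))"
  proof (rule vector_eqI)
    fix g assume g: "linear_form scale g"
    show "g ((6 * (s i j * s (i XOR j) k)) \<cdot> (m \<star> e w \<star> e w \<star> e w))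
        = g ((6 * (s i j * s (i XOR j) k)) \<cdot> ((- 4 * n w) \<cdot> (m \<star> e w)))"
      using arg_cong[OF bracket_sum[OF i, of m], of g]
          arg_cong[OF bracket_sum[OF i, of "m \<star> e w \<star> e w"], of g]
      unfolding w sqs linear_form_simps[OF g] by algebra
  qed
  then show ?thesis using nz by (simp only: scale_left_imp_eq)
qed

lemma s_norm':
  assumes "i \<in> imag" "j \<in> imag" "i \<noteq> j" shows "s i j * s i (i XOR j) = - n i"
proof -
  have "s (i XOR j) i = - s i (i XOR j)"
    using assms by (intro s_skew xor_imag) (auto simp: xor_fix)
  then show ?thesis using s_norm[OF assms] by (metis minus_minus mult_minus_right)
qed

section \<open>Components and the regular module structure\<close>

definition component :: "nat \<Rightarrow> 'm set" where
  "component a = {u. u \<star> e a = 0}"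

lemma componentD: "u \<in> component a \<Longrightarrow> u \<star> e a = 0" by (simp add: component_def)

context
  fixes a u
  assumes a: "a \<in> imag" and u: "u \<in> component a"
begin

lemma component_mul:
  assumes "z \<in> imag" "z \<noteq> a"
  shows "u \<star> e z \<star> e a = - ((2 * s a z) \<cdot> (u \<star> e (a XOR z)))"
  using ker_mul[OF orth_pair_basis[OF a assms(1)] componentD[OF u]] assms by (simp add: bilinear)

lemma component_shift:
  assumes "z \<in> imag" "z \<noteq> a"
  shows "u \<star> e z \<star> e (a XOR z) = 0"
  using ker_mul_mul[OF orth_pair_basis[OF a assms(1)] componentD[OF u]] assms s_nonzero[OF a assms(1)]
  by (simp add: bilinear)

text \<open>
  This is \<open>frame_sagle\<close> applied to \<open>u\<close> with \<open>a\<close> as first letter. The index \<open>k\<close> is chosen with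
  \<open>a XOR k = l\<close>, so that \<open>component_mul\<close> turns \<open>u e\<^sub>k e\<^sub>a\<close> into a multiple of \<open>u e\<^sub>l\<close>.
\<close>

lemma component_bracket:
  assumes i: "indep a l j"
  shows "u \<star> e l \<star> e j - u \<star> e j \<star> e l = - ((4 * s l j) \<cdot> (u \<star> e (l XOR j)))"
proof -
  define k where "k = a XOR l"
  have i2: "indep a j k" unfolding k_def using indep_xor(3)[OF indep_perm(3)[OF i]] by simp
  note d = indepD[OF i2]
  have x: "a XOR k = l" "a XOR (j XOR k) = l XOR j" "a XOR j XOR k = l XOR j"
    by (simp_all add: k_def xor_left_self xor.left_commute xor.commute)
  note s1 = s_assoc[OF i2] and s2 = s_assoc'[OF i2, unfolded x]
  have "(2 * s a k) \<cdot> (u \<star> e l \<star> e j - u \<star> e j \<star> e l)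
      = (2 * s a k) \<cdot> (- ((4 * s l j) \<cdot> (u \<star> e (l XOR j))))"
  proof (rule vector_eqI)
    fix g assume g: "linear_form scale g"
    show "g ((2 * s a k) \<cdot> (u \<star> e l \<star> e j - u \<star> e j \<star> e l))
        = g ((2 * s a k) \<cdot> (- ((4 * s l j) \<cdot> (u \<star> e (l XOR j)))))"
      using arg_cong[OF frame_sagle[OF i2, of u], of g] s1 s2
      unfolding componentD[OF u] component_mul[OF d(3,11)] component_mul[OF d(6,18)] x bilinear
          linear_form_simps[OF g]
      by algebra
  qed
  moreover have "2 * s a k \<noteq> 0" using two s_nonzero d by simp
  ultimately show ?thesis by (metis scale_left_imp_eq)
qed

end

text \<open>
  The difference \<open>w\<close> of both sides lies in the components of both \<open>a\<close> and \<open>z\<close>. A vector in two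
  components is annihilated by every basis element: for an index on the line through \<open>a\<close> and \<open>z\<close>
  by \<open>component_mul\<close>, and for any other index because \<open>component_mul\<close> and \<open>component_bracket\<close> give
  different multiples for the same product.
\<close>

lemma component_square:
  assumes a: "a \<in> imag" and u: "u \<in> component a" and z: "z \<in> imag" "z \<noteq> a"
  shows "u \<star> e z \<star> e z = (- 4 * n z) \<cdot> u"
proof -
  define w where "w = u \<star> e z \<star> e z + (4 * n z) \<cdot> u"
  have wa: "w \<in> component a"
    using ker_square[OF orth_pair_basis[OF a z(1)] componentD[OF u]] z componentD[OF u]
    by (simp add: w_def bilinear component_def)
  have wz: "w \<in> component z"
    using cube[OF z(1), of u] by (simp add: w_def bilinear component_def)
  have "w = 0"
  proof (rule faithful)
    fix l assume l: "l \<in> imag"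
    consider "l = a" | "l = z" | "l = a XOR z" | "l \<noteq> a" "l \<noteq> z" "l \<noteq> a XOR z" by blast
    then show "w \<star> e l = 0"
    proof cases
      case 3
      then show ?thesis
        using component_mul[OF a wa z] componentD[OF wz] z two s_nonzero[OF a z(1)]
            by (simp add: bilinear)
    next
      case 4
      have i: "indep a (l XOR z) z"
        using indep_xor(4)[of a z l] indepI[OF a z(1) l] z 4 by (metis indep_perm(3) xor.commute)
      note d = indepD[OF i]
      have x: "(l XOR z) XOR z = l" "z XOR (l XOR z) = l"
        by (simp_all add: xor.assoc xor.commute xor.left_commute xor_left_self)
      have "6 \<cdot> (s (l XOR z) z \<cdot> (w \<star> e l)) = 6 \<cdot> 0"
      proof (rule vector_eqI)
        fix g assume g: "linear_form scale g"
        show "g (6 \<cdot> (s (l XOR z) z \<cdot> (w \<star> e l))) = g (6 \<cdot> 0)"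
          using arg_cong[OF component_bracket[OF a wa i], of g]
              arg_cong[OF component_mul[OF z(1) wz d(2) d(12)], of g]
            s_skew[OF d(2,3,12)]
          unfolding componentD[OF wz] x bilinear linear_form_simps[OF g] by algebra
      qed
      then show ?thesis using six s_nonzero[OF d(2,3)] by (metis scale_eq_0_iff scale_zero_right)
    qed (use componentD wa wz in auto)
  qed
  then show ?thesis by (simp add: w_def eq_neg_iff_add_eq_0)
qed

text \<open>
  It suffices, by \<open>component_bracket\<close>, that the symmetrised product \<open>w k = u e\<^sub>j e\<^sub>k + u e\<^sub>k e\<^sub>j\<close>
  vanishes. Multiplication by \<open>e\<^sub>j\<close> exchanges \<open>w k\<close> with a multiple of \<open>w (j XOR k)\<close>, whence
  \<open>(w k) e\<^sub>j e\<^sub>j = - n\<^sub>j (w k)\<close>, whereas \<open>cube\<close> only permits the eigenvalues \<open>0\<close> and \<open>- 4 n\<^sub>j\<close>.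
\<close>

lemma component_mul_indep:
  assumes u: "u \<in> component a" and i: "indep a j k"
  shows "u \<star> e j \<star> e k = - ((2 * s j k) \<cdot> (u \<star> e (j XOR k)))"
proof -
  have a: "a \<in> imag" using indepD[OF i] by simp
  define w where "w k = u \<star> e j \<star> e k + u \<star> e k \<star> e j" for k
  have step: "w k \<star> e j = - (s j k \<cdot> w (j XOR k))" if i: "indep a j k" for k
  proof -
    note d = indepD[OF i]
    have i': "indep a j (j XOR k)" using indep_xor(4)[OF i] .
    have x: "j XOR j XOR k = k" by (rule xor_left_self)
    have n: "s j k * s j (j XOR k) = - n j"
      by (rule s_norm'[OF d(2,3,12)])
    have "3 \<cdot> (w k \<star> e j) = 3 \<cdot> (- (s j k \<cdot> w (j XOR k)))"
    proof (rule vector_eqI)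
      fix g assume g: "linear_form scale g"
      show "g (3 \<cdot> (w k \<star> e j)) = g (3 \<cdot> (- (s j k \<cdot> w (j XOR k))))"
        using arg_cong[OF right_square[OF orth_pair_basis[OF d(2,3,12)], of u], of g]
            arg_cong[OF sandwich[OF orth_pair_basis[OF d(2,3,12)], of u], of g]
          arg_cong[OF component_bracket[OF a u i'], of g] n
        unfolding w_def x bilinear linear_form_simps[OF g] by algebra
    qed
    then show ?thesis by (metis three scale_left_imp_eq)
  qed
  note d = indepD[OF i]
  have i': "indep a j (j XOR k)" using indep_xor(4)[OF i] .
  have n: "s j k * s j (j XOR k) = - n j"
    by (rule s_norm'[OF d(2,3,12)])
  have sq: "w k \<star> e j \<star> e j = (- n j) \<cdot> w k"
    using n by (simp add: step[OF i] step[OF i'] bilinear xor_left_self)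
  have "(3 * n j * n j) \<cdot> w k = (3 * n j * n j) \<cdot> 0"
  proof (rule vector_eqI)
    fix g assume g: "linear_form scale g"
    show "g ((3 * n j * n j) \<cdot> w k) = g ((3 * n j * n j) \<cdot> 0)"
      using arg_cong[OF cube[OF d(2), of "w k"], of "\<lambda>x. g (x \<star> e j)"]
      unfolding sq bilinear linear_form_simps[OF g] by algebra
  qed
  moreover have "3 * n j * n j \<noteq> 0" using three n_nonzero[OF d(2)] by simp
  ultimately have w0: "w k = 0" by (metis scale_left_imp_eq)
  have "2 \<cdot> (u \<star> e j \<star> e k) = 2 \<cdot> (- ((2 * s j k) \<cdot> (u \<star> e (j XOR k))))"
  proof (rule vector_eqI)
    fix g assume g: "linear_form scale g"
    show "g (2 \<cdot> (u \<star> e j \<star> e k)) = g (2 \<cdot> (- ((2 * s j k) \<cdot> (u \<star> e (j XOR k)))))"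
      using arg_cong[OF w0, of g] arg_cong[OF component_bracket[OF a u i], of g]
      unfolding w_def linear_form_simps[OF g] by algebra
  qed
  then show ?thesis by (metis two scale_left_imp_eq)
qed

section \<open>Decomposition into components\<close>

definition proj :: "nat \<Rightarrow> 'm \<Rightarrow> 'm" where
  "proj i m = m + (1 / (4 * n i)) \<cdot> (m \<star> e i \<star> e i)"

lemma proj_component: "i \<in> imag \<Longrightarrow> proj i m \<in> component i"
  using n_nonzero[of i] four cube[of i m] by (simp add: proj_def component_def bilinear)

lemma proj_same: "u \<in> component i \<Longrightarrow> proj i u = u"
  by (simp add: proj_def component_def bilinear)

lemma proj_other: "\<lbrakk>u \<in> component j; i \<in> imag; j \<in> imag; i \<noteq> j\<rbrakk> \<Longrightarrow> proj i u = 0"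
  using n_nonzero[of i] four component_square[of j u i] by (simp add: proj_def)

lemma proj_add: "proj i (x + y) = proj i x + proj i y"
  by (simp add: proj_def bilinear algebra_simps scale_right_distrib)

lemma proj_scale: "proj i (c \<cdot> x) = c \<cdot> proj i x"
  by (simp add: proj_def bilinear algebra_simps scale_right_distrib)

lemma proj_diff: "proj i (x - y) = proj i x - proj i y"
  by (metis add_diff_cancel_right' diff_add_cancel proj_add)

lemma proj_sum: "proj i (sum f A) = (\<Sum>x\<in>A. proj i (f x))"
  by (induction A rule: infinite_finite_induct) (simp_all add: proj_add, simp_all add: proj_def
      bilinear)

text \<open>
  If all projections of \<open>m\<close> vanish, then \<open>m e\<^sub>i e\<^sub>i = - 4 n\<^sub>i m\<close> for every \<open>i\<close>, which forces
  \<open>m e\<^sub>i e\<^sub>j\<close> to be a multiple of \<open>m e\<^bsub>i XOR j\<^esub>\<close>. Substituted into \<open>bracket_sum\<close>, this gives \<open>-12\<close>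
  on one side and \<open>-6\<close> on the other, so that \<open>m\<close> is annihilated by every \<open>e\<^sub>w\<close>.
\<close>

lemma no_components:
  assumes "\<And>i. i \<in> imag \<Longrightarrow> proj i m = 0"
  shows "m = 0"
proof -
  have sq: "m \<star> e i \<star> e i = (- 4 * n i) \<cdot> m" if "i \<in> imag" for i
  proof -
    have "(4 * n i) \<cdot> proj i m = 0" using assms[OF that] by simp
    then show ?thesis using n_nonzero[OF that] four
        by (simp add: proj_def scale_right_distrib eq_neg_iff_add_eq_0 add.commute)
  qed
  have *: "m \<star> e i \<star> e j = - ((2 * s i j) \<cdot> (m \<star> e (i XOR j)))" if ij: "i \<in> imag" "j \<in> imag" "i \<noteq> j"
      for i j
  proof -
    have nn: "m \<star> e i \<star> c + 2 \<cdot> (m \<star> c \<star> e i) + (2 * n i) \<cdot> (m \<star> t) = 0"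
      if "orth_pair (e i) t c (n i) \<beta>" "i \<in> imag" for t c i \<beta>
    proof -
      have "2 \<cdot> (m \<star> e i \<star> c + 2 \<cdot> (m \<star> c \<star> e i) + (2 * n i) \<cdot> (m \<star> t)) = 2 \<cdot> 0"
      proof (rule vector_eqI)
        fix g assume g: "linear_form scale g"
        show "g (2 \<cdot> (m \<star> e i \<star> c + 2 \<cdot> (m \<star> c \<star> e i) + (2 * n i) \<cdot> (m \<star> t))) = g (2 \<cdot> 0)"
          using arg_cong[OF left_square[OF that(1), of m], of g]
              unfolding sq[OF that(2)] bilinear linear_form_simps[OF g] by algebra
      qed
      then show ?thesis by (metis two scale_left_imp_eq)
    qed
    note p = orth_pair_basis[OF ij] and q = orth_pair_swap[OF orth_pair_basis[OF ij]]
    have "(3 * n i * n j) \<cdot> (m \<star> e i \<star> e j) = (3 * n i * n j) \<cdot> (- ((2 * s i j) \<cdot> (m \<star> e (i XOR j))))"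
    proof (rule vector_eqI)
      fix g assume g: "linear_form scale g"
      show "g ((3 * n i * n j) \<cdot> (m \<star> e i \<star> e j))
          = g ((3 * n i * n j) \<cdot> (- ((2 * s i j) \<cdot> (m \<star> e (i XOR j)))))"
        using arg_cong[OF nn[OF orth_pair_next[OF p] ij(1)], of g]
            arg_cong[OF nn[OF orth_pair_next[OF q] ij(2)], of g]
        unfolding bilinear linear_form_simps[OF g] by algebra
    qed
    moreover have "3 * n i * n j \<noteq> 0" using three n_nonzero ij by simp
    ultimately show ?thesis by (metis scale_left_imp_eq)
  qed
  show ?thesis
  proof (rule faithful)
    fix w assume "w \<in> imag"
    then obtain i j k where i: "indep i j k" and w: "i XOR j XOR k = w"
      using indep_decomp by blast
    note d = indepD[OF i]
    note p = indep_perm[OF i]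
    have x: "(i XOR j) XOR k = w" "k XOR (i XOR j) = w" "(j XOR k) XOR i = w" "i XOR (j XOR k) = w"
        "(k XOR i) XOR j = w" "j XOR (k XOR i) = w"
      unfolding w[symmetric] by (simp_all add: xor.commute xor.left_commute xor.assoc)
    have m: "k XOR i \<in> imag" "k XOR i \<noteq> j" "j \<noteq> k XOR i" using d by (simp_all add: xor.commute)
    note sqs = *[OF d(4,3,14)] *[OF d(3,4,15)] *[OF d(6,1,18)] *[OF d(1,6,19)]
      *[OF m(1) d(2) m(2)] *[OF d(2) m(1) m(3)]
    have nz: "6 * (s i j * s (i XOR j) k) \<noteq> 0" using six s_nonzero d by simp
    have sk: "s k (i XOR j) = - s (i XOR j) k" "s i (j XOR k) = - s (j XOR k) i"
        "s j (k XOR i) = - s (k XOR i) j"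
      using s_skew d m by metis+
    have "(6 * (s i j * s (i XOR j) k)) \<cdot> (m \<star> e w) = (6 * (s i j * s (i XOR j) k)) \<cdot> 0"
    proof (rule vector_eqI)
      fix g assume g: "linear_form scale g"
      show "g ((6 * (s i j * s (i XOR j) k)) \<cdot> (m \<star> e w)) = g ((6 * (s i j * s (i XOR j) k)) \<cdot> 0)"
        using arg_cong[OF bracket_sum[OF i, of m], of g] s_cyclic[OF i] s_cyclic[OF p(1)]
        unfolding sqs linear_form_simps[OF g] x sk by algebra
    qed
    then show "m \<star> e w = 0" using nz by (metis scale_left_imp_eq)
  qed
qed

lemma decomposition: "m = (\<Sum>i\<in>imag. proj i m)"
proof -
  have "m - (\<Sum>i\<in>imag. proj i m) = 0"
  proof (rule no_components)
    fix j :: nat assume j: "j \<in> imag"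
    have "proj j (\<Sum>i\<in>imag. proj i m) = (\<Sum>i\<in>imag. if i = j then proj j m else 0)"
      unfolding proj_sum using j by (intro sum.cong) (auto simp: proj_same[OF proj_component]
          proj_other[OF proj_component])
    then show "proj j (m - (\<Sum>i\<in>imag. proj i m)) = 0"
      using j by (simp add: proj_diff)
  qed
  then show ?thesis by simp
qed

section \<open>Products of components\<close>

lemma component_subspace:
  "0 \<in> component i" "x \<in> component i \<Longrightarrow> y \<in> component i \<Longrightarrow> x + y \<in> component i"
  "x \<in> component i \<Longrightarrow> c \<cdot> x \<in> component i" "x \<in> component i \<Longrightarrow> - x \<in> component i"
  by (simp_all add: component_def bilinear)

lemma component_mul_component:
  "\<lbrakk>u \<in> component a; a \<in> imag; z \<in> imag; z \<noteq> a\<rbrakk> \<Longrightarrow> u \<star> e z \<in> component (a XOR z)"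
  using component_shift[of a u z] by (simp add: component_def)

text \<open>
  Right multiplication by an element \<open>y\<close> of the component of \<open>a\<close> commutes with \<open>e\<^sub>a\<close> on the
  eigenspace of \<open>e\<^sub>a\<^sup>2\<close>: by \<open>sagle_repeat'\<close> both \<open>x\<close> and \<open>x e\<^sub>a\<close> satisfy
  \<open>(x e\<^sub>a) y e\<^sub>a = - 4 n\<^sub>a (x y)\<close>.
\<close>

lemma mul_commute_component:
  assumes x: "x \<star> e a \<star> e a = (- 4 * n a) \<cdot> x" and y: "y \<in> component a" and a: "a \<in> imag"
  shows "(x \<star> e a) \<star> y = (x \<star> y) \<star> e a" "(x \<star> y) \<star> e a \<star> e a = (- 4 * n a) \<cdot> (x \<star> y)"
proof -
  have nz: "- 4 * n a \<noteq> 0" using four n_nonzero[OF a] by simp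
  have 1: "x \<star> e a \<star> y \<star> e a = (- 4 * n a) \<cdot> (x \<star> y)" if "x \<star> e a \<star> e a = (- 4 * n a) \<cdot> x" for x
    using sagle_repeat'[of x "e a" y] that componentD[OF y] by (simp add: bilinear)
  have "x \<star> e a \<star> e a \<star> y \<star> e a = (- 4 * n a) \<cdot> (x \<star> e a \<star> y)"
    using 1[of "x \<star> e a"] x by (simp add: bilinear)
  then show 2: "(x \<star> e a) \<star> y = (x \<star> y) \<star> e a"
    using nz unfolding x bilinear by (metis scale_left_imp_eq)
  then show "(x \<star> y) \<star> e a \<star> e a = (- 4 * n a) \<cdot> (x \<star> y)"
    using 1[OF x] by simp
qed

lemma component_closed:
  assumes "x \<in> component p" "y \<in> component p" "p \<in> imag"
  shows "x \<star> y \<in> component p"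
proof -
  have "x \<star> y \<star> e p \<star> e p = 0"
    using sagle_repeat[of x "e p" y] assms(1,2) by (simp add: component_def bilinear)
  then have "(- 4 * n p) \<cdot> (x \<star> y \<star> e p) = 0"
    using cube[OF assms(3), of "x \<star> y"] by (simp add: bilinear)
  then show ?thesis using four n_nonzero[OF assms(3)] by (simp add: component_def)
qed

text \<open>
  With \<open>X = (x e\<^sub>z) y\<close>, Sagle's identity reads \<open>(x e\<^sub>z)(y e\<^sub>z) = - X e\<^sub>z\<close>, and the left side lies
  in the component of \<open>p XOR z\<close>. Hence \<open>X\<close> has parts only in the components of \<open>z\<close> and of \<open>p\<close>; the
  latter vanishes because \<open>X e\<^sub>p e\<^sub>p = - 4 n\<^sub>p X\<close>. So \<open>X e\<^sub>z = 0\<close>, which gives both claims at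
  once.
\<close>

lemma product_shift:
  assumes x: "x \<in> component p" and y: "y \<in> component p" and p: "p \<in> imag" and z: "z \<in> imag" "z \<noteq> p"
  shows "(x \<star> e z) \<star> (y \<star> e z) = 0" "(x \<star> e z) \<star> y \<in> component z"
proof -
  let ?c = "p XOR z"
  have c: "?c \<in> imag" "?c \<noteq> p" using p z xor_imag by (auto simp: xor_fix)
  have xz: "x \<star> e z \<in> component ?c" and yz: "y \<star> e z \<in> component ?c"
    using x y p z component_mul_component by blast+
  define X where "X = (x \<star> e z) \<star> y"
  have "x \<star> y \<in> component p" using component_closed x y p .
  then have *: "(x \<star> e z) \<star> (y \<star> e z) = - (X \<star> e z)"
    using sagle_repeat[of x "e z" y] component_square[of p _ z] y p z by (simp add: X_def bilinear)
  define v where "v = X \<star> e z"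
  have v: "v \<in> component ?c"
    using component_closed[OF xz yz c(1)] * component_subspace(4) by (metis minus_minus v_def)
  \<comment> \<open>up to a scalar, \<open>Y\<close> is the part of \<open>X\<close> in the component of \<open>p\<close>\<close>
  define Y where "Y = v \<star> e z"
  have "Y \<in> component (?c XOR z)"
    unfolding Y_def using component_mul_component[OF v c(1) z(1)] p c by (auto simp: xor_fix)
  then have Yp: "Y \<star> e p = 0" by (simp add: xor_right_self component_def)
  have PX: "proj z X = X + (1 / (4 * n z)) \<cdot> Y" by (simp add: proj_def Y_def v_def)
  have "proj z X \<star> e p \<star> e p = (- 4 * n p) \<cdot> proj z X"
    using component_square[OF z(1) proj_component[OF z(1)] p] z(2) by simp
  moreover have "X \<star> e p \<star> e p = (- 4 * n p) \<cdot> X"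
    unfolding X_def using component_square[OF c(1) xz p c(2)[symmetric]] y p
        by (rule mul_commute_component(2))
  ultimately have "(- 4 * n p * (1 / (4 * n z))) \<cdot> Y = 0"
    unfolding PX by (simp add: bilinear Yp scale_right_distrib)
  then have "Y = 0" using four n_nonzero p z by simp
  have "z \<noteq> ?c" using p by (auto simp: xor_fix)
  then have "(- 4 * n z) \<cdot> v = 0"
    using component_square[OF c(1) v z(1)] \<open>Y = 0\<close> by (simp add: Y_def bilinear)
  then have "v = 0" using four n_nonzero z by simp
  then show "(x \<star> e z) \<star> (y \<star> e z) = 0" "(x \<star> e z) \<star> y \<in> component z"
    using * by (simp_all add: v_def X_def component_def)
qed

lemma component_unshift:
  assumes "x \<in> component c" "c \<in> imag" "z \<in> imag" "z \<noteq> c"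
  obtains x' where "x' \<in> component (c XOR z)" "x' \<star> e z = x"
proof
  let ?x = "(- 1 / (4 * n z)) \<cdot> (x \<star> e z)"
  show "?x \<in> component (c XOR z)" using assms component_mul_component component_subspace(3) by blast
  show "?x \<star> e z = x" using component_square[OF assms(2,1,3,4)] four n_nonzero[OF assms(3)]
    by (simp add: bilinear)
qed

lemma component_square_zero:
  assumes x: "x \<in> component c" and y: "y \<in> component c" and c: "c \<in> imag"
  shows "x \<star> y = 0"
proof -
  obtain z :: nat where z: "z \<in> imag" "z \<noteq> c"
  proof (cases "c = 1")
    case True then show ?thesis using that[of 2] by simp
  next
    case False then show ?thesis using that[of 1] by simp
  qed
  obtain x' y' where xy: "x' \<in> component (c XOR z)" "x' \<star> e z = x" "y' \<in> component (c XOR z)"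
      "y' \<star> e z = y"
    using component_unshift[OF x c z] component_unshift[OF y c z] by metis
  have "c XOR z \<in> imag" "z \<noteq> c XOR z" using c z xor_imag by (auto simp: xor_fix)
  then show ?thesis using product_shift(1)[OF xy(1,3) _ z(1)] xy by simp
qed

lemma component_product:
  assumes x: "x \<in> component c" and y: "y \<in> component p" and c: "c \<in> imag" "p \<in> imag" "c \<noteq> p"
  shows "x \<star> y \<in> component (c XOR p)"
proof -
  have z: "c XOR p \<in> imag" "c XOR p \<noteq> c" "c XOR p \<noteq> p" "c XOR (c XOR p) = p"
    using c xor_imag by (auto simp: xor_fix xor_left_self)
  obtain x' where "x' \<in> component p" "x' \<star> e (c XOR p) = x"
    using component_unshift[OF x c(1) z(1,2)] z(4) by metis
  then show ?thesis using product_shift(2)[OF _ y c(2) z(1,3)] by metis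
qed

lemma product_shift_indep:
  assumes x: "x \<in> component p" and y: "y \<in> component q" and i: "indep p q z"
  shows "(x \<star> e z) \<star> (y \<star> e z) = - ((x \<star> e z) \<star> y \<star> e z)"
proof -
  note d = indepD[OF i]
  have "x \<star> y \<in> component (p XOR q)" using component_product[OF x y] d by simp
  then show ?thesis
    using sagle_repeat[of x "e z" y] component_square[of "p XOR q"
        "x \<star> y" z] component_square[of q y z] y d
    by (simp add: bilinear)
qed

section \<open>Coordinates with values in one component\<close>

text \<open>
  For \<open>u\<close> in the component of \<open>1\<close>, which plays the role of the coordinate space \<open>U\<close>, the element
  \<open>embed j u\<close> is the image of \<open>e\<^sub>j \<otimes> u\<close>: the scalar is chosen so that \<open>e\<^sub>1 e\<^bsub>1 XOR j\<^esub>\<close> becomes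
  \<open>e\<^sub>j\<close>. The map \<open>coord i\<close> is the inverse of \<open>embed i\<close>, preceded by the projection onto the
  component of \<open>i\<close>; its scalar comes from \<open>component_square\<close> for the index \<open>1 XOR i\<close>.
\<close>

definition embed :: "nat \<Rightarrow> 'm \<Rightarrow> 'm" where
  "embed j u = (if j = 1 then u else (1 / (2 * s 1 (1 XOR j))) \<cdot> (u \<star> e (1 XOR j)))"

definition coord :: "nat \<Rightarrow> 'm \<Rightarrow> 'm" where
  "coord i m = (if i = 1 then proj 1 m
     else (- s 1 (1 XOR i) / (2 * n (1 XOR i))) \<cdot> (proj i m \<star> e (1 XOR i)))"

lemma embed_add: "embed i (x + y) = embed i x + embed i y"
  by (simp add: embed_def bilinear scale_right_distrib)
lemma embed_scale: "embed i (c \<cdot> x) = c \<cdot> embed i x"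
  by (simp add: embed_def bilinear)
lemma coord_add: "coord i (x + y) = coord i x + coord i y"
  by (simp add: coord_def proj_add bilinear scale_right_distrib)
lemma coord_scale: "coord i (c \<cdot> x) = c \<cdot> coord i x"
  by (simp add: coord_def proj_scale bilinear)

lemma one_imag: "1 \<in> imag" by simp

lemma xor_one: "j \<in> imag \<Longrightarrow> j \<noteq> 1 \<Longrightarrow> 1 XOR j \<in> imag \<and> 1 XOR j \<noteq> 1 \<and> 1 XOR j \<noteq> j \<and> 1 XOR (1 XOR j) = j"
  using xor_imag[of 1 j] by (simp add: xor_left_self xor_fix del: One_nat_def)

lemma embed_component:
  assumes "u \<in> component 1" "j \<in> imag" shows "embed j u \<in> component j"
  using component_mul_component[OF assms(1) one_imag, of "1 XOR j"] xor_one[OF assms(2)] assms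
  by (auto simp: embed_def component_subspace simp del: One_nat_def)

text \<open>
  The cases \<open>k = 1\<close>, \<open>k = l\<close> and the remaining \<open>k\<close> are those of \<open>component_mul\<close>,
  \<open>component_square\<close> and \<open>component_mul_indep\<close>.
\<close>

lemma embed_mul:
  assumes u: "u \<in> component 1" and j: "j \<in> imag" "k \<in> imag" "j \<noteq> k"
  shows "embed j u \<star> e k = (2 * s j k) \<cdot> embed (j XOR k) u"
proof (cases "j = 1")
  case True
  then show ?thesis using xor_one[of k] j s_nonzero[of 1 k] two xor_fix[of 1 k]
    by (simp add: embed_def del: One_nat_def)
next
  case False
  define l where "l = 1 XOR j"
  have l: "l \<in> imag" "l \<noteq> 1" "l \<noteq> j" "1 XOR l = j" using xor_one[OF j(1) False] by (auto simp: l_def)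
  have e: "embed j u = (1 / (2 * s 1 l)) \<cdot> (u \<star> e l)" using False by (simp add: embed_def l_def)
  have s1l: "s 1 l \<noteq> 0" using s_nonzero l one_imag by blast
  have j1: "j XOR 1 = l" "j XOR l = 1" "1 XOR j = l" "l XOR 1 = j"
    using l(4) xor_right_self[of 1 l] by (simp_all only: l_def xor.commute[of _ 1])
  consider "k = 1" | "k = l" | "k \<noteq> 1" "k \<noteq> l" by blast
  then show ?thesis
  proof cases
    case 1
    have sk: "s j 1 = - s 1 j" using s_skew[OF one_imag j(1)] False by metis
    have "embed l u = (1 / (2 * s 1 j)) \<cdot> (u \<star> e j)" using l by (simp add: embed_def del: One_nat_def)
    then show ?thesis
      unfolding 1 e j1 bilinear sk
      using component_mul[OF one_imag u l(1,2)] l s1l two s_nonzero[OF one_imag j(1)]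
          by (simp del: One_nat_def)
  next
    case 2
    have "s l 1 = - s 1 l" "s l j = - s j l"
      using s_skew[OF one_imag l(1)] s_skew[OF j(1) l(1)] l by auto
    then have "s 1 l * s j l = - n l"
      using s_norm'[OF l(1) one_imag l(2)] unfolding j1 by simp
    then have "(2 * s j l) = (1 / (2 * s 1 l)) * (- 4 * n l)" using s1l two
      by (simp add: field_simps)
    then show ?thesis
      unfolding 2 e j1 bilinear using component_square[OF one_imag u l(1,2)] by (simp add: embed_def)
  next
    case 3
    have i: "indep 1 l k" using 3 l j one_imag by (intro indepI) auto
    note d = indepD[OF i]
    have x: "1 XOR (l XOR k) = j XOR k" "1 XOR (j XOR k) = l XOR k"
      using l(4) j1(3) by (metis xor.assoc)+
    have x1: "j XOR k \<noteq> 1" using 3(2) j1(1) xor_left_self by metis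
    have s: "s 1 l * s j k = - s l k * s 1 (l XOR k)" using s_assoc[OF i] l(4) by simp
    have e2: "embed (j XOR k) u = (1 / (2 * s 1 (l XOR k))) \<cdot> (u \<star> e (l XOR k))"
      using x x1 by (simp add: embed_def del: One_nat_def)
    have "s j k = - s l k * s 1 (l XOR k) / s 1 l"
      using s s1l by (metis nonzero_mult_div_cancel_left)
    then have eq: "(1 / (2 * s 1 l)) * - (2 * s l k) = (2 * s j k) * (1 / (2 * s 1 (l XOR k)))"
      using two s_nonzero[OF one_imag d(6)] by (simp del: One_nat_def)
    have "embed j u \<star> e k = ((1 / (2 * s 1 l)) * - (2 * s l k)) \<cdot> (u \<star> e (l XOR k))"
      by (simp add: e bilinear component_mul_indep[OF u i])
    then show ?thesis unfolding eq by (simp add: e2)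
  qed
qed

lemma coord_component:
  assumes "i \<in> imag" shows "coord i m \<in> component 1"
  using component_mul_component[OF proj_component[OF assms], of
      "1 XOR i" m] proj_component[of 1 m] assms xor_one[OF assms]
  by (auto simp: coord_def xor_right_self xor.commute[of i] component_subspace(3,4) simp del:
      One_nat_def)

lemma embed_coord:
  assumes i: "i \<in> imag" shows "embed i (coord i m) = proj i m"
proof (cases "i = 1")
  case True
  then show ?thesis by (simp add: coord_def embed_def)
next
  case False
  note x = xor_one[OF i False]
  have nz: "s 1 (1 XOR i) \<noteq> 0" "n (1 XOR i) \<noteq> 0"
    using s_nonzero[OF one_imag] n_nonzero x by blast+
  show ?thesis
    using component_square[OF i proj_component[OF i], of "1 XOR i" m] x nz two False four
    by (simp add: coord_def embed_def bilinear del: One_nat_def)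
qed

lemma coord_embed_other:
  assumes "u \<in> component 1" "i \<in> imag" "j \<in> imag" "i \<noteq> j" shows "coord i (embed j u) = 0"
  using proj_other[OF embed_component[OF assms(1,3)] assms(2,3,4)]
      by (auto simp add: coord_def bilinear simp del: One_nat_def)

lemma coord_embed:
  assumes u: "u \<in> component 1" and i: "i \<in> imag" shows "coord i (embed i u) = u"
proof (cases "i = 1")
  case True
  then show ?thesis using u by (simp add: coord_def embed_def proj_same del: One_nat_def)
next
  case False
  then show ?thesis
    using proj_same[OF embed_component[OF u i]] component_square[OF one_imag u, of
        "1 XOR i"] xor_one[OF i False]
     s_nonzero[OF one_imag, of "1 XOR i"] n_nonzero[of "1 XOR i"] two four
    by (simp add: coord_def embed_def bilinear del: One_nat_def)
qed

lemma embed_inj: "\<lbrakk>embed i u = embed i w; u \<in> component 1; w \<in> component 1; i \<in> imag\<rbrakk> \<Longrightarrow> u = w"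
  using coord_embed by metis

section \<open>The commutative algebra of coordinates\<close>

definition coeff :: "nat \<Rightarrow> nat \<Rightarrow> 'm \<Rightarrow> 'm \<Rightarrow> 'm" where
  "coeff i j u w = coord (i XOR j) ((1 / (2 * s i j)) \<cdot> (embed i u \<star> embed j w))"

text \<open>
  The product of \<open>U\<close>, read off from \<open>e\<^sub>2 e\<^sub>3\<close>; this pair is convenient because \<open>2 XOR 3 = 1\<close>, so
  that the value already lies in the component of \<open>1\<close>. By \<open>coeff_eq_uprod\<close> every other pair of
  distinct indices gives the same product.
\<close>

definition uprod :: "'m \<Rightarrow> 'm \<Rightarrow> 'm" where
  "uprod u w = (1 / (2 * s 2 3)) \<cdot> (embed 2 u \<star> embed 3 w)"

context
  fixes u w
  assumes u: "u \<in> component 1" and w: "w \<in> component 1"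
begin

lemma coeff_component: "\<lbrakk>i \<in> imag; j \<in> imag; i \<noteq> j\<rbrakk> \<Longrightarrow> coeff i j u w \<in> component 1"
  unfolding coeff_def using coord_component xor_imag by blast

lemma embed_mul_embed:
  assumes ij: "i \<in> imag" "j \<in> imag" "i \<noteq> j"
  shows "embed i u \<star> embed j w = (2 * s i j) \<cdot> embed (i XOR j) (coeff i j u w)"
  using embed_coord[OF xor_imag[OF ij]] proj_same[OF component_product[OF embed_component[OF u ij(1)]
      embed_component[OF w ij(2)] ij]]
    s_nonzero[OF ij(1,2)] two four
  by (simp add: coeff_def coord_scale embed_scale)

text \<open>
  By \<open>mul_commute_component\<close>, the multiplication by \<open>e\<^sub>j\<close> may be applied to the first factor or to
  the product; both results are embedded in the component of \<open>i\<close>.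
\<close>

lemma coeff_line:
  assumes ij: "i \<in> imag" "j \<in> imag" "i \<noteq> j"
  shows "coeff (i XOR j) j u w = coeff i j u w"
proof -
  let ?k = "i XOR j"
  have k: "?k \<in> imag" "?k \<noteq> j" "?k \<noteq> i" using ij xor_imag by (auto simp: xor_fix)
  have "(embed i u \<star> e j) \<star> embed j w = (embed i u \<star> embed j w) \<star> e j"
    by (rule mul_commute_component(1)[OF component_square[OF ij(1) embed_component[OF u ij(1)] ij(2)]
        embed_component[OF w ij(2)] ij(2)])
      (use ij in auto)
  then have "((2 * s i j) * (2 * s ?k j)) \<cdot> embed i (coeff ?k j u w)
      = ((2 * s i j) * (2 * s ?k j)) \<cdot> embed i (coeff i j u w)"
    using embed_mul[OF u ij] embed_mul[OF coeff_component[OF ij] k(1) ij(2) k(2)] embed_mul_embed[OF ij]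
        embed_mul_embed[OF k(1) ij(2) k(2)]
    by (simp add: bilinear xor_right_self)
  moreover have "(2 * s i j) * (2 * s ?k j) \<noteq> 0" using four s_nonzero ij k by simp
  ultimately have "embed i (coeff ?k j u w) = embed i (coeff i j u w)" by (metis scale_left_imp_eq)
  then show ?thesis using embed_inj coeff_component ij k by blast
qed

text \<open>
  This compares the two sides of \<open>product_shift_indep\<close> for \<open>e\<^bsub>i XOR k\<^esub> \<otimes> u\<close> and \<open>e\<^sub>j \<otimes> w\<close>.
\<close>

lemma coeff_indep:
  assumes i: "indep i j k"
  shows "coeff i (j XOR k) u w = coeff i j u w"
proof -
  let ?p = "i XOR k" let ?w = "i XOR (j XOR k)"
  have i': "indep ?p j k"
    using indep_xor(1)[OF indep_perm(3)[OF i]] indep_perm(3) by blast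
  note d = indepD[OF i] and d' = indepD[OF i']
  have x: "?p XOR k = i" "(i XOR j) XOR k = ?w" by (simp_all add: xor_right_self xor.assoc)
  have pk: "embed ?p u \<star> e k = (2 * s ?p k) \<cdot> embed i u"
    using embed_mul[OF u d'(1,3,10)] x by simp
  have "(embed ?p u \<star> e k) \<star> (embed j w \<star> e k) = - ((embed ?p u \<star> e k) \<star> embed j w \<star> e k)"
    by (rule product_shift_indep[OF embed_component[OF u d'(1)] embed_component[OF w d'(2)] i'])
  then have eq: "((2 * s ?p k) * ((2 * s j k) * (2 * s i (j XOR k)))) \<cdot> embed ?w (coeff i (j XOR k) u w)
      = - (((2 * s ?p k) * ((2 * s i j) * (2 * s (i XOR j) k))) \<cdot> embed ?w (coeff i j u w))"
    unfolding pk embed_mul[OF w d(2,3,12)] bilinear embed_mul_embed[OF d(1,6,19)]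
        embed_mul_embed[OF d(1,2,8)]
      embed_mul[OF coeff_component[OF d(1,2,8)] d(4,3,14)] x scale_scale
          by (simp only: mult.assoc mult.left_commute)
  have c: "(2 * s ?p k) * ((2 * s j k) * (2 * s i (j XOR k))) =
      - ((2 * s ?p k) * ((2 * s i j) * (2 * s (i XOR j) k)))"
    using s_assoc[OF i] by algebra
  have "(2 * s ?p k) * ((2 * s j k) * (2 * s i (j XOR k))) \<noteq> 0"
    using eight s_nonzero d d' by simp
  then have "embed ?w (coeff i (j XOR k) u w) = embed ?w (coeff i j u w)"
    using eq unfolding scale_minus_left[symmetric] c[symmetric] by (simp only: scale_left_imp_eq)
  then show ?thesis using embed_inj coeff_component d by blast
qed

end

lemma coeff_swap:
  assumes u: "u \<in> component 1" and w: "w \<in> component 1" and ij: "i \<in> imag" "j \<in> imag" "i \<noteq> j"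
  shows "coeff i j u w = coeff j i w u"
proof -
  have "(1 / (2 * s i j)) \<cdot> (embed i u \<star> embed j w) = (1 / (2 * s j i)) \<cdot> (embed j w \<star> embed i u)"
    unfolding s_skew[OF ij] anticomm[of "embed i u"] by simp
  then show ?thesis unfolding coeff_def by (simp add: xor.commute[of j i])
qed

lemma coeff_second:
  assumes u: "u \<in> component 1" and w: "w \<in> component 1" and i: "i \<in> imag" "j \<in> imag" "k \<in> imag" "i \<noteq> j"
      "i \<noteq> k"
  shows "coeff i j u w = coeff i k u w"
proof -
  consider "j = k" | "k = j XOR i" | "j \<noteq> k" "k \<noteq> j XOR i" by blast
  then show ?thesis
  proof cases
    case 2
    then show ?thesis
      using coeff_swap[OF u w i(1,2,4)] coeff_swap[OF u w i(1,3,5)] coeff_line[OF w u i(2,1)] i(4)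
          by simp
  next
    case 3
    then have "indep i j (j XOR k)"
      using i by (intro indep_xor(4) indepI) (auto simp: xor.commute)
    then show ?thesis using coeff_indep[OF u w, of i j "j XOR k"] by (simp add: xor_left_self)
  qed simp
qed

text \<open>
  By \<open>coeff_second\<close> the second index is arbitrary, and by \<open>coeff_swap\<close> so is the first; the index
  \<open>k\<close> avoids both first indices \<open>i\<close> and \<open>2\<close>.
\<close>

lemma coeff_eq_uprod:
  assumes u: "u \<in> component 1" and w: "w \<in> component 1" and ij: "i \<in> imag" "j \<in> imag" "i \<noteq> j"
  shows "coeff i j u w = uprod u w"
proof -
  have I: "2 \<in> imag" "3 \<in> imag" "(2::nat) \<noteq> 3" by auto
  obtain k :: nat where k: "k \<in> imag" "i \<noteq> k" "2 \<noteq> k"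
  proof (cases "i = 3")
    case True then show ?thesis using that[of 1] by simp
  next
    case False then show ?thesis using that[of 3] by simp
  qed
  have "coeff i j u w = coeff i k u w" by (rule coeff_second[OF u w]) (use ij k in auto)
  also have "\<dots> = coeff k i w u" by (rule coeff_swap[OF u w]) (use ij k in auto)
  also have "\<dots> = coeff k 2 w u" by (rule coeff_second[OF w u]) (use ij k in auto)
  also have "\<dots> = coeff 2 k u w" by (rule coeff_swap[OF w u]) (use ij k in auto)
  also have "\<dots> = coeff 2 3 u w" by (rule coeff_second[OF u w]) (use ij k in auto)
  also have "\<dots> = uprod u w"
  proof -
    have "(2::nat) XOR 3 = 1" by code_simp
    then have "uprod u w \<in> component 1"
      using component_product[OF embed_component[OF u I(1)] embed_component[OF w I(2)] I]
      by (simp add: uprod_def component_subspace(3) del: One_nat_def)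
    then show ?thesis using \<open>(2::nat) XOR 3 = 1\<close>
      by (simp add: coeff_def uprod_def coord_def proj_same del: One_nat_def)
  qed
  finally show ?thesis .
qed

lemma uprod_component: "\<lbrakk>u \<in> component 1; w \<in> component 1\<rbrakk> \<Longrightarrow> uprod u w \<in> component 1"
  using coeff_component[of u w 2 3] coeff_eq_uprod[of u w 2 3] by simp

lemma embed_product_distinct:
  assumes u: "u \<in> component 1" and w: "w \<in> component 1" and ij: "i \<in> imag" "j \<in> imag" "i \<noteq> j"
  shows "embed i u \<star> embed j w = (2 * s i j) \<cdot> embed (i XOR j) (uprod u w)"
  using embed_mul_embed[OF u w ij] coeff_eq_uprod[OF u w ij] by simp

lemma embed_product:
  assumes u: "u \<in> component 1" and w: "w \<in> component 1" and ij: "i \<in> imag" "j \<in> imag"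
  shows "embed i u \<star> embed j w = (if i = j then 0 else (2 * s i j) \<cdot> embed (i XOR j) (uprod u w))"
  using component_square_zero[OF embed_component[OF u ij(1)] embed_component[OF w ij(1)] ij(1)]
    embed_mul_embed[OF u w ij] coeff_eq_uprod[OF u w ij] by auto

lemma uprod_commute: "\<lbrakk>u \<in> component 1; w \<in> component 1\<rbrakk> \<Longrightarrow> uprod u w = uprod w u"
  using coeff_eq_uprod[of u w 2 3] coeff_swap[of u w 2 3] coeff_eq_uprod[of w u 3 2] by simp

text \<open>
  Sagle's identity for \<open>e\<^sub>i \<otimes> u\<close>, \<open>e\<^sub>j \<otimes> v\<close>, \<open>e\<^sub>i \<otimes> w\<close> and \<open>e\<^sub>k\<close>. Repeating the index \<open>i\<close> kills
  one of its terms, and the two terms with \<open>(u v) w\<close> have equal coefficients and cancel.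
\<close>

lemma uprod_rotate:
  assumes u: "u \<in> component 1" and v: "v \<in> component 1" and w: "w \<in> component 1"
  shows "uprod (uprod w v) u = uprod (uprod u w) v"
proof -
  obtain i j k where i: "indep i j k" using indep_decomp[OF one_imag] by blast
  note d = indepD[OF i]
  note i' = indep_xor(2)[OF i]
  note U = uprod_component
  define A B C where "A = uprod (uprod u v) w" and "B = uprod (uprod w v) u" and
      "C = uprod (uprod u w) v"
  have ABC: "A \<in> component 1" "B \<in> component 1" "C \<in> component 1" using U u v w
      by (auto simp: A_def B_def C_def)
  have x: "(i XOR j) XOR (i XOR k) = j XOR k" "(i XOR j XOR k) XOR i = j XOR k"
      "(j XOR k) XOR i = i XOR j XOR k"
    "(i XOR j) XOR k = i XOR j XOR k" "(i XOR k) XOR i = k" "k XOR j = j XOR k"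
    by (simp_all add: xor_simps)
  have ne: "i XOR j \<noteq> i XOR k" "i XOR j XOR k \<noteq> i" "i XOR k \<noteq> i" using d
      by (auto simp: xor_cancel xor_fix)
  note P = embed_product_distinct
  have 1: "(embed i u \<star> embed j v) \<star> (embed i w \<star> e k)
      = (8 * (s i j * s i k * s (i XOR j) (i XOR k))) \<cdot> embed (j XOR k) A"
    unfolding P[OF u v d(1,2,8)] embed_mul[OF w d(1,3,10)] bilinear P[OF U[OF u v] w d(4,5) ne(1)] x
        A_def scale_scale
    by (rule arg_cong[where f = "\<lambda>c. c \<cdot> _"]) algebra
  have 3: "embed i w \<star> embed j v \<star> e k \<star> embed i u
      = (8 * (s i j * s (i XOR j) k * s (i XOR j XOR k) i)) \<cdot> embed (j XOR k) B"
    unfolding P[OF w v d(1,2,8)] bilinear embed_mul[OF U[OF w v] d(4,3,14)] x P[OF U[OF w v] u d(7,1)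
        ne(2)] B_def scale_scale
    by (rule arg_cong[where f = "\<lambda>c. c \<cdot> _"]) algebra
  have 4: "embed j v \<star> e k \<star> embed i u \<star> embed i w
      = (8 * (s j k * s (j XOR k) i * s (i XOR j XOR k) i)) \<cdot> embed (j XOR k) A"
    unfolding embed_mul[OF v d(2,3,12)] bilinear P[OF v u d(6,1,18)] x P[OF U[OF u v] w d(7,1) ne(2)]
      uprod_commute[OF v u] A_def scale_scale
    by (rule arg_cong[where f = "\<lambda>c. c \<cdot> _"]) algebra
  have 5: "embed i u \<star> e k \<star> embed i w \<star> embed j v
      = (8 * (s i k * s (i XOR k) i * s k j)) \<cdot> embed (j XOR k) C"
    unfolding embed_mul[OF u d(1,3,10)] bilinear P[OF u w d(5,1) ne(3)] x P[OF U[OF u w] v d(3,2,13)]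
        C_def scale_scale
    by (rule arg_cong[where f = "\<lambda>c. c \<cdot> _"]) algebra
  have 6: "e k \<star> embed i u \<star> embed i w \<star> embed j v = - (embed i u \<star> e k \<star> embed i w \<star> embed j v)"
    by (metis anticomm mul_minus_left)
  have 7: "embed i u \<star> embed i w = 0" using embed_product[OF u w d(1,1)] by simp
  have 8: "embed j v \<star> embed i w = - (embed i w \<star> embed j v)" by (rule anticomm)
  have sg: "(embed i u \<star> embed j v) \<star> (embed i w \<star> e k) =
      embed i w \<star> embed j v \<star> e k \<star> embed i u + embed j v \<star> e k \<star> embed i u \<star> embed i w
      + - (embed i u \<star> e k \<star> embed i w \<star> embed j v)"
    using sagle[of "embed i u" "embed j v" "embed i w" "e k"] unfolding 6 7 by (simp add: mul_zero_left)
  have s1: "s i j * s i k * s (i XOR j) (i XOR k) = - (n i * s j k)"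
  proof -
    have "(i XOR j) XOR i = j" by (simp add: xor_simps)
    then have "s i k * s (i XOR j) (i XOR k) = - (s (i XOR j) i * s j k)"
      using s_assoc[OF indep_perm(2)[OF i']] by simp
    then show ?thesis using s_norm[OF d(1,2,8)] by (metis mult.assoc mult_minus_right)
  qed
  have s2: "s (j XOR k) i * s (i XOR j XOR k) i = - n i"
    using s_norm[OF d(1,6,19)] s_skew[OF d(1,6,19)] by simp
  have s3: "s i k * s (i XOR k) i * s k j = - (n i * s j k)"
    using s_norm[OF d(1,3,10)] s_skew[OF d(2,3,12)] by simp
  have s4: "s i j * s (i XOR j) k * s (i XOR j XOR k) i = - (n i * s j k)"
    unfolding s_cyclic[OF i, symmetric] mult.assoc s2 by simp
  have s5: "s j k * s (j XOR k) i * s (i XOR j XOR k) i = - (n i * s j k)"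
    unfolding mult.assoc s2 by simp
  have cancel: "y = z" if "x = y + x + - z" for x y z :: 'm
    using that by (simp add: add.assoc add.left_commute)
  define c where "c = 8 * - (n i * s j k)"
  have "c \<cdot> embed (j XOR k) A = c \<cdot> embed (j XOR k) B + c \<cdot> embed (j XOR k) A +
      - (c \<cdot> embed (j XOR k) C)"
    using sg unfolding 1 3 4 5 s1 s3 s4 s5 c_def .
  then have "c \<cdot> embed (j XOR k) B = c \<cdot> embed (j XOR k) C"
    by (rule cancel)
  moreover have "c \<noteq> 0" using eight s_nonzero n_nonzero d by (simp add: c_def)
  ultimately have "embed (j XOR k) B = embed (j XOR k) C" by (metis scale_left_imp_eq)
  then have "B = C" using embed_inj ABC d by blast
  then show ?thesis unfolding B_def C_def .
qed

lemma uprod_assoc: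
  assumes u: "u \<in> component 1" and v: "v \<in> component 1" and w: "w \<in> component 1"
  shows "uprod (uprod u v) w = uprod u (uprod v w)"
  using uprod_rotate[OF u w v] uprod_commute[OF u uprod_component[OF v w]] by simp

end

section \<open>Quotients by the kernel of a homomorphism\<close>

text \<open>
  The isomorphism theorem. The isomorphism sends \<open>m\<close> to its fibre under \<open>ev\<close>, which is a coset of
  the kernel.
\<close>

lemma type_alg_iso_quotient:
  fixes A :: "('f::field, 'b::ab_group_add) alg" and ev :: "'b \<Rightarrow> 'm::ab_group_add"
    and scale :: "'f \<Rightarrow> 'm \<Rightarrow> 'm" and mul :: "'m \<Rightarrow> 'm \<Rightarrow> 'm"
  assumes add: "add A = (+)"
    and diff_closed: "\<And>x y. x \<in> carrier A \<Longrightarrow> y \<in> carrier A \<Longrightarrow> x - y \<in> carrier A"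
    and smult_closed: "\<And>c x. x \<in> carrier A \<Longrightarrow> smult A c x \<in> carrier A"
    and mult_closed: "\<And>x y. x \<in> carrier A \<Longrightarrow> y \<in> carrier A \<Longrightarrow> mult A x y \<in> carrier A"
    and ev_add: "\<And>x y. x \<in> carrier A \<Longrightarrow> y \<in> carrier A \<Longrightarrow> ev (x + y) = ev x + ev y"
    and ev_smult: "\<And>c x. x \<in> carrier A \<Longrightarrow> ev (smult A c x) = scale c (ev x)"
    and ev_mult: "\<And>x y. x \<in> carrier A \<Longrightarrow> y \<in> carrier A \<Longrightarrow> ev (mult A x y) = mul (ev x) (ev y)"
    and surj: "\<And>m. \<exists>x\<in>carrier A. ev x = m"
    and I: "I = {x \<in> carrier A. ev x = 0}"
  shows "type_alg scale mul \<cong> quotient_alg A I"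
proof -
  define fiber where "fiber m = {x \<in> carrier A. ev x = m}" for m
  have zero: "0 \<in> carrier A"
    using surj[of 0] diff_closed by (metis cancel_comm_monoid_add_class.diff_cancel)
  have add_closed: "x + y \<in> carrier A" if "x \<in> carrier A" "y \<in> carrier A" for x y
    using diff_closed[OF that(1) diff_closed[OF zero that(2)]] by simp
  have ev_diff: "ev (x - y) = ev x - ev y" if "x \<in> carrier A" "y \<in> carrier A" for x y
    using ev_add[OF diff_closed[OF that] that(2)] by simp
  have coset: "alg_coset A I x = fiber (ev x)" if x: "x \<in> carrier A" for x
  proof
    show "alg_coset A I x \<subseteq> fiber (ev x)"
      using x add_closed by (auto simp: alg_coset_def I fiber_def add ev_add)
    show "fiber (ev x) \<subseteq> alg_coset A I x"
    proof
      fix y assume "y \<in> fiber (ev x)"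
      then have "y = x + (y - x) \<and> y - x \<in> I"
        using x diff_closed by (auto simp: I fiber_def ev_diff)
      then show "y \<in> alg_coset A I x" unfolding alg_coset_def add by blast
    qed
  qed
  have fiberE: "\<exists>x. x \<in> fiber m" for m using surj[of m] by (auto simp: fiber_def)
  have carrier: "carrier (quotient_alg A I) = range fiber"
    using coset surj by (auto simp: quotient_alg_def image_iff) (metis)
  have inj: "inj fiber"
    using fiberE by (intro injI) (metis (mono_tags, lifting) fiber_def mem_Collect_eq)
  have "add (quotient_alg A I) (fiber x) (fiber y) = fiber (x + y)" for x y
  proof -
    have "alg_coset A I (a + b) = fiber (x + y)" if "a \<in> fiber x" "b \<in> fiber y" for a b
      using that coset[OF add_closed, of a b] ev_add by (simp add: fiber_def)
    then show ?thesis using fiberE[of x] fiberE[of y] by (auto simp: quotient_alg_def add)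
  qed
  moreover have "smult (quotient_alg A I) c (fiber x) = fiber (scale c x)" for c x
  proof -
    have "alg_coset A I (smult A c a) = fiber (scale c x)" if "a \<in> fiber x" for a
      using that coset[OF smult_closed, of a c] ev_smult by (simp add: fiber_def)
    then show ?thesis using fiberE[of x] by (auto simp: quotient_alg_def)
  qed
  moreover have "mult (quotient_alg A I) (fiber x) (fiber y) = fiber (mul x y)" for x y
  proof -
    have "alg_coset A I (mult A a b) = fiber (mul x y)" if "a \<in> fiber x" "b \<in> fiber y" for a b
      using that coset[OF mult_closed, of a b] ev_mult by (simp add: fiber_def)
    then show ?thesis using fiberE[of x] fiberE[of y] by (auto simp: quotient_alg_def)
  qed
  moreover have "bij_betw fiber UNIV (range fiber)" using inj by (simp add: bij_betw_def)
  ultimately show ?thesis unfolding alg_iso_def carrier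
      by (intro exI[of _ fiber]) (simp add: type_alg_def)
qed

definition linear_ext :: "('f::field \<Rightarrow> 'b::ab_group_add \<Rightarrow> 'b) \<Rightarrow> ('x \<Rightarrow> 'b) \<Rightarrow> ('x \<Rightarrow>\<^sub>0 'f) \<Rightarrow> 'b" where
  "linear_ext s g f = (\<Sum>p\<in>Poly_Mapping.keys f. s (Poly_Mapping.lookup f p) (g p))"

context vector_space begin

lemma linear_ext_superset:
  assumes "finite K" "Poly_Mapping.keys f \<subseteq> K"
  shows "linear_ext scale g f = (\<Sum>p\<in>K. scale (Poly_Mapping.lookup f p) (g p))"
  unfolding linear_ext_def using assms by (intro sum.mono_neutral_left) (auto simp: in_keys_iff)

lemma linear_ext_add: "linear_ext scale g (f + f') = linear_ext scale g f + linear_ext scale g f'"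
proof -
  let ?K = "Poly_Mapping.keys f \<union> Poly_Mapping.keys f'"
  show ?thesis
    using linear_ext_superset[of ?K f g] linear_ext_superset[of ?K f' g] linear_ext_superset[of ?K
        "f + f'" g] keys_add[of f f']
    by (simp add: lookup_add scale_left_distrib sum.distrib)
qed

lemma linear_ext_smult: "linear_ext scale g (free_smult c f) = scale c (linear_ext scale g f)"
proof -
  have "Poly_Mapping.keys (free_smult c f) \<subseteq> Poly_Mapping.keys f"
    by (auto simp: in_keys_iff lookup_free_smult)
  then show ?thesis
    using linear_ext_superset[of "Poly_Mapping.keys f" "free_smult c f" g]
    by (simp add: lookup_free_smult linear_ext_def scale_sum_right)
qed

lemma linear_ext_single: "linear_ext scale g (Poly_Mapping.single p c) = scale c (g p)"
  using linear_ext_superset[of "{p}" "Poly_Mapping.single p c" g] by simp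

lemma linear_ext_zero: "linear_ext scale g 0 = 0"
  by (simp add: linear_ext_def)

lemma linear_ext_diff: "linear_ext scale g (f - f') = linear_ext scale g f - linear_ext scale g f'"
  using linear_ext_add[of g "f - f'" f'] by (simp add: algebra_simps)

lemma linear_ext_sum: "linear_ext scale g (sum h K) = (\<Sum>k\<in>K. linear_ext scale g (h k))"
  by (induction K rule: infinite_finite_induct) (simp_all add: linear_ext_add linear_ext_zero)

end

lemma poly_mapping_eq_sum_singles:
  "f = (\<Sum>p\<in>Poly_Mapping.keys f. free_smult (Poly_Mapping.lookup f p) (Poly_Mapping.single p 1))"
  by (rule poly_mapping_eqI)
    (auto simp: lookup_sum lookup_free_smult lookup_single when_def if_distrib in_keys_iff cong:
        if_cong)

context octonion_frame begin

lemma uprod_add_left: "uprod (x + y) u = uprod x u + uprod y u"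
  by (simp add: uprod_def embed_add bilinear scale_right_distrib)
lemma uprod_add_right: "uprod u (x + y) = uprod u x + uprod u y"
  by (simp add: uprod_def embed_add bilinear scale_right_distrib)
lemma uprod_scale_left: "uprod (c \<cdot> x) u = c \<cdot> uprod x u"
  by (simp add: uprod_def embed_scale bilinear mult.commute)
lemma uprod_scale_right: "uprod u (c \<cdot> x) = c \<cdot> uprod u x"
  by (simp add: uprod_def embed_scale bilinear mult.commute)
lemma uprod_zero_left: "uprod 0 u = 0"
  using uprod_scale_left[of 0 0 u] by simp

lemma e_component: "e i \<in> component i"
  by (simp add: component_def mul_self)

lemma embed_unit: "i \<in> imag \<Longrightarrow> embed i (e 1) = e i"
  using xor_one[of i] e_mul[OF one_imag, of "1 XOR i"] s_nonzero[OF one_imag, of "1 XOR i"] two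
  by (cases "i = 1") (auto simp: embed_def simp del: One_nat_def)

lemma uprod_unit: assumes u: "u \<in> component 1" shows "uprod (e 1) u = u"
proof -
  have I: "2 \<in> imag" "3 \<in> imag" "(3::nat) \<noteq> 2" by auto
  have x: "(3::nat) XOR 2 = 1" by code_simp
  have "e 2 \<star> embed 3 u = - ((2 * s 3 2) \<cdot> u)"
    using anticomm[of "e 2"] embed_mul[OF u I(2,1,3)] unfolding x by (simp add: embed_def)
  then show ?thesis
    using embed_unit[OF I(1)] s_skew[OF I(2,1,3)] s_nonzero[OF I(2,1)] two by (simp add: uprod_def)
qed

text \<open>
  The element of \<open>M\<close> that corresponds to \<open>a \<otimes> u\<close>. It is defined for every \<open>a\<close> of \<open>M\<close>, with the
  product of \<open>U\<close> applied to each coordinate of \<open>a\<close>; for \<open>a\<close> in the exceptional subalgebra these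
  coordinates are multiples of the unit \<open>e\<^sub>1\<close> of \<open>U\<close>. Bilinearity is then evident.
\<close>

definition pure_tensor :: "'m \<Rightarrow> 'm \<Rightarrow> 'm" where
  "pure_tensor a u = (\<Sum>i\<in>imag. embed i (uprod (coord i a) u))"

lemma pure_tensor_add_left: "pure_tensor (a + b) u = pure_tensor a u + pure_tensor b u"
  by (simp add: pure_tensor_def coord_add uprod_add_left embed_add sum.distrib)
lemma pure_tensor_add_right: "pure_tensor a (u + w) = pure_tensor a u + pure_tensor a w"
  by (simp add: pure_tensor_def uprod_add_right embed_add sum.distrib)
lemma pure_tensor_scale_left: "pure_tensor (c \<cdot> a) u = c \<cdot> pure_tensor a u"
  by (simp add: pure_tensor_def coord_scale uprod_scale_left embed_scale scale_sum_right)
lemma pure_tensor_scale_right: "pure_tensor a (c \<cdot> u) = c \<cdot> pure_tensor a u"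
  by (simp add: pure_tensor_def uprod_scale_right embed_scale scale_sum_right)
lemma pure_tensor_zero_left: "pure_tensor 0 u = 0" using pure_tensor_scale_left[of 0 0 u] by simp
lemma pure_tensor_sum_left: "pure_tensor (sum f A) u = (\<Sum>i\<in>A. pure_tensor (f i) u)"
  by (induction A rule: infinite_finite_induct) (simp_all add: pure_tensor_zero_left
      pure_tensor_add_left)

lemma embed_zero: "embed i 0 = 0" by (simp add: embed_def bilinear)

lemma pure_tensor_embed:
  assumes v: "v \<in> component 1" and i: "i \<in> imag" shows "pure_tensor (embed i v) u = embed i (uprod v u)"
proof -
  have "pure_tensor (embed i v) u = (\<Sum>j\<in>imag. if j = i then embed i (uprod v u) else 0)"
    unfolding pure_tensor_def using v i
    by (intro sum.cong) (auto simp: coord_embed coord_embed_other uprod_zero_left embed_zero simp del: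
        One_nat_def)
  then show ?thesis using i by simp
qed

lemma embed_coord_sum: "m = (\<Sum>i\<in>imag. embed i (coord i m))"
  using decomposition[of m] by (simp add: embed_coord)

lemma mul_sum_left: "sum f A \<star> x = (\<Sum>i\<in>A. f i \<star> x)"
  by (induction A rule: infinite_finite_induct) (simp_all add: bilinear)
lemma mul_sum_right: "x \<star> sum f A = (\<Sum>i\<in>A. x \<star> f i)"
  by (induction A rule: infinite_finite_induct) (simp_all add: bilinear)

text \<open>
  On coordinates this is \<open>embed_product\<close> together with \<open>(x u) (y w) = (x y) (u w)\<close> in \<open>U\<close>.
\<close>

lemma pure_tensor_mul:
  assumes u: "u \<in> component 1" and w: "w \<in> component 1"
  shows "pure_tensor a u \<star> pure_tensor b w = pure_tensor (a \<star> b) (uprod u w)"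
proof -
  have interchange: "uprod (uprod x u) (uprod y w) = uprod (uprod x y) (uprod u w)"
    if "x \<in> component 1" "y \<in> component 1" for x y
  proof -
    have "uprod (uprod x u) (uprod y w) = uprod x (uprod u (uprod y w))"
      using that u w by (intro uprod_assoc uprod_component)
    also have "uprod u (uprod y w) = uprod (uprod y u) w"
      using that u w by (simp add: uprod_assoc uprod_commute)
    also have "\<dots> = uprod y (uprod u w)"
      using that u w by (intro uprod_assoc)
    also have "uprod x \<dots> = uprod (uprod x y) (uprod u w)"
      using that u w by (intro uprod_assoc[symmetric] uprod_component)
    finally show ?thesis .
  qed
  have "embed i (uprod (coord i a) u) \<star> embed j (uprod (coord j b) w)
      = pure_tensor (embed i (coord i a) \<star> embed j (coord j b)) (uprod u w)"
          if ij: "i \<in> imag" "j \<in> imag" for i j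
    using embed_product[OF uprod_component[OF coord_component[OF ij(1)] u] uprod_component[OF
        coord_component[OF ij(2)] w] ij]
      embed_product[OF coord_component[OF ij(1)] coord_component[OF ij(2)] ij]
      interchange[OF coord_component[OF ij(1)] coord_component[OF ij(2)]]
      pure_tensor_embed[OF uprod_component[OF coord_component[OF ij(1)] coord_component[OF ij(2)]]
          xor_imag[OF ij]]
    by (simp add: pure_tensor_zero_left pure_tensor_scale_left)
  then have "pure_tensor a u \<star> pure_tensor b w
      = pure_tensor ((\<Sum>i\<in>imag. embed i (coord i a)) \<star> (\<Sum>j\<in>imag. embed j (coord j b))) (uprod u w)"
    by (simp add: pure_tensor_def[of a u] pure_tensor_def[of b w] mul_sum_left mul_sum_right
        pure_tensor_sum_left)
  then show ?thesis by (simp flip: embed_coord_sum)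
qed

definition scalar_alg :: "('f, 'm) alg" where
  "scalar_alg = \<lparr>carrier = component 1, zero = 0, add = (+), smult = scale, mult = uprod\<rparr>"

lemma scalar_alg: "comm_assoc_algebra scalar_alg"
proof (unfold_locales, simp_all add: scalar_alg_def component_subspace uprod_component del: One_nat_def)
  fix x assume "x \<in> component 1"
  then show "\<exists>y\<in>component 1. x + y = 0" using component_subspace(4) by (intro bexI[of _ "- x"]) auto
qed (auto simp: algebra_simps scale_right_distrib scale_left_distrib uprod_add_left uprod_add_right
    uprod_scale_left uprod_scale_right uprod_commute uprod_assoc simp del: One_nat_def)

section \<open>The tensor product\<close>

context
  fixes S :: "'m set"
  assumes S: "subalgebra S (type_alg scale mul)" and e_S: "\<And>i. i \<in> imag \<Longrightarrow> e i \<in> S"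
    and span_S: "\<And>a. a \<in> S \<Longrightarrow> \<exists>\<alpha>. a = (\<Sum>i\<in>imag. \<alpha> i \<cdot> e i)"
begin

lemma S_closed: "0 \<in> S" "a \<in> S \<Longrightarrow> b \<in> S \<Longrightarrow> a + b \<in> S" "a \<in> S \<Longrightarrow> b \<in> S \<Longrightarrow> a \<star> b \<in> S"
    "a \<in> S \<Longrightarrow> c \<cdot> a \<in> S"
  using S by (auto simp: subalgebra_def type_alg_def)

abbreviation "sub_alg \<equiv> (type_alg scale mul)\<lparr>carrier := S\<rparr>"
abbreviation "relations \<equiv> bilinear_relations sub_alg scalar_alg"
abbreviation "pairs \<equiv> S \<times> component 1"

lemma alg_simps:
  "carrier sub_alg = S" "add sub_alg = (+)" "smult sub_alg = scale" "mult sub_alg = mul"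
  "carrier scalar_alg = component 1" "add scalar_alg = (+)" "smult scalar_alg = scale"
      "mult scalar_alg = uprod"
  by (simp_all add: type_alg_def scalar_alg_def)

definition evaluate :: "(('m \<times> 'm) \<Rightarrow>\<^sub>0 'f) \<Rightarrow> 'm" where
  "evaluate = linear_ext scale (\<lambda>(a, u). pure_tensor a u)"

lemmas evaluate_simps = linear_ext_add[of "\<lambda>(a, u). pure_tensor a u", folded evaluate_def]
  linear_ext_diff[of "\<lambda>(a, u). pure_tensor a u", folded evaluate_def]
  linear_ext_smult[of "\<lambda>(a, u). pure_tensor a u", folded evaluate_def]
  linear_ext_single[of "\<lambda>(a, u). pure_tensor a u", folded evaluate_def]
  linear_ext_zero[of "\<lambda>(a, u). pure_tensor a u", folded evaluate_def]
  linear_ext_sum[of "\<lambda>(a, u). pure_tensor a u", folded evaluate_def]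

interpretation free: vector_space "free_smult :: 'f \<Rightarrow> ('m \<times> 'm \<Rightarrow>\<^sub>0 'f) \<Rightarrow> _"
  by (rule vector_space_free_smult)

abbreviation equiv_mod (infix "\<sim>\<^sub>R" 50) where "f \<sim>\<^sub>R g \<equiv> f - g \<in> free.span relations"

lemma equiv_trans: "f \<sim>\<^sub>R g \<Longrightarrow> g \<sim>\<^sub>R h \<Longrightarrow> f \<sim>\<^sub>R h"
  using free.span_add[of "f - g" _ "g - h"] by simp
lemma equiv_sym: "f \<sim>\<^sub>R g \<Longrightarrow> g \<sim>\<^sub>R f"
  using free.span_neg[of "f - g"] by simp
lemma equiv_add: "f \<sim>\<^sub>R g \<Longrightarrow> f' \<sim>\<^sub>R g' \<Longrightarrow> f + f' \<sim>\<^sub>R g + g'"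
  using free.span_add[of "f - g" _ "f' - g'"] by (simp add: algebra_simps)
lemma equiv_smult: "f \<sim>\<^sub>R g \<Longrightarrow> free_smult c f \<sim>\<^sub>R free_smult c g"
  using free.span_scale[of "f - g" _ c] by (simp add: free.scale_right_diff_distrib)
lemma equiv_sum: "(\<And>i. i \<in> K \<Longrightarrow> f i \<sim>\<^sub>R g i) \<Longrightarrow> sum f K \<sim>\<^sub>R sum g K"
proof (induction K rule: infinite_finite_induct)
  case (insert i K)
  show ?case unfolding sum.insert[OF insert.hyps] by (rule equiv_add) (use insert in auto)
qed (simp_all add: free.span_zero)

lemma pair_relations:
  shows pair_add_left: "\<lbrakk>a \<in> S; b \<in> S; u \<in> component 1\<rbrakk> \<Longrightarrow> basis_pair (a + b) u \<sim>\<^sub>R basis_pair a u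
      + basis_pair b u"
    and pair_add_right: "\<lbrakk>a \<in> S; u \<in> component 1; w \<in> component 1\<rbrakk> \<Longrightarrow> basis_pair a (u
        + w) \<sim>\<^sub>R basis_pair a u + basis_pair a w"
    and pair_scale_left: "\<lbrakk>a \<in> S; u \<in> component 1\<rbrakk>
        \<Longrightarrow> basis_pair (c \<cdot> a) u \<sim>\<^sub>R free_smult c (basis_pair a u)"
    and pair_scale_right: "\<lbrakk>a \<in> S; u \<in> component 1\<rbrakk>
        \<Longrightarrow> basis_pair a (c \<cdot> u) \<sim>\<^sub>R free_smult c (basis_pair a u)"
  unfolding diff_diff_eq[symmetric]
  by (rule free.span_base; unfold bilinear_relations_def alg_simps; blast)+

lemma pair_zero: "u \<in> component 1 \<Longrightarrow> basis_pair 0 u \<sim>\<^sub>R 0"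
  using pair_scale_left[OF S_closed(1), of u 0] by simp

lemma pair_sum_left:
  assumes u: "u \<in> component 1" and K: "finite K" "K \<subseteq> imag"
  shows "(\<Sum>i\<in>K. \<alpha> i \<cdot> e i) \<in> S \<and> basis_pair (\<Sum>i\<in>K. \<alpha> i \<cdot> e i) u \<sim>\<^sub>R (\<Sum>i\<in>K. basis_pair (e i) (\<alpha> i \<cdot> u))"
  using K
proof (induction K rule: finite_induct)
  case empty
  then show ?case using S_closed(1) pair_zero[OF u] by simp
next
  case (insert i K)
  let ?r = "\<Sum>i\<in>K. \<alpha> i \<cdot> e i"
  have IH: "?r \<in> S" "basis_pair ?r u \<sim>\<^sub>R (\<Sum>i\<in>K. basis_pair (e i) (\<alpha> i \<cdot> u))" using insert by auto
  have i: "e i \<in> S" "\<alpha> i \<cdot> e i \<in> S" using insert e_S S_closed(4) by auto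
  have "basis_pair (\<alpha> i \<cdot> e i) u \<sim>\<^sub>R basis_pair (e i) (\<alpha> i \<cdot> u)"
    using equiv_trans[OF pair_scale_left[OF i(1) u] equiv_sym[OF pair_scale_right[OF i(1) u]]] .
  then have "basis_pair (\<alpha> i \<cdot> e i + ?r) u \<sim>\<^sub>R basis_pair (e i) (\<alpha> i \<cdot> u)
      + (\<Sum>i\<in>K. basis_pair (e i) (\<alpha> i \<cdot> u))"
    using equiv_trans[OF pair_add_left[OF i(2) IH(1) u] equiv_add[OF _ IH(2)]] by blast
  then show ?case using insert S_closed(2)[OF i(2) IH(1)] by simp
qed

text \<open>
  The representative \<open>\<Sum>i. e\<^sub>i \<otimes> u\<^sub>i\<close> of the tensors with value \<open>m\<close>.
\<close>

definition normal_form :: "'m \<Rightarrow> (('m \<times> 'm) \<Rightarrow>\<^sub>0 'f)" where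
  "normal_form m = (\<Sum>i\<in>imag. basis_pair (e i) (coord i m))"

lemma normal_form_add: "normal_form (m + m') \<sim>\<^sub>R normal_form m + normal_form m'"
  unfolding normal_form_def coord_add sum.distrib[symmetric]
  by (intro equiv_sum pair_add_right e_S coord_component)

lemma normal_form_scale: "normal_form (c \<cdot> m) \<sim>\<^sub>R free_smult c (normal_form m)"
  unfolding normal_form_def coord_scale free.scale_sum_right
  by (intro equiv_sum pair_scale_right e_S coord_component)

lemma pure_tensor_e: "u \<in> component 1 \<Longrightarrow> i \<in> imag \<Longrightarrow> pure_tensor (e i) u = embed i u"
  using pure_tensor_embed[OF e_component, of i u] by (simp add: embed_unit uprod_unit del: One_nat_def)

lemma coord_sum: "coord j (sum f K) = (\<Sum>i\<in>K. coord j (f i))"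
proof (induction K rule: infinite_finite_induct)
  case (insert i K)
  then show ?case by (simp add: coord_add)
qed (use coord_scale[of j 0 0] in simp_all)

lemma pair_normal_form:
  assumes a: "a \<in> S" and u: "u \<in> component 1"
  shows "basis_pair a u \<sim>\<^sub>R normal_form (pure_tensor a u)"
proof -
  obtain \<alpha> where \<alpha>: "a = (\<Sum>i\<in>imag. \<alpha> i \<cdot> e i)" using span_S[OF a] by blast
  have "pure_tensor a u = (\<Sum>i\<in>imag. embed i (\<alpha> i \<cdot> u))"
    unfolding \<alpha> pure_tensor_sum_left pure_tensor_scale_left embed_scale
        by (intro sum.cong) (simp_all add: pure_tensor_e u del: One_nat_def)
  moreover have "coord j (\<Sum>i\<in>imag. embed i (\<alpha> i \<cdot> u)) = \<alpha> j \<cdot> u" if j: "j \<in> imag" for j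
  proof -
    have "coord j (\<Sum>i\<in>imag. embed i (\<alpha> i \<cdot> u)) = (\<Sum>i\<in>imag. coord j (embed i (\<alpha> i \<cdot> u)))"
      by (rule coord_sum)
    also have "\<dots> = (\<Sum>i\<in>imag. if i = j then \<alpha> j \<cdot> u else 0)"
      using j component_subspace(3)[OF u]
      by (intro sum.cong) (auto simp: coord_embed coord_embed_other simp del: One_nat_def)
    finally show ?thesis using j by simp
  qed
  ultimately have "normal_form (pure_tensor a u) = (\<Sum>i\<in>imag. basis_pair (e i) (\<alpha> i \<cdot> u))"
    unfolding normal_form_def by (intro sum.cong) simp_all
  then show ?thesis using pair_sum_left[OF u, of imag \<alpha>] \<alpha> by simp
qed

lemma normal_form_evaluate:
  assumes f: "Poly_Mapping.keys f \<subseteq> pairs"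
  shows "f \<sim>\<^sub>R normal_form (evaluate f)"
proof -
  have "(\<Sum>p\<in>K. free_smult (c p) (Poly_Mapping.single p 1)) \<sim>\<^sub>R
      normal_form (evaluate (\<Sum>p\<in>K. free_smult (c p) (Poly_Mapping.single p 1)))"
    if "finite K" "K \<subseteq> pairs" for K c
    using that
  proof (induction K rule: finite_induct)
    case empty
    have "0 \<sim>\<^sub>R normal_form 0" using equiv_sym[OF normal_form_scale[of 0 0]] by simp
    then show ?case by (simp add: evaluate_simps)
  next
    case (insert p K)
    obtain a u where p: "p = (a, u)" "a \<in> S" "u \<in> component 1" using insert by auto
    have "free_smult (c p) (basis_pair a u) \<sim>\<^sub>R normal_form (c p \<cdot> pure_tensor a u)"
      using equiv_trans[OF equiv_smult[OF pair_normal_form[OF p(2,3)]]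
          equiv_sym[OF normal_form_scale]] .
    then have "free_smult (c p) (basis_pair a u) \<sim>\<^sub>R normal_form (evaluate (free_smult (c p) (basis_pair
        a u)))"
      by (simp add: evaluate_simps)
    from equiv_trans[OF equiv_add[OF this insert.IH] equiv_sym[OF normal_form_add]]
    show ?case using insert by (simp add: evaluate_simps p(1))
  qed
  from this[of "Poly_Mapping.keys f" "Poly_Mapping.lookup f"] show ?thesis
    using f by (simp flip: poly_mapping_eq_sum_singles)
qed

lemma keys_smult: "Poly_Mapping.keys (free_smult c f) \<subseteq> Poly_Mapping.keys f"
  by (auto simp: in_keys_iff lookup_free_smult)

lemma keys_pairs:
  fixes f g :: "('m \<times> 'm) \<Rightarrow>\<^sub>0 'f"
  shows "\<lbrakk>Poly_Mapping.keys f \<subseteq> pairs; Poly_Mapping.keys g \<subseteq> pairs\<rbrakk> \<Longrightarrow> Poly_Mapping.keys (f + g) \<subseteq> pairs"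
    and "\<lbrakk>Poly_Mapping.keys f \<subseteq> pairs; Poly_Mapping.keys g \<subseteq> pairs\<rbrakk> \<Longrightarrow> Poly_Mapping.keys (f - g) \<subseteq> pairs"
    and "Poly_Mapping.keys f \<subseteq> pairs \<Longrightarrow> Poly_Mapping.keys (free_smult c f) \<subseteq> pairs"
    and "\<lbrakk>a \<in> S; u \<in> component 1\<rbrakk> \<Longrightarrow> Poly_Mapping.keys (Poly_Mapping.single (a, u) c) \<subseteq> pairs"
  using keys_add[of f g] keys_diff[of f g] keys_smult[of c f] by (blast, blast, blast, simp)

text \<open>
  The relations evaluate to zero because \<open>pure_tensor\<close> is bilinear. Conversely a tensor with value
  zero is congruent to its normal form, which is \<open>normal_form 0\<close> and hence congruent to zero.
\<close>

lemma span_relations: "free.span relations = {f. Poly_Mapping.keys f \<subseteq> pairs \<and> evaluate f = 0}"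
proof
  let ?I = "{f. Poly_Mapping.keys f \<subseteq> pairs \<and> evaluate f = 0}"
  have "free.subspace ?I"
    unfolding free.subspace_def mem_Collect_eq
    by (intro conjI ballI allI; (elim conjE CollectE)?)
      (simp_all add: keys_pairs evaluate_simps del: One_nat_def)
  moreover have "relations \<subseteq> ?I"
    unfolding bilinear_relations_def alg_simps Un_subset_iff
  proof (intro conjI subsetI; elim CollectE exE conjE; simp only: mem_Collect_eq)
    fix a b u c :: 'm assume "a \<in> S" "b \<in> S" "u \<in> component 1"
    then show "Poly_Mapping.keys (basis_pair (a + b) u - basis_pair a u
        - basis_pair b u :: _ \<Rightarrow>\<^sub>0 'f) \<subseteq> pairs \<and>
        evaluate (basis_pair (a + b) u - basis_pair a u - basis_pair b u) = 0"
      by (intro conjI keys_pairs S_closed) (simp_all add: evaluate_simps pure_tensor_add_left)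
  next
    fix a u w :: 'm assume "a \<in> S" "u \<in> component 1" "w \<in> component 1"
    then show "Poly_Mapping.keys (basis_pair a (u + w) - basis_pair a u
        - basis_pair a w :: _ \<Rightarrow>\<^sub>0 'f) \<subseteq> pairs \<and>
        evaluate (basis_pair a (u + w) - basis_pair a u - basis_pair a w) = 0"
      by (intro conjI keys_pairs component_subspace) (simp_all add: evaluate_simps
          pure_tensor_add_right)
  next
    fix c a u assume "a \<in> S" "u \<in> component 1"
    then show "Poly_Mapping.keys (basis_pair (c \<cdot> a) u
        - free_smult c (basis_pair a u) :: _ \<Rightarrow>\<^sub>0 'f) \<subseteq> pairs \<and>
        evaluate (basis_pair (c \<cdot> a) u - free_smult c (basis_pair a u)) = 0"
      and "Poly_Mapping.keys (basis_pair a (c \<cdot> u)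
          - free_smult c (basis_pair a u) :: _ \<Rightarrow>\<^sub>0 'f) \<subseteq> pairs \<and>
        evaluate (basis_pair a (c \<cdot> u) - free_smult c (basis_pair a u)) = 0"
      by (intro conjI keys_pairs S_closed component_subspace; simp add: evaluate_simps
          pure_tensor_scale_left pure_tensor_scale_right)+
  qed
  ultimately show "free.span relations \<subseteq> ?I" by (rule free.span_minimal[rotated])
  show "?I \<subseteq> free.span relations"
  proof
    fix f assume f: "f \<in> ?I"
    then have "f \<sim>\<^sub>R normal_form 0" using normal_form_evaluate[of f] unfolding mem_Collect_eq by metis
    moreover have "normal_form 0 \<sim>\<^sub>R 0" using normal_form_scale[of 0 0] by simp
    ultimately show "f \<in> free.span relations" using equiv_trans by fastforce
  qed
qed

lemma evaluate_mult:
  assumes f: "Poly_Mapping.keys f \<subseteq> pairs" and g: "Poly_Mapping.keys g \<subseteq> pairs"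
  shows "evaluate (mult (free_prod_alg sub_alg scalar_alg) f g) = evaluate f \<star> evaluate g"
proof -
  have *: "evaluate (Poly_Mapping.single (fst p \<star> fst q, uprod (snd p) (snd q)) (c * d))
     = (c \<cdot> pure_tensor (fst p) (snd p)) \<star> (d \<cdot> pure_tensor (fst q) (snd q))" if "p \<in> pairs" "q \<in> pairs"
         for p q c d
    using that pure_tensor_mul[of "snd p" "snd q" "fst p" "fst q"]
        by (auto simp: evaluate_simps bilinear mult.commute)
  have "evaluate (mult (free_prod_alg sub_alg scalar_alg) f g) =
     (\<Sum>p\<in>Poly_Mapping.keys f. \<Sum>q\<in>Poly_Mapping.keys g. (Poly_Mapping.lookup f p \<cdot> pure_tensor (fst p)
         (snd p)) \<star> (Poly_Mapping.lookup g q \<cdot> pure_tensor (fst q) (snd q)))"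
    unfolding free_prod_alg_def alg_simps alg.simps evaluate_simps(6)
    by (intro sum.cong[OF refl] *) (use f g in blast)+
  also have "\<dots> = evaluate f \<star> evaluate g"
    unfolding evaluate_def linear_ext_def mul_sum_left mul_sum_right case_prod_beta by (rule sum.swap)
  finally show ?thesis .
qed

lemma keys_mult:
  assumes f: "Poly_Mapping.keys f \<subseteq> pairs" and g: "Poly_Mapping.keys g \<subseteq> pairs"
  shows "Poly_Mapping.keys (mult (free_prod_alg sub_alg scalar_alg) f g) \<subseteq> pairs"
proof -
  have "Poly_Mapping.keys (Poly_Mapping.single (fst p \<star> fst q, uprod (snd p) (snd q))
      (Poly_Mapping.lookup f p * Poly_Mapping.lookup g q)) \<subseteq> pairs"
    if "p \<in> Poly_Mapping.keys f" "q \<in> Poly_Mapping.keys g" for p q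
  proof -
    have "p \<in> pairs" "q \<in> pairs" using f g that by blast+
    then show ?thesis by (intro keys_pairs S_closed uprod_component) (auto simp del: One_nat_def)
  qed
  then have "Poly_Mapping.keys (\<Sum>p\<in>Poly_Mapping.keys f. \<Sum>q\<in>Poly_Mapping.keys g.
      Poly_Mapping.single (fst p \<star> fst q, uprod (snd p) (snd q)) (Poly_Mapping.lookup f p *
          Poly_Mapping.lookup g q)) \<subseteq> pairs"
    by (intro subset_trans[OF keys_sum] UN_least)
  then show ?thesis by (simp only: free_prod_alg_def alg_simps alg.simps)
qed

lemma evaluate_normal_form: "evaluate (normal_form m) = m"
  unfolding normal_form_def evaluate_simps scale_one prod.case
  using embed_coord_sum[of m] pure_tensor_e[OF coord_component] by simp

lemma keys_normal_form: "Poly_Mapping.keys (normal_form m) \<subseteq> pairs"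
  unfolding normal_form_def by (intro subset_trans[OF keys_sum] UN_least keys_pairs e_S coord_component)

lemma tensor_iso: "type_alg scale mul \<cong> tensor_alg sub_alg scalar_alg"
proof -
  let ?A = "free_prod_alg sub_alg scalar_alg"
  have C: "f \<in> carrier ?A \<longleftrightarrow> Poly_Mapping.keys f \<subseteq> pairs" for f
    by (simp add: free_prod_alg_def alg_simps)
  have smult: "smult ?A = free_smult" and add: "add ?A = (+)"
    by (simp_all add: free_prod_alg_def)
  show ?thesis
    unfolding tensor_alg_def span_relations
  proof (rule type_alg_iso_quotient[where ev = evaluate])
    show "add ?A = (+)" by (rule add)
    show "f - g \<in> carrier ?A" if "f \<in> carrier ?A" "g \<in> carrier ?A" for f g
      using that unfolding C by (rule keys_pairs(2))
    show "smult ?A c f \<in> carrier ?A" if "f \<in> carrier ?A" for c f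
      using that unfolding C smult by (rule keys_pairs(3))
    show "mult ?A f g \<in> carrier ?A" if "f \<in> carrier ?A" "g \<in> carrier ?A" for f g
      using that unfolding C by (rule keys_mult)
    show "evaluate (f + g) = evaluate f + evaluate g" for f g by (rule evaluate_simps)
    show "evaluate (smult ?A c f) = c \<cdot> evaluate f" for c f unfolding smult by (rule evaluate_simps)
    show "evaluate (mult ?A f g) = evaluate f \<star> evaluate g" if "f \<in> carrier ?A" "g \<in> carrier ?A" for f g
      using that unfolding C by (rule evaluate_mult)
    show "\<exists>f\<in>carrier ?A. evaluate f = m" for m
      using C keys_normal_form evaluate_normal_form by blast
    show "{f. Poly_Mapping.keys f \<subseteq> pairs \<and> evaluate f = 0} = {f \<in> carrier ?A. evaluate f = 0}"
      unfolding C ..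
  qed
qed

end
end

section \<open>Octonion bases of the exceptional algebras\<close>

text \<open>
  The signs of the products of the units \<open>1, i, j, k, v, v i, v j, v k\<close>, numbered from \<open>0\<close> to \<open>7\<close>,
  in the octonions with \<open>i\<^sup>2 = j\<^sup>2 = k\<^sup>2 = -1\<close> and \<open>v\<^sup>2 = \<gamma>\<close>. A factor \<open>\<gamma>\<close> appears precisely if
  both units contain \<open>v\<close>, that is, if both numbers are at least \<open>4\<close>.
\<close>

definition sign_table :: "int list list" where
  "sign_table =
    [[1,  1,  1,  1,  1,  1,  1,  1],
     [1, -1,  1, -1, -1,  1, -1,  1],
     [1, -1, -1,  1, -1,  1,  1, -1],
     [1,  1, -1, -1, -1, -1,  1,  1],
     [1,  1,  1,  1,  1,  1,  1,  1],
     [1, -1, -1,  1, -1,  1,  1, -1],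
     [1,  1, -1, -1, -1, -1,  1,  1],
     [1, -1,  1, -1, -1,  1, -1,  1]]"

definition oct_sign :: "nat \<Rightarrow> nat \<Rightarrow> int" where
  "oct_sign i j = sign_table ! i ! j"

definition oct_exponent :: "nat \<Rightarrow> nat \<Rightarrow> nat" where
  "oct_exponent i j = (if 4 \<le> i \<and> 4 \<le> j then 1 else 0)"

definition oct_coeff :: "'f::field \<Rightarrow> nat \<Rightarrow> nat \<Rightarrow> 'f" where
  "oct_coeff \<gamma> i j = of_int (oct_sign i j) * \<gamma> ^ oct_exponent i j"

definition oct_norm :: "'f::field \<Rightarrow> nat \<Rightarrow> 'f" where
  "oct_norm \<gamma> i = (if i < 4 then 1 else - \<gamma>)"

lemma imag_upt: "i \<in> imag \<longleftrightarrow> i \<in> set [1..<8]" by auto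

lemma oct_sign_pairs:
  "\<forall>i\<in>set [1..<8]. \<forall>j\<in>set [1..<8]. oct_sign i j \<noteq> 0 \<and> oct_sign i j * oct_sign i j = 1 \<and>
    (i \<noteq> j \<longrightarrow> oct_sign j i = - oct_sign i j \<and> oct_exponent j i = oct_exponent i j
      \<and> oct_sign i j * oct_sign (i XOR j) i = (if i < 4 then 1 else - 1)
      \<and> oct_exponent i j + oct_exponent (i XOR j) i = (if i < 4 then 0 else 1))"
  by code_simp

lemma oct_sign_triples:
  "\<forall>i\<in>set [1..<8]. \<forall>j\<in>set [1..<8]. \<forall>k\<in>set [1..<8].
    i \<noteq> j \<longrightarrow> i \<noteq> k \<longrightarrow> j \<noteq> k \<longrightarrow> i XOR j \<noteq> k \<longrightarrow>
      oct_sign i j * oct_sign (i XOR j) k = - oct_sign j k * oct_sign i (j XOR k)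
      \<and> oct_exponent i j + oct_exponent (i XOR j) k = oct_exponent j k + oct_exponent i (j XOR k)"
  by code_simp

lemma oct_coeff_mult:
  "oct_coeff \<gamma> i j * oct_coeff \<gamma> k l =
    of_int (oct_sign i j * oct_sign k l) * \<gamma> ^ (oct_exponent i j + oct_exponent k l)"
  by (simp add: oct_coeff_def power_add)

lemma oct_coeff_skew:
  assumes "i \<in> imag" "j \<in> imag" "i \<noteq> j" shows "oct_coeff \<gamma> j i = - oct_coeff \<gamma> i j"
proof -
  have "oct_sign j i = - oct_sign i j \<and> oct_exponent j i = oct_exponent i j"
    using oct_sign_pairs assms unfolding imag_upt by blast
  then show ?thesis by (simp add: oct_coeff_def)
qed

lemma oct_coeff_nonzero:
  assumes "\<gamma> \<noteq> 0" "i \<in> imag" "j \<in> imag" shows "oct_coeff (\<gamma> :: 'f::field) i j \<noteq> 0"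
proof -
  have "oct_sign i j * oct_sign i j = 1" using oct_sign_pairs assms(2,3) unfolding imag_upt by blast
  then have "of_int (oct_sign i j) * (of_int (oct_sign i j) :: 'f) = 1" by (metis of_int_1 of_int_mult)
  then have "(of_int (oct_sign i j) :: 'f) \<noteq> 0" by auto
  then show ?thesis using assms(1) by (simp add: oct_coeff_def)
qed

lemma oct_coeff_norm:
  assumes "i \<in> imag" "j \<in> imag" "i \<noteq> j"
  shows "oct_coeff \<gamma> i j * oct_coeff \<gamma> (i XOR j) i = oct_norm \<gamma> i"
proof -
  have "oct_sign i j * oct_sign (i XOR j) i = (if i < 4 then 1 else - 1)
      \<and> oct_exponent i j + oct_exponent (i XOR j) i = (if i < 4 then 0 else 1)"
    using oct_sign_pairs assms unfolding imag_upt by blast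
  then show ?thesis unfolding oct_coeff_mult oct_norm_def by simp
qed

lemma oct_coeff_assoc:
  assumes "indep i j k"
  shows "oct_coeff \<gamma> i j * oct_coeff \<gamma> (i XOR j) k = - oct_coeff \<gamma> j k * oct_coeff \<gamma> i (j XOR k)"
proof -
  have *: "oct_sign i j * oct_sign (i XOR j) k = - oct_sign j k * oct_sign i (j XOR k)
      \<and> oct_exponent i j + oct_exponent (i XOR j) k = oct_exponent j k + oct_exponent i (j XOR k)"
    using oct_sign_triples indepD[OF assms] unfolding imag_upt by blast
  have "oct_coeff \<gamma> i j * oct_coeff \<gamma> (i XOR j) k = - (oct_coeff \<gamma> j k * oct_coeff \<gamma> i (j XOR k))"
    unfolding oct_coeff_mult using * by simp
  then show ?thesis by simp
qed

text \<open>
  In the applications \<open>X\<close> is a commutator algebra and \<open>one\<close> its unit. Central elements do not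
  contribute to commutators, so that the cosets of the line through the unit multiply like their
  representatives. Composing the quotient map with the inverse of the
  given isomorphism yields a homomorphism onto \<open>T\<close>.
\<close>

lemma unit_quotient_projection:
  fixes X :: "('f::field, 'b) alg" and T :: "('f, 'm) alg" and one :: 'b
  assumes iso: "T \<cong> quotient_alg X {smult X c one | c. True}"
    and T: "\<And>x y. x \<in> carrier T \<Longrightarrow> y \<in> carrier T \<Longrightarrow> add T x y \<in> carrier T \<and> mult T x y \<in> carrier T"
      "\<And>c x. x \<in> carrier T \<Longrightarrow> smult T c x \<in> carrier T"
    and UNIV: "carrier X = UNIV"
    and add: "\<And>x y c d. add X (add X x (smult X c one)) (add X y (smult X d one))
        = add X (add X x y) (smult X (c + d) one)"
    and smult: "\<And>x c r. smult X r (add X x (smult X c one)) = add X (smult X r x) (smult X (r * c) one)"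
    and mult: "\<And>x y c d. mult X (add X x (smult X c one)) (add X y (smult X d one)) = mult X x y"
    and add2: "\<And>x c d. add X (add X x (smult X c one)) (smult X d one) = add X x (smult X (c + d) one)"
    and zero: "\<And>x. add X x (smult X 0 one) = x"
  obtains \<pi> where "range \<pi> = carrier T" "\<And>x y. \<pi> (add X x y) = add T (\<pi> x) (\<pi> y)"
    "\<And>c x. \<pi> (smult X c x) = smult T c (\<pi> x)" "\<And>x y. \<pi> (mult X x y) = mult T (\<pi> x) (\<pi> y)"
    "\<And>x c. \<pi> (add X x (smult X c one)) = \<pi> x"
proof -
  define I where "I = {smult X c one | c. True}"
  define K where "K = alg_coset X I"
  let ?Q = "quotient_alg X I"
  have K: "K x = {add X x (smult X c one) | c. True}" for x
    by (auto simp: K_def alg_coset_def I_def)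
  have K_shift: "K (add X x (smult X c one)) = K x" for x c
  proof -
    have "\<exists>d'. add X x (smult X d one) = add X x (smult X (c + d') one)" for d
      by (rule exI[of _ "d - c"]) simp
    then show ?thesis unfolding K add2 by blast
  qed
  have self: "x \<in> K x" for x
  proof -
    have "add X x (smult X 0 one) \<in> K x" unfolding K by blast
    then show ?thesis by (simp add: zero)
  qed
  have Q: "carrier ?Q = range K" "add ?Q (K x) (K y) = K (add X x y)"
    "smult ?Q c (K x) = K (smult X c x)" "mult ?Q (K x) (K y) = K (mult X x y)" for x y c
  proof -
    show "carrier ?Q = range K" by (simp add: quotient_alg_def UNIV K_def)
    have KD: "\<exists>c. x' = add X x (smult X c one)" if "x' \<in> K x" for x x'
      using that unfolding K by blast
    have a: "K (add X x' y') = K (add X x y)" if "x' \<in> K x" "y' \<in> K y" for x' y'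
      using KD[OF that(1)] KD[OF that(2)] by (auto simp: add K_shift)
    have s: "K (smult X c x') = K (smult X c x)" if "x' \<in> K x" for x'
      using KD[OF that] by (auto simp: smult K_shift)
    have m: "K (mult X x' y') = K (mult X x y)" if "x' \<in> K x" "y' \<in> K y" for x' y'
      using KD[OF that(1)] KD[OF that(2)] by (auto simp: mult)
    have "add ?Q (K x) (K y) = (\<Union>p\<in>K x. \<Union>q\<in>K y. K (add X x y))"
      unfolding quotient_alg_def alg.simps K_def[symmetric] I_def[symmetric] by (intro SUP_cong refl a)
    then show "add ?Q (K x) (K y) = K (add X x y)" using self by auto
    have "smult ?Q c (K x) = (\<Union>p\<in>K x. K (smult X c x))"
      unfolding quotient_alg_def alg.simps K_def[symmetric] I_def[symmetric] by (intro SUP_cong refl s)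
    then show "smult ?Q c (K x) = K (smult X c x)" using self by auto
    have "mult ?Q (K x) (K y) = (\<Union>p\<in>K x. \<Union>q\<in>K y. K (mult X x y))"
      unfolding quotient_alg_def alg.simps K_def[symmetric] I_def[symmetric] by (intro SUP_cong refl m)
    then show "mult ?Q (K x) (K y) = K (mult X x y)" using self by auto
  qed
  obtain \<phi> where bij: "bij_betw \<phi> (carrier T) (range K)"
    and \<phi>: "\<And>x y. \<lbrakk>x \<in> carrier T; y \<in> carrier T\<rbrakk> \<Longrightarrow> \<phi> (add T x y) = add ?Q (\<phi> x) (\<phi> y)"
      "\<And>c x. x \<in> carrier T \<Longrightarrow> \<phi> (smult T c x) = smult ?Q c (\<phi> x)"
      "\<And>x y. \<lbrakk>x \<in> carrier T; y \<in> carrier T\<rbrakk> \<Longrightarrow> \<phi> (mult T x y) = mult ?Q (\<phi> x) (\<phi> y)"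
    using iso unfolding alg_iso_def I_def[symmetric] Q(1) by blast
  define \<pi> where "\<pi> x = inv_into (carrier T) \<phi> (K x)" for x
  have \<pi>_in: "\<pi> x \<in> carrier T" for x
    unfolding \<pi>_def using bij by (metis bij_betw_imp_surj_on inv_into_into rangeI)
  have \<phi>\<pi>: "\<phi> (\<pi> x) = K x" for x
    unfolding \<pi>_def using bij by (metis bij_betw_inv_into_right rangeI)
  have eqI: "\<pi> x = y" if "y \<in> carrier T" "\<phi> y = K x" for x y
    unfolding \<pi>_def using bij that by (metis bij_betw_inv_into_left)
  have "range \<pi> = carrier T"
  proof
    show "carrier T \<subseteq> range \<pi>"
    proof
      fix y assume y: "y \<in> carrier T"
      then obtain x where "\<phi> y = K x" using bij by (metis bij_betwE imageE)
      then show "y \<in> range \<pi>" using eqI[OF y] by (metis rangeI)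
    qed
  qed (use \<pi>_in in auto)
  then show thesis
  proof (rule that)
    show "\<pi> (add X x y) = add T (\<pi> x) (\<pi> y)" for x y
      by (rule eqI) (simp_all add: \<pi>_in T \<phi> \<phi>\<pi> Q)
    show "\<pi> (smult X c x) = smult T c (\<pi> x)" for c x
      by (rule eqI) (simp_all add: \<pi>_in T \<phi> \<phi>\<pi> Q)
    show "\<pi> (mult X x y) = mult T (\<pi> x) (\<pi> y)" for x y
      by (rule eqI) (simp_all add: \<pi>_in T \<phi> \<phi>\<pi> Q)
    show "\<pi> (add X x (smult X c one)) = \<pi> x" for x c
      unfolding \<pi>_def K_shift ..
  qed
qed

text \<open>
  The spanning condition is stated with the operations of the record, since \<open>X\<close> is not assumed to
  be of a type with an addition.
\<close>

definition octonion_basis :: "('f::field, 'b) alg \<Rightarrow> 'f \<Rightarrow> (nat \<Rightarrow> 'b) \<Rightarrow> bool" where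
  "octonion_basis X \<gamma> b \<longleftrightarrow>
     (\<forall>i\<in>imag. \<forall>j\<in>imag. i \<noteq> j \<longrightarrow> mult X (b i) (b j) = smult X (2 * oct_coeff \<gamma> i j) (b (i XOR j)))
     \<and> (\<forall>x. \<exists>c. x = foldr (\<lambda>i. add X (smult X (c i) (b i))) [1..<8] (smult X (c 0) (b 0)))"

lemma imag_cases: "i \<in> imag \<Longrightarrow> i = 1 \<or> i = 2 \<or> i = 3 \<or> i = 4 \<or> i = 5 \<or> i = 6 \<or> i = 7"
  unfolding imag_iff by linarith

lemma xor_table:
  "(1::nat) XOR 3 = 2" "(1::nat) XOR 5 = 4" "(1::nat) XOR 7 = 6" "(3::nat) XOR 1 = 2"
      "(5::nat) XOR 1 = 4" "(7::nat) XOR 1 = 6"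
  "(1::nat) XOR 2 = 3" "(1::nat) XOR 4 = 5" "(1::nat) XOR 6 = 7" "(2::nat) XOR 1 = 3"
      "(4::nat) XOR 1 = 5" "(6::nat) XOR 1 = 7"
  "(2::nat) XOR 3 = 1" "(3::nat) XOR 2 = 1" "(4::nat) XOR 5 = 1" "(5::nat) XOR 4 = 1"
      "(6::nat) XOR 7 = 1" "(7::nat) XOR 6 = 1"
  "(2::nat) XOR 4 = 6" "(2::nat) XOR 5 = 7" "(2::nat) XOR 6 = 4" "(2::nat) XOR 7 = 5"
  "(4::nat) XOR 2 = 6" "(5::nat) XOR 2 = 7" "(6::nat) XOR 2 = 4" "(7::nat) XOR 2 = 5"
  "(3::nat) XOR 4 = 7" "(3::nat) XOR 5 = 6" "(3::nat) XOR 6 = 5" "(3::nat) XOR 7 = 4"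
  "(4::nat) XOR 3 = 7" "(5::nat) XOR 3 = 6" "(6::nat) XOR 3 = 5" "(7::nat) XOR 3 = 4"
  "(4::nat) XOR 6 = 2" "(4::nat) XOR 7 = 3" "(5::nat) XOR 6 = 3" "(5::nat) XOR 7 = 2"
  "(6::nat) XOR 4 = 2" "(7::nat) XOR 4 = 3" "(6::nat) XOR 5 = 3" "(7::nat) XOR 5 = 2"
  by code_simp+

lemma upt_1_8: "[1..<8] = [1, 2, 3, 4, 5, 6, 7::nat]" by code_simp

definition quat_basis :: "nat \<Rightarrow> 'f::field quat" where
  "quat_basis i = [Quat 1 0 0 0, Quat 0 1 0 0, Quat 0 0 1 0, Quat 0 0 0 1] ! i"

definition oct_basis :: "nat \<Rightarrow> 'f::field quat \<times> 'f quat" where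
  "oct_basis i = (if i < 4 then (quat_basis i, Quat 0 0 0 0) else (Quat 0 0 0 0, quat_basis (i - 4)))"

lemma commutator_oct:
  "add (commutator_alg (oct_alg \<gamma>)) = oct_add" "smult (commutator_alg (oct_alg \<gamma>)) = oct_smult"
  "mult (commutator_alg (oct_alg \<gamma>)) x y = oct_add (oct_mult \<gamma> x y) (oct_smult (- 1) (oct_mult \<gamma> y x))"
  "carrier (commutator_alg (oct_alg \<gamma>)) = UNIV"
  by (simp_all add: commutator_alg_def oct_alg_def alg_minus_def)

lemma octonion_basis_oct: "octonion_basis (commutator_alg (oct_alg \<gamma>)) \<gamma> oct_basis"
  unfolding octonion_basis_def
proof (intro conjI ballI impI allI)
  fix i j assume ij: "i \<in> imag" "j \<in> imag" "i \<noteq> j"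
  show "mult (commutator_alg (oct_alg \<gamma>)) (oct_basis i) (oct_basis j) =
      smult (commutator_alg (oct_alg \<gamma>)) (2 * oct_coeff \<gamma> i j) (oct_basis (i XOR j))"
    using imag_cases[OF ij(1)] imag_cases[OF ij(2)] ij(3)
    by (elim disjE; simp only: xor_table commutator_oct)
      (simp_all add: oct_basis_def quat_basis_def oct_coeff_def oct_sign_def oct_exponent_def
          sign_table_def)
next
  fix x :: "'a quat \<times> 'a quat"
  obtain a0 a1 a2 a3 b0 b1 b2 b3 where x: "x = (Quat a0 a1 a2 a3, Quat b0 b1 b2 b3)"
    by (metis quat.exhaust surj_pair)
  show "\<exists>c. x = foldr (\<lambda>i. add (commutator_alg (oct_alg \<gamma>)) (smult (commutator_alg (oct_alg \<gamma>)) (c i)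
      (oct_basis i))) [1..<8]
      (smult (commutator_alg (oct_alg \<gamma>)) (c 0) (oct_basis 0))"
    unfolding upt_1_8 by (rule exI[of _ "\<lambda>i. [a0, a1, a2, a3, b0, b1, b2, b3] ! i"])
      (simp add: x commutator_oct oct_basis_def quat_basis_def)
qed

text \<open>
  The matrices in coordinates, so that identities between them become polynomial identities.
\<close>

definition cdv :: "'f::field \<Rightarrow> 'f \<Rightarrow> 'f \<Rightarrow> 'f \<Rightarrow> 'f \<Rightarrow> 'f \<Rightarrow> 'f \<Rightarrow> 'f \<Rightarrow> 'f cd_matrix" where
  "cdv a x1 x2 x3 y1 y2 y3 b = CD a (vector [x1, x2, x3]) (vector [y1, y2, y3]) b"

lemma cdv_ops:
  "cd_add (cdv a x1 x2 x3 y1 y2 y3 b) (cdv a' x1' x2' x3' y1' y2' y3' b') =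
     cdv (a + a') (x1 + x1') (x2 + x2') (x3 + x3') (y1 + y1') (y2 + y2') (y3 + y3') (b + b')"
  "cd_smult k (cdv a x1 x2 x3 y1 y2 y3 b) = cdv (k * a) (k * x1) (k * x2) (k * x3) (k * y1) (k * y2) (k
      * y3) (k * b)"
  "cd_mult (cdv a x1 x2 x3 y1 y2 y3 b) (cdv c z1 z2 z3 w1 w2 w3 d) =
     cdv (a * c + (x1 * w1 + x2 * w2 + x3 * w3))
       (a * z1 + d * x1 - (y2 * w3 - y3 * w2)) (a * z2 + d * x2 - (y3 * w1 - y1 * w3)) (a * z3 + d * x3
           - (y1 * w2 - y2 * w1))
       (c * y1 + b * w1 + (x2 * z3 - x3 * z2)) (c * y2 + b * w2 + (x3 * z1 - x1 * z3)) (c * y3 + b * w3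
           + (x1 * z2 - x2 * z1))
       (y1 * z1 + y2 * z2 + y3 * z3 + b * d)"
  by (simp_all add: cdv_def vec_eq_iff forall_3 vector_3 dot3_def vprod3_def sum_3)

lemma cdv_cases: obtains a x1 x2 x3 y1 y2 y3 b where "x = cdv a x1 x2 x3 y1 y2 y3 b"
proof (cases x)
  case (CD a \<alpha> \<beta> b)
  have "\<alpha> = vector [\<alpha>$1, \<alpha>$2, \<alpha>$3]" "\<beta> = vector [\<beta>$1, \<beta>$2, \<beta>$3]"
    by (simp_all add: vec_eq_iff forall_3 vector_3)
  then show thesis using that CD unfolding cdv_def by metis
qed

lemma cdv_inject: "cdv a x1 x2 x3 y1 y2 y3 b = cdv a' x1' x2' x3' y1' y2' y3' b' \<longleftrightarrow>
    a = a' \<and> x1 = x1' \<and> x2 = x2' \<and> x3 = x3' \<and> y1 = y1' \<and> y2 = y2' \<and> y3 = y3' \<and> b = b'"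
  by (auto simp: cdv_def vec_eq_iff forall_3 vector_3)

text \<open>
  Quaternion units inside the split algebra are \<open>i\<close> with \<open>\<alpha> = - \<beta>\<close> the first unit vector, \<open>j\<close>
  likewise with the second, and their product \<open>k\<close>. The diagonal matrix \<open>v\<close> with entries \<open>1\<close>, \<open>-1\<close>
  is orthogonal to them and satisfies \<open>v\<^sup>2 = 1\<close>, hence \<open>\<gamma> = 1\<close>.
\<close>

definition cd_basis :: "nat \<Rightarrow> 'f::field cd_matrix" where
  "cd_basis i =
    [cdv 1 0 0 0 0 0 0 1, cdv 0 1 0 0 (-1) 0 0 0, cdv 0 0 1 0 0 (-1) 0 0, cdv 0 0 0 (-1) 0 0 1 0,
     cdv 1 0 0 0 0 0 0 (-1), cdv 0 1 0 0 1 0 0 0, cdv 0 0 1 0 0 1 0 0, cdv 0 0 0 (-1) 0 0 (-1) 0] ! i"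

lemma commutator_cd:
  "add (commutator_alg split_cd_alg) = cd_add" "smult (commutator_alg split_cd_alg) = cd_smult"
  "mult (commutator_alg split_cd_alg) x y = cd_add (cd_mult x y) (cd_smult (- 1) (cd_mult y x))"
  "carrier (commutator_alg split_cd_alg) = UNIV"
  by (simp_all add: commutator_alg_def split_cd_alg_def alg_minus_def)

lemma octonion_basis_cd:
  assumes two: "(2::'f::field) \<noteq> 0"
  shows "octonion_basis (commutator_alg split_cd_alg) (1::'f) cd_basis"
  unfolding octonion_basis_def
proof (intro conjI ballI impI allI)
  fix i j assume ij: "i \<in> imag" "j \<in> imag" "i \<noteq> j"
  show "mult (commutator_alg split_cd_alg) (cd_basis i) (cd_basis j) =
      smult (commutator_alg split_cd_alg) (2 * oct_coeff (1::'f) i j) (cd_basis (i XOR j))"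
    using imag_cases[OF ij(1)] imag_cases[OF ij(2)] ij(3)
    by (elim disjE; simp only: xor_table commutator_cd)
      (simp_all add: cd_basis_def cdv_ops cdv_inject oct_coeff_def oct_sign_def oct_exponent_def
          sign_table_def)
next
  fix x :: "'f cd_matrix"
  obtain a x1 x2 x3 y1 y2 y3 b where x: "x = cdv a x1 x2 x3 y1 y2 y3 b" by (rule cdv_cases)
  have four: "(4::'f) \<noteq> 0"
  proof -
    have "(4::'f) = 2 * 2" by simp
    then show ?thesis using two by (metis mult_eq_0_iff)
  qed
  show "\<exists>c. x = foldr (\<lambda>i. add (commutator_alg split_cd_alg) (smult (commutator_alg split_cd_alg) (c i)
      (cd_basis i))) [1..<8]
      (smult (commutator_alg split_cd_alg) (c 0) (cd_basis 0))"
    unfolding upt_1_8 using two four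
    by (intro exI[of _ "\<lambda>i. [(a + b) / 2, (x1 - y1) / 2, (x2 - y2) / 2, (y3 - x3) / 2, (a - b) / 2, (x1
        + y1) / 2, (x2 + y2) / 2, - (x3 + y3) / 2] ! i"])
      (simp add: x commutator_cd cd_basis_def cdv_ops cdv_inject field_simps)
qed

lemma two_three_nonzero:
  assumes "CHAR('f::field) \<noteq> 2" "CHAR('f) \<noteq> 3"
  shows "(2::'f) \<noteq> 0" "(3::'f) \<noteq> 0"
proof -
  have *: "of_nat p \<noteq> (0::'f)" if "CHAR('f) \<noteq> p" "prime p" for p :: nat
    using that by (metis CHAR_not_1 of_nat_eq_0_iff_char_dvd prime_nat_iff One_nat_def)
  show "(2::'f) \<noteq> 0" "(3::'f) \<noteq> 0"
    using *[of 2] *[of 3] assms by simp_all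
qed

lemma cd_unit_laws:
  fixes x y :: "'f::field cd_matrix"
  shows "cd_add (cd_add x (cd_smult c (cd_basis 0))) (cd_add y (cd_smult d (cd_basis 0)))
      = cd_add (cd_add x y) (cd_smult (c + d) (cd_basis 0))"
    "cd_smult r (cd_add x (cd_smult c (cd_basis 0)))
        = cd_add (cd_smult r x) (cd_smult (r * c) (cd_basis 0))"
    "cd_add (cd_add x (cd_smult c (cd_basis 0))) (cd_smult d (cd_basis 0)) = cd_add x (cd_smult (c
        + d) (cd_basis 0))"
    "cd_add x (cd_smult 0 (cd_basis 0)) = x"
proof -
  obtain a x1 x2 x3 y1 y2 y3 b where x: "x = cdv a x1 x2 x3 y1 y2 y3 b" by (rule cdv_cases)
  obtain a' x1' x2' x3' y1' y2' y3' b' where y: "y = cdv a' x1' x2' x3' y1' y2' y3' b'"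
      by (rule cdv_cases)
  have e: "cd_basis 0 = cdv 1 0 0 0 0 0 0 (1::'f)" by (simp add: cd_basis_def)
  show "cd_add (cd_add x (cd_smult c (cd_basis 0))) (cd_add y (cd_smult d (cd_basis 0)))
      = cd_add (cd_add x y) (cd_smult (c + d) (cd_basis 0))"
    "cd_smult r (cd_add x (cd_smult c (cd_basis 0)))
        = cd_add (cd_smult r x) (cd_smult (r * c) (cd_basis 0))"
    "cd_add (cd_add x (cd_smult c (cd_basis 0))) (cd_smult d (cd_basis 0)) = cd_add x (cd_smult (c
        + d) (cd_basis 0))"
    "cd_add x (cd_smult 0 (cd_basis 0)) = x"
    unfolding x y e cdv_ops cdv_inject by (simp_all add: algebra_simps)
qed

lemma cd_unit_commutator:
  fixes x y :: "'f::field cd_matrix"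
  shows "cd_add (cd_mult (cd_add x (cd_smult c (cd_basis 0))) (cd_add y (cd_smult d (cd_basis 0))))
      (cd_smult (- 1) (cd_mult (cd_add y (cd_smult d (cd_basis 0))) (cd_add x (cd_smult c (cd_basis
          0))))) =
    cd_add (cd_mult x y) (cd_smult (- 1) (cd_mult y x))"
proof -
  obtain a x1 x2 x3 y1 y2 y3 b where x: "x = cdv a x1 x2 x3 y1 y2 y3 b" by (rule cdv_cases)
  obtain a' x1' x2' x3' y1' y2' y3' b' where y: "y = cdv a' x1' x2' x3' y1' y2' y3' b'"
      by (rule cdv_cases)
  have e: "cd_basis 0 = cdv 1 0 0 0 0 0 0 (1::'f)" by (simp add: cd_basis_def)
  show ?thesis
    unfolding x y e cdv_ops cdv_inject mult_zero_right mult_1_right add_0_right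
    by (intro conjI; algebra)
qed

lemma oct_unit_laws:
  fixes x y :: "'f::field quat \<times> 'f quat"
  shows "oct_add (oct_add x (oct_smult c (oct_basis 0))) (oct_add y (oct_smult d (oct_basis 0)))
      = oct_add (oct_add x y) (oct_smult (c + d) (oct_basis 0))"
    "oct_smult r (oct_add x (oct_smult c (oct_basis 0)))
        = oct_add (oct_smult r x) (oct_smult (r * c) (oct_basis 0))"
    "oct_add (oct_add x (oct_smult c (oct_basis 0))) (oct_smult d (oct_basis 0))
        = oct_add x (oct_smult (c + d) (oct_basis 0))"
    "oct_add x (oct_smult 0 (oct_basis 0)) = x"
proof -
  obtain a0 a1 a2 a3 b0 b1 b2 b3 where x: "x = (Quat a0 a1 a2 a3, Quat b0 b1 b2 b3)"
    by (metis quat.exhaust surj_pair)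
  obtain a0' a1' a2' a3' b0' b1' b2' b3' where y: "y = (Quat a0' a1' a2' a3', Quat b0' b1' b2' b3')"
    by (metis quat.exhaust surj_pair)
  have e: "oct_basis 0 = (Quat 1 0 0 0, Quat 0 0 0 (0::'f))" by (simp add: oct_basis_def quat_basis_def)
  show "oct_add (oct_add x (oct_smult c (oct_basis 0))) (oct_add y (oct_smult d (oct_basis 0)))
      = oct_add (oct_add x y) (oct_smult (c + d) (oct_basis 0))"
    "oct_smult r (oct_add x (oct_smult c (oct_basis 0)))
        = oct_add (oct_smult r x) (oct_smult (r * c) (oct_basis 0))"
    "oct_add (oct_add x (oct_smult c (oct_basis 0))) (oct_smult d (oct_basis 0))
        = oct_add x (oct_smult (c + d) (oct_basis 0))"
    "oct_add x (oct_smult 0 (oct_basis 0)) = x"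
    unfolding x y e by (simp_all add: algebra_simps)
qed

lemma oct_unit_commutator:
  fixes x y :: "'f::field quat \<times> 'f quat"
  shows "oct_add (oct_mult \<gamma> (oct_add x (oct_smult c (oct_basis 0))) (oct_add y (oct_smult d (oct_basis
      0))))
      (oct_smult (- 1) (oct_mult \<gamma> (oct_add y (oct_smult d (oct_basis 0))) (oct_add x (oct_smult c
          (oct_basis 0))))) =
    oct_add (oct_mult \<gamma> x y) (oct_smult (- 1) (oct_mult \<gamma> y x))"
proof -
  obtain a0 a1 a2 a3 b0 b1 b2 b3 where x: "x = (Quat a0 a1 a2 a3, Quat b0 b1 b2 b3)"
    by (metis quat.exhaust surj_pair)
  obtain a0' a1' a2' a3' b0' b1' b2' b3' where y: "y = (Quat a0' a1' a2' a3', Quat b0' b1' b2' b3')"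
    by (metis quat.exhaust surj_pair)
  have e: "oct_basis 0 = (Quat 1 0 0 0, Quat 0 0 0 (0::'f))" by (simp add: oct_basis_def quat_basis_def)
  show ?thesis
    unfolding x y e by (simp add: algebra_simps)
qed

definition spans_octonions ::
  "('f::field \<Rightarrow> 'm::ab_group_add \<Rightarrow> 'm) \<Rightarrow> ('m \<Rightarrow> 'm \<Rightarrow> 'm) \<Rightarrow> 'm set \<Rightarrow> 'f \<Rightarrow> (nat \<Rightarrow> 'm) \<Rightarrow> bool" where
  "spans_octonions sc mu S \<gamma> e \<longleftrightarrow>
    (\<forall>i\<in>imag. e i \<in> S) \<and> (\<forall>a\<in>S. \<exists>\<alpha>. a = (\<Sum>i\<in>imag. sc (\<alpha> i) (e i)))
    \<and> (\<forall>i\<in>imag. \<forall>j\<in>imag. i \<noteq> j \<longrightarrow> mu (e i) (e j) = sc (2 * oct_coeff \<gamma> i j) (e (i XOR j)))"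

text \<open>
  The images of the seven imaginary units span \<open>S\<close>, because the image of the unit is zero.
\<close>

lemma octonion_projection:
  fixes X :: "('f::field, 'b) alg" and scale :: "'f \<Rightarrow> 'm::ab_group_add \<Rightarrow> 'm" and mul :: "'m \<Rightarrow> 'm \<Rightarrow> 'm"
  assumes S: "subalgebra S (type_alg scale mul)" and vs: "vector_space scale"
    and basis: "octonion_basis X \<gamma> b"
    and iso: "(type_alg scale mul)\<lparr>carrier := S\<rparr> \<cong> quotient_alg X {smult X c (b 0) | c. True}"
    and UNIV: "carrier X = UNIV"
    and laws: "\<And>x y c d. add X (add X x (smult X c (b 0))) (add X y (smult X d (b 0)))
        = add X (add X x y) (smult X (c + d) (b 0))"
    "\<And>x c r. smult X r (add X x (smult X c (b 0))) = add X (smult X r x) (smult X (r * c) (b 0))"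
    "\<And>x y c d. mult X (add X x (smult X c (b 0))) (add X y (smult X d (b 0))) = mult X x y"
    "\<And>x c d. add X (add X x (smult X c (b 0))) (smult X d (b 0)) = add X x (smult X (c + d) (b 0))"
    "\<And>x. add X x (smult X 0 (b 0)) = x"
  shows "\<exists>e. spans_octonions scale mul S \<gamma> e"
proof -
  interpret vector_space scale by (rule vs)
  let ?T = "(type_alg scale mul)\<lparr>carrier := S\<rparr>"
  have T: "carrier ?T = S" "add ?T = (+)" "smult ?T = scale" "mult ?T = mul"
      by (simp_all add: type_alg_def)
  obtain \<pi> where \<pi>: "range \<pi> = S" "\<And>x y. \<pi> (add X x y) = \<pi> x + \<pi> y"
      "\<And>c x. \<pi> (smult X c x) = scale c (\<pi> x)"
      "\<And>x y. \<pi> (mult X x y) = mul (\<pi> x) (\<pi> y)" and shift: "\<And>x c. \<pi> (add X x (smult X c (b 0))) = \<pi> x"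
  proof (rule unit_quotient_projection[OF iso _ _ UNIV laws], unfold T)
    show "x + y \<in> S \<and> mul x y \<in> S" if "x \<in> S" "y \<in> S" for x y
      using S that by (simp add: subalgebra_def type_alg_def)
    show "scale c x \<in> S" if "x \<in> S" for c x
      using S that by (simp add: subalgebra_def type_alg_def)
  qed blast
  have "\<pi> (b 0) + \<pi> (b 0) = \<pi> (b 0)" using shift[of "b 0" 1] unfolding \<pi> by simp
  then have b0: "\<pi> (b 0) = 0" by simp
  define e where "e i = \<pi> (b i)" for i
  have "\<exists>\<alpha>. a = (\<Sum>i\<in>imag. scale (\<alpha> i) (e i))" if a: "a \<in> S" for a
  proof -
    obtain x where x: "a = \<pi> x" using a \<pi>(1) by auto
    obtain c where "x = foldr (\<lambda>i. add X (smult X (c i) (b i))) [1..<8] (smult X (c 0) (b 0))"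
      using basis unfolding octonion_basis_def by blast
    moreover have "\<pi> (foldr (\<lambda>i. add X (smult X (c i) (b i))) l (smult X (c 0) (b 0)))
        = (\<Sum>i\<leftarrow>l. scale (c i) (e i))" for l
      by (induction l) (simp_all add: \<pi> b0 e_def)
    moreover have "(\<Sum>i\<leftarrow>[1..<8]. scale (c i) (e i)) = (\<Sum>i\<in>imag. scale (c i) (e i))"
    proof -
      have "imag = set [1..<8]" by auto
      then show ?thesis by (simp only: sum_list_distinct_conv_sum_set distinct_upt)
    qed
    ultimately show ?thesis using x by metis
  qed
  moreover have "mul (e i) (e j) = scale (2 * oct_coeff \<gamma> i j) (e (i XOR j))"
      if "i \<in> imag" "j \<in> imag" "i \<noteq> j" for i j
  proof -
    have "mult X (b i) (b j) = smult X (2 * oct_coeff \<gamma> i j) (b (i XOR j))"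
      using basis that unfolding octonion_basis_def by blast
    then show ?thesis unfolding e_def by (simp flip: \<pi>(3,4))
  qed
  moreover have "e i \<in> S" for i using \<pi>(1) by (auto simp: e_def)
  ultimately show ?thesis unfolding spans_octonions_def by blast
qed

lemma exceptional_basis:
  fixes scale :: "'f::field \<Rightarrow> 'm::ab_group_add \<Rightarrow> 'm" and mul :: "'m \<Rightarrow> 'm \<Rightarrow> 'm"
  assumes two: "(2::'f) \<noteq> 0"
    and S: "subalgebra S (type_alg scale mul)" and vs: "vector_space scale"
    and exc: "exceptional ((type_alg scale mul)\<lparr>carrier := S\<rparr>)"
  shows "\<exists>\<gamma> e. \<gamma> \<noteq> 0 \<and> spans_octonions scale mul S \<gamma> e"
proof -
  let ?T = "(type_alg scale mul)\<lparr>carrier := S\<rparr>"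
  have cd0: "cd_basis 0 = CD 1 0 0 (1::'f)"
    by (simp add: cd_basis_def cdv_def vec_eq_iff forall_3 vector_3)
  have oct0: "oct_basis 0 = (Quat 1 0 0 0, Quat 0 0 0 (0::'f))"
    by (simp add: oct_basis_def quat_basis_def)
  show ?thesis
    using exc unfolding exceptional_def
  proof (elim disjE exE conjE)
    assume M: "?T \<cong> split_M7"
    have iso: "?T \<cong> quotient_alg (commutator_alg split_cd_alg) {smult (commutator_alg split_cd_alg) c
        (cd_basis 0) | c. True}"
      using M unfolding split_M7_def commutator_cd cd0 .
    have "\<exists>e. spans_octonions scale mul S 1 e"
      by (rule octonion_projection[OF S vs
          octonion_basis_cd[OF two] iso commutator_cd(4)]; unfold commutator_cd;
          rule cd_unit_laws cd_unit_commutator)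
    then obtain e where "spans_octonions scale mul S 1 e" ..
    then show ?thesis by (intro exI[of _ "1::'f"] exI[of _ e] conjI one_neq_zero)
  next
    fix \<gamma> :: 'f assume \<gamma>: "\<gamma> \<noteq> 0" and M: "?T \<cong> division_M7 \<gamma>"
    have iso: "?T \<cong> quotient_alg (commutator_alg (oct_alg \<gamma>)) {smult (commutator_alg (oct_alg \<gamma>)) c
        (oct_basis 0) | c. True}"
      using M unfolding division_M7_def commutator_oct oct0 .
    have "\<exists>e. spans_octonions scale mul S \<gamma> e"
      by (rule octonion_projection[OF S vs octonion_basis_oct iso commutator_oct(4)]; unfold
          commutator_oct;
          rule oct_unit_laws oct_unit_commutator)
    then obtain e where "spans_octonions scale mul S \<gamma> e" ..
    with \<gamma> show ?thesis by (intro exI[of _ \<gamma>] exI[of _ e] conjI)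
  qed
qed

section \<open>Kronecker factorization\<close>

theorem theorem3p1:
  fixes scale :: "'f::field \<Rightarrow> 'm::ab_group_add \<Rightarrow> 'm"
    and mul :: "'m \<Rightarrow> 'm \<Rightarrow> 'm"
    and S :: "'m set"
  assumes "CHAR('f) \<noteq> 2" and "CHAR('f) \<noteq> 3"
    and "variety_H (type_alg scale mul)"
    and "subalgebra S (type_alg scale mul)"
    and "exceptional ((type_alg scale mul)\<lparr>carrier := S\<rparr>)"
    and "\<And>m. m \<noteq> 0 \<Longrightarrow> \<exists>a\<in>S. mul m a \<noteq> 0"
  shows "\<exists>U :: ('f, 'm) alg. comm_assoc_algebra U \<and>
           type_alg scale mul \<cong> tensor_alg ((type_alg scale mul)\<lparr>carrier := S\<rparr>) U"
proof -
  note char = two_three_nonzero[OF assms(1,2)]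
  interpret H: variety_H "type_alg scale mul" by (rule assms(3))
  have ops: "carrier (type_alg scale mul) = UNIV" "zero (type_alg scale mul) = 0"
      "add (type_alg scale mul) = (+)"
      "smult (type_alg scale mul) = scale" "mult (type_alg scale mul) = mul"
    by (simp_all add: type_alg_def)
  have vs: "vector_space scale"
    using H.smult_add H.add_smult H.smult_smult H.one_smult unfolding ops by unfold_locales auto
  interpret vector_space scale by (rule vs)
  interpret anticommutative_algebra scale mul
    using char H.mult_add_left H.mult_add_right H.mult_smult_left H.mult_smult_right H.square_zero
    unfolding ops by unfold_locales auto
  interpret sagle_space scale mul
  proof
    show "mul (mul x z) (mul y t) = mul (mul (mul x y) z) t + mul (mul (mul y z) t) x
        + mul (mul (mul z t) x) y + mul (mul (mul t x) y) z" for x z y t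
      using H.malcev unfolding ops jacobian_def by (intro sagle_identity) auto
    show "mul (mul (mul (mul m a) t) a - mul (mul (mul m a) a) t + scale 2 (mul (mul m a) (mul t a))) a
        = 0" for m a t
    proof -
      have triple: "triple_expr (type_alg scale mul) x y z = mul (mul x y) z - mul (mul x z) y
          + scale 2 (mul x (mul y z))" for x y z
        by (simp only: triple_expr_def alg_minus_def ops scale_minus_left scale_one
            add_uminus_conv_diff)
      have "triple_expr (type_alg scale mul) (mul m a) a a = 0"
        unfolding triple by (simp add: mul_self mul_zero_right)
      then have "mul (triple_expr (type_alg scale mul) (mul m a) t a) a
          + mul (triple_expr (type_alg scale mul) (mul m a) t a) a = 0"
        using H.h_zero[of m a t a a] unfolding h_expr_def ops by (simp add: mul_zero_left)
      then have "scale 2 (mul (triple_expr (type_alg scale mul) (mul m a) t a) a) = 0"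
        using scale_left_distrib[of 1 1] by simp
      then show ?thesis unfolding triple by (metis char(1) scale_eq_0_iff)
    qed
  qed
  obtain \<gamma> e where \<gamma>: "\<gamma> \<noteq> 0" and e: "spans_octonions scale mul S \<gamma> e"
    using exceptional_basis[OF char(1) assms(4) vs assms(5)] by blast
  have e: "\<And>i. i \<in> imag \<Longrightarrow> e i \<in> S" "\<And>a. a \<in> S \<Longrightarrow> \<exists>\<alpha>. a = (\<Sum>i\<in>imag. scale (\<alpha> i) (e i))"
    "\<And>i j. \<lbrakk>i \<in> imag; j \<in> imag; i \<noteq> j\<rbrakk> \<Longrightarrow> mul (e i) (e j) = scale (2 * oct_coeff \<gamma> i j) (e (i XOR j))"
    using e unfolding spans_octonions_def by blast+
  have faithful: "m = 0" if m: "\<And>i. i \<in> imag \<Longrightarrow> mul m (e i) = 0" for m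
  proof (rule ccontr)
    assume "m \<noteq> 0"
    then obtain a where a: "a \<in> S" "mul m a \<noteq> 0" using assms(6) by blast
    obtain \<alpha> where \<alpha>: "a = (\<Sum>i\<in>imag. scale (\<alpha> i) (e i))" using e(2)[OF a(1)] by blast
    have *: "mul m (\<Sum>i\<in>K. scale (\<alpha> i) (e i)) = 0" if "K \<subseteq> imag" for K
      using that
    proof (induction K rule: infinite_finite_induct)
      case (insert i K)
      then have "mul m (e i) = 0" "mul m (\<Sum>i\<in>K. scale (\<alpha> i) (e i)) = 0" using m by auto
      then show ?case unfolding sum.insert[OF insert.hyps] bilinear by simp
    qed (simp_all add: mul_zero_right)
    show False using *[OF subset_refl] a(2) unfolding \<alpha> by contradiction
  qed
  interpret octonion_frame scale mul e "oct_coeff \<gamma>" "oct_norm \<gamma>"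
  proof
    show "mul (e i) (e j) = scale (2 * oct_coeff \<gamma> i j) (e (i XOR j))" if "i \<in> imag" "j \<in> imag" "i \<noteq> j"
        for i j
      using that by (rule e(3))
    show "oct_coeff \<gamma> i j \<noteq> 0" if "i \<in> imag" "j \<in> imag" for i j
      using \<gamma> that by (rule oct_coeff_nonzero)
    show "oct_norm \<gamma> i \<noteq> 0" for i using \<gamma> by (simp add: oct_norm_def)
    show "oct_coeff \<gamma> j i = - oct_coeff \<gamma> i j" if "i \<in> imag" "j \<in> imag" "i \<noteq> j" for i j
      using that by (rule oct_coeff_skew)
    show "oct_coeff \<gamma> i j * oct_coeff \<gamma> (i XOR j) i = oct_norm \<gamma> i" if "i \<in> imag" "j \<in> imag" "i \<noteq> j"
        for i j
      using that by (rule oct_coeff_norm)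
    show "oct_coeff \<gamma> i j * oct_coeff \<gamma> (i XOR j) k = - oct_coeff \<gamma> j k * oct_coeff \<gamma> i (j XOR k)"
        if "indep i j k" for i j k
      using that by (rule oct_coeff_assoc)
    show "m = 0" if "\<And>i. i \<in> imag \<Longrightarrow> mul m (e i) = 0" for m
      using that by (rule faithful)
  qed
  have "type_alg scale mul \<cong> tensor_alg ((type_alg scale mul)\<lparr>carrier := S\<rparr>) scalar_alg"
    using assms(4) e(1,2) by (rule tensor_iso)
  with scalar_alg show ?thesis by (intro exI[of _ scalar_alg] conjI)
qed

end
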